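(* Let $\lambda_1$ be the largest eigenvalue of the sample covariance matrix $S$ constructed from $M$ independent, identically distributed complex Gaussian sample vectors of $N$ variables, and let $\ell_1,\dots,\ell_N>0$ denote the eigenvalues of the covariance matrix $\Sigma$ of the samples. Suppose that for a fixed integer $r\ge0$, $\ell_{r+1}=\ell_{r+2}=\dots=\ell_N=1$. As $M,N\to\infty$ while $M/N=\gamma^2$ is in a compact subset of $[1,\infty)$, the following holds. (a) When for some $0\le k\le r$, $\ell_1=\dots=\ell_k=1+\gamma^{-1}$, and $\ell_{k+1},\dots,\ell_r$ are in a compact subset of $(0,1+\gamma^{-1})$, $$\lambda_1\to(1+\gamma^{-1})^2\quad\text{in probability.}$$ (b) When for some $1\le k\le r$, $\ell_1=\dots=\ell_k>1+\gamma^{-1}$, with $\ell_1$ in a compact set of $(1+\gamma^{-1},\infty)$, and $\ell_{k+1},\dots,\ell_r$ are in a compact subset of $(0,\ell_1)$, $$\lambda_1\to\ell_1\left(1+\frac{\gamma^{-2}}{\ell_1-1}\right)\quad\text{in probability.}$$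
   Context: **Sample covariance matrix.** $\vec y_1,\dots,\vec y_M\in\mathbb{C}^N$ are i.i.d. (circularly symmetric) complex Gaussian column vectors with mean $\vec\mu$ and covariance $\Sigma=\mathbb{E}[(\vec y-\vec\mu)(\vec y-\vec\mu)^*]$, where $\Sigma$ is a fixed $N\times N$ positive definite Hermitian matrix, i.e. $\vec y$ has density proportional to $e^{-(\vec y-\vec\mu)^*\Sigma^{-1}(\vec y-\vec\mu)}$. Put $\overline Y=\frac1M(\vec y_1+\dots+\vec y_M)$, $X=[\vec y_1-\overline Y,\dots,\vec y_M-\overline Y]$ (an $N\times M$ matrix) and $S=\frac1M XX^*$, where $X^*$ is the conjugate transpose. **Conventions on parameters.** The integers $r,k$ are fixed; $\gamma\ge1$ and the $\ell_j$ ($j\le r$) may vary with $M,N$, in which case convergence in probability means that the difference of the two sides tends to $0$ in probability. "In a compact subset" of an interval whose endpoints may depend on the parameters means staying uniformly away from the endpoints (and bounded, if an endpoint is $\infty$). *)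

theory Defs
  imports "HOL-Probability.Probability" "Jordan_Normal_Form.Spectral_Radius"
begin

hide_type (open) Finite_Cartesian_Product.vec
hide_const (open) Finite_Cartesian_Product.vec Finite_Cartesian_Product.mat
no_notation Finite_Cartesian_Product.vec_nth (infixl \<open>$\<close> 90)
no_notation Inner_Product.real_inner_class.inner (infix \<open>\<bullet>\<close> 70)

text \<open>
  Complex \<open>N\<close>-space with its Borel sigma-algebra and Lebesgue measure. The product measure
  lives on functions \<open>{..<N} \<rightarrow>\<^sub>E UNIV\<close>, on which \<^term>\<open>Matrix.vec N\<close> is a bijection to
  \<^term>\<open>carrier_vec N\<close>; \<open>complex\<close> itself carries two-dimensional Lebesgue measure.
\<close>

definition lborel_cvec :: "nat \<Rightarrow> complex vec measure" where
  "lborel_cvec N = embed_measure (\<Pi>\<^sub>M i\<in>{..<N}. (lborel :: complex measure)) (Matrix.vec N)"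

lemma inj_on_vec_PiM: "inj_on (Matrix.vec N) (space (\<Pi>\<^sub>M i\<in>{..<N}. (lborel :: complex measure)))"
proof (rule inj_onI)
  fix f g :: "nat \<Rightarrow> complex"
  assume f: "f \<in> space (\<Pi>\<^sub>M i\<in>{..<N}. lborel)" and g: "g \<in> space (\<Pi>\<^sub>M i\<in>{..<N}. lborel)"
    and eq: "Matrix.vec N f = Matrix.vec N g"
  have "f i = g i" if "i < N" for i
    using arg_cong[OF eq, of "\<lambda>v. v $ i"] that by simp
  with f g show "f = g"
    by (auto simp: space_PiM intro: PiE_ext)
qed

lemma space_lborel_cvec: "space (lborel_cvec N) = carrier_vec N"
proof
  show "space (lborel_cvec N) \<subseteq> carrier_vec N"
    by (auto simp: lborel_cvec_def space_embed_measure)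
  show "carrier_vec N \<subseteq> space (lborel_cvec N)"
  proof
    fix v :: "complex vec" assume v: "v \<in> carrier_vec N"
    then have "v = Matrix.vec N (restrict (vec_index v) {..<N})" by auto
    then show "v \<in> space (lborel_cvec N)"
      unfolding lborel_cvec_def space_embed_measure space_PiM
      by (intro image_eqI[where x = "restrict (vec_index v) {..<N}"]) auto
  qed
qed

definition hermitian_pos_def :: "nat \<Rightarrow> complex mat \<Rightarrow> bool" where
  "hermitian_pos_def N A \<longleftrightarrow> A \<in> carrier_mat N N \<and> mat_adjoint A = A \<and>
     (\<forall>v \<in> carrier_vec N. v \<noteq> 0\<^sub>v N \<longrightarrow> 0 < Re ((A *\<^sub>v v) \<bullet>c v))"

text \<open>
  Circularly symmetric complex Gaussian law with mean \<open>\<mu>\<close> and (positive definite) covariance \<open>\<Sigma>\<close>: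
  the density is proportional to \<open>exp (- (v - \<mu>)\<^sup>* \<Sigma>\<^sup>-\<^sup>1 (v - \<mu>))\<close>. Note that \<open>w\<^sup>* A w\<close> is
  \<^term>\<open>(A *\<^sub>v w) \<bullet>c w\<close>, since \<open>\<bullet>c\<close> conjugates its second argument.
\<close>

definition complex_gaussian ::
    "'a measure \<Rightarrow> nat \<Rightarrow> complex vec \<Rightarrow> complex mat \<Rightarrow> ('a \<Rightarrow> complex vec) \<Rightarrow> bool" where
  "complex_gaussian P N \<mu> \<Sigma> y \<longleftrightarrow>
     (\<exists>c::real. distributed P (lborel_cvec N) y
        (\<lambda>v. ennreal (c * exp (- Re ((the (mat_inverse \<Sigma>) *\<^sub>v (v - \<mu>)) \<bullet>c (v - \<mu>))))))"

definition sample_mean :: "nat \<Rightarrow> nat \<Rightarrow> (nat \<Rightarrow> complex vec) \<Rightarrow> complex vec" where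
  "sample_mean N M y = Matrix.vec N (\<lambda>i. (\<Sum>j<M. y j $ i) / of_nat M)"

definition centered_sample :: "nat \<Rightarrow> nat \<Rightarrow> (nat \<Rightarrow> complex vec) \<Rightarrow> complex mat" where
  "centered_sample N M y = mat_of_cols N (map (\<lambda>j. y j - sample_mean N M y) [0..<M])"

definition sample_covariance :: "nat \<Rightarrow> nat \<Rightarrow> (nat \<Rightarrow> complex vec) \<Rightarrow> complex mat" where
  "sample_covariance N M y =
     (let X = centered_sample N M y in (1 / of_nat M) \<cdot>\<^sub>m (X * mat_adjoint X))"

text \<open>Used for Hermitian matrices only, whose eigenvalues are all real.\<close>

definition largest_eigenvalue :: "complex mat \<Rightarrow> real" where
  "largest_eigenvalue A = Max {x. eigenvalue A (complex_of_real x)}"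

text \<open>
  The variables may live on different probability spaces. Measurability is part of the definition
  because \<^const>\<open>measure\<close> is \<open>0\<close> on non-measurable sets.
\<close>

definition tends_to_zero_in_prob :: "(nat \<Rightarrow> 'a measure) \<Rightarrow> (nat \<Rightarrow> 'a \<Rightarrow> real) \<Rightarrow> bool" where
  "tends_to_zero_in_prob P Z \<longleftrightarrow>
     (\<forall>n. Z n \<in> borel_measurable (P n)) \<and>
     (\<forall>\<epsilon>>0. (\<lambda>n. measure (P n) {\<omega> \<in> space (P n). \<epsilon> < \<bar>Z n \<omega>\<bar>}) \<longlonglongrightarrow> 0)"

end

theory Submission
  imports Defs "HOL-Real_Asymp.Real_Asymp"
begin

text \<open>
  After whitening, diagonalizing \<open>\<Sigma>\<close> and rotating away the sample mean, the event
  \<open>\<lambda>\<^sub>1 \<le> t / M\<close> says that a matrix \<open>G\<close> of independent standard complex Gaussians with \<open>M - 1\<close>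
  columns satisfies \<open>\<Sum>\<^sub>j |\<Sum>\<^sub>i x\<^sub>i G\<^sub>i\<^sub>j|\<^sup>2 \<le> t \<Sum>\<^sub>i |x\<^sub>i|\<^sup>2 / \<ell>\<^sub>i\<close> for all \<open>x\<close>. With a single spike \<open>\<ell>\<close>
  this is \<open>G G\<^sup>* + s e e\<^sup>* \<le> t\<close> for \<open>s = t (1 - 1 / \<ell>)\<close>. A Schur complement in the spiked row followed
  by a rotation of the columns, and the splitting of one column followed by a rotation of the rows,
  turn this event into the same one for a matrix with one row and one column less and with
  \<open>s' = |b|\<^sup>2 (t - s) / (t - s - |a|\<^sup>2)\<close>, where \<open>|a|\<^sup>2\<close> and \<open>|b|\<^sup>2\<close> are independent Gamma variables
  close to \<open>M\<close> and \<open>N\<close>. On the scale \<open>M\<close>, with \<open>c = N / M\<close> and \<open>w = (t - s) / M\<close>, the recursion is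
  \<open>w' = \<tau> - c w / (w - 1)\<close>. If \<open>\<tau>\<close> exceeds the claimed limit, the recursion never leaves the region
  \<open>w > 1\<close> and a union bound with Chernoff estimates applies; if \<open>\<tau>\<close> is below it, then \<open>w\<close> decreases by
  a fixed amount in every step and drops below \<open>1\<close>, where the event is impossible, after boundedly many
  steps. Several spikes are reduced to one by a finite net of the unit sphere of the spiked subspace.
\<close>

section \<open>Gaussian measures on coordinate spaces\<close>

text \<open>The limits are read off the map w -> \<tau> - c w / (w - 1). A point is fixed when w + c
  w / (w - 1) = \<tau>; over w > 1 the left side has minimum (1 + sqrt c)^2, at w = 1 + sqrt c, so
  for smaller \<tau> there is no fixed point and every orbit falls. A spike l starts the orbit at
  \<tau> / l, and \<tau> = l (1 + c / (l - 1)) says that this start is fixed. For l > 1 + sqrt c it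
  lies left of the minimum, where fixed points repel, so the orbit falls as soon as \<tau> is
  smaller; hence the threshold.

  The two directions use the recursion differently. For the upper bound all rows may be consumed:
  shrinking lengths only improve upper tails, and N exponentially small errors remain small. For the
  lower bound shrinking lengths hurt, so the number of steps must not depend on M.

  No Jacobian is ever computed: uniqueness of the translation invariant measure determines each
  push-forward up to a constant, which total mass 1 fixes.\<close>

lemma PiM_lborel_translate:
  fixes a :: "'i \<Rightarrow> complex"
  assumes fin: "finite I"
  shows "distr (PiM I (\<lambda>_. lborel)) (PiM I (\<lambda>_. lborel)) (\<lambda>x. \<lambda>i\<in>I. x i + a i)
    = PiM I (\<lambda>_. lborel)"
proof -
  interpret product_sigma_finite "\<lambda>_::'i. lborel :: complex measure"
    by (simp add: product_sigma_finite_def sigma_finite_lborel)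
  have m: "(\<lambda>x. \<lambda>i\<in>I. x i + a i) \<in> measurable (PiM I (\<lambda>_. lborel)) (PiM I (\<lambda>_. lborel :: complex measure))"
    by measurable
  show ?thesis
  proof (rule PiM_eqI[OF fin])
    fix A :: "'i \<Rightarrow> complex set" assume A: "\<And>i. i \<in> I \<Longrightarrow> A i \<in> sets lborel"
    have [measurable]: "(\<lambda>z. z + a i) -` A i \<in> sets lborel" if "i \<in> I" for i
      using measurable_sets[of "\<lambda>z. z + a i" borel borel "A i"] A[OF that] by simp
    have eq: "(\<lambda>x. \<lambda>i\<in>I. x i + a i) -` Pi\<^sub>E I A \<inter> space (PiM I (\<lambda>_. lborel :: complex measure))
       = Pi\<^sub>E I (\<lambda>i. (\<lambda>z. z + a i) -` A i)"
      by (auto simp: space_PiM PiE_iff)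
    have "emeasure (distr (PiM I (\<lambda>_. lborel)) (PiM I (\<lambda>_. lborel)) (\<lambda>x. \<lambda>i\<in>I. x i + a i)) (Pi\<^sub>E I A)
      = (\<Prod>i\<in>I. emeasure lborel ((\<lambda>z. z + a i) -` A i))"
      using A \<open>\<And>i. i \<in> I \<Longrightarrow> (\<lambda>z. z + a i) -` A i \<in> sets lborel\<close>
      by (subst emeasure_distr[OF m]) (auto simp: eq fin intro!: emeasure_PiM sets_PiM_I_finite)
    also have "\<dots> = (\<Prod>i\<in>I. emeasure lborel (A i))"
    proof (rule prod.cong[OF refl])
      fix i assume i: "i \<in> I"
      have "emeasure (lborel :: complex measure) (A i) = emeasure (distr lborel borel (\<lambda>z. a i + z)) (A i)"
        by (simp add: lborel_distr_plus)
      also have "\<dots> = emeasure lborel ((\<lambda>z. a i + z) -` A i)"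
        using A[OF i] by (subst emeasure_distr) auto
      also have "(\<lambda>z. a i + z) = (\<lambda>z. z + a i)" by (simp add: add.commute)
      finally show "emeasure lborel ((\<lambda>z. z + a i) -` A i) = emeasure lborel (A i)" ..
    qed
    finally show "emeasure (distr (PiM I (\<lambda>_. lborel)) (PiM I (\<lambda>_. lborel)) (\<lambda>x. \<lambda>i\<in>I. x i + a i)) (Pi\<^sub>E I A)
      = (\<Prod>i\<in>I. emeasure lborel (A i))" .
  qed simp
qed

text \<open>Weil's argument for the uniqueness of Haar measure: Fubini and the invariance of both
  measures turn \<open>\<lambda>(A) \<nu>(B)\<close> into \<open>\<nu>(-A) \<lambda>(B)\<close>, and \<open>A\<close> is taken to be the unit cube.\<close>

lemma translation_invariant_unique:
  fixes \<nu> :: "('i \<Rightarrow> complex) measure"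
  assumes fin: "finite I"
    and sf: "sigma_finite_measure \<nu>"
    and sets_nu: "sets \<nu> = sets (PiM I (\<lambda>_. lborel :: complex measure))"
    and inv: "\<And>a. distr \<nu> (PiM I (\<lambda>_. lborel)) (\<lambda>x. \<lambda>i\<in>I. x i + a i) = \<nu>"
  shows "\<exists>C. \<forall>B\<in>sets \<nu>. emeasure \<nu> B = C * emeasure (PiM I (\<lambda>_. lborel)) B"
proof -
  interpret psf: product_sigma_finite "\<lambda>_::'i. lborel :: complex measure"
    by (simp add: product_sigma_finite_def sigma_finite_lborel)
  define L where "L = PiM I (\<lambda>_. lborel :: complex measure)"
  define add where "add x y = (\<lambda>i\<in>I. x i + y i)" for x y :: "'i \<Rightarrow> complex"
  define neg where "neg x = (\<lambda>i\<in>I. - x i)" for x :: "'i \<Rightarrow> complex"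
  interpret L: sigma_finite_measure L
    unfolding L_def by (rule psf.sigma_finite[OF fin])
  interpret nu: sigma_finite_measure \<nu> by fact
  interpret pair_sigma_finite L \<nu> ..
  have sp: "space \<nu> = space L" using sets_nu sets_eq_imp_space_eq unfolding L_def by blast
  have sets_nu': "sets \<nu> = sets L" using sets_nu by (simp add: L_def)
  note [measurable_cong] = sets_nu'
  have [measurable]: "(\<lambda>(x,y). add x y) \<in> measurable (L \<Otimes>\<^sub>M L) L"
    unfolding add_def L_def by measurable
  have [measurable]: "neg \<in> measurable L L"
    unfolding neg_def L_def by measurable
  have inv_nu: "(\<integral>\<^sup>+x. f (add x a) \<partial>\<nu>) = (\<integral>\<^sup>+x. f x \<partial>\<nu>)"
    if [measurable]: "f \<in> borel_measurable L" and a[measurable]: "a \<in> space L" for f a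
  proof -
    have [measurable]: "(\<lambda>x. add x a) \<in> measurable \<nu> L" by measurable
    have "(\<integral>\<^sup>+x. f x \<partial>\<nu>) = (\<integral>\<^sup>+x. f x \<partial>distr \<nu> L (\<lambda>x. add x a))"
      using inv[of a] unfolding add_def L_def by simp
    also have "\<dots> = (\<integral>\<^sup>+x. f (add x a) \<partial>\<nu>)"
      by (subst nn_integral_distr) auto
    finally show ?thesis ..
  qed
  have inv_L: "(\<integral>\<^sup>+x. f (add x a) \<partial>L) = (\<integral>\<^sup>+x. f x \<partial>L)"
    if [measurable]: "f \<in> borel_measurable L" and a[measurable]: "a \<in> space L" for f a
  proof -
    have [measurable]: "(\<lambda>x. add x a) \<in> measurable L L" by measurable
    have "(\<integral>\<^sup>+x. f x \<partial>L) = (\<integral>\<^sup>+x. f x \<partial>distr L L (\<lambda>x. add x a))"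
      using PiM_lborel_translate[OF fin, of a] unfolding add_def L_def by simp
    also have "\<dots> = (\<integral>\<^sup>+x. f (add x a) \<partial>L)"
      by (subst nn_integral_distr) auto
    finally show ?thesis ..
  qed
  have spL: "space L = PiE I (\<lambda>_. UNIV)" by (simp add: L_def space_PiM)
  have neg_sp: "neg x \<in> space L" for x by (auto simp: spL neg_def)
  have add_neg: "add (add y x) (neg y) = x" "add x (neg (add y x)) = neg y"
      "add y (add x (neg y)) = x" if "x \<in> space L" "y \<in> space L" for x y
    using that by (auto simp: spL add_def neg_def fun_eq_iff PiE_iff extensional_def)
  define A where "A = PiE I (\<lambda>_. cbox 0 (Complex 1 1))"
  have A[measurable]: "A \<in> sets L" unfolding A_def L_def using fin by (intro sets_PiM_I_finite) auto
  have cube: "emeasure lborel (cbox 0 (Complex 1 1)) = 1"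
    by (subst emeasure_lborel_cbox) (auto simp: Basis_complex_def inner_complex_def)
  have LA: "emeasure L A = 1"
    unfolding A_def L_def using fin cube by (subst psf.emeasure_PiM) auto
  define C where "C = (\<integral>\<^sup>+y. indicator A (neg y) \<partial>\<nu>)"
  have "emeasure \<nu> B = C * emeasure L B" if B: "B \<in> sets \<nu>" for B
  proof -
    have [measurable]: "B \<in> sets L" using B by (simp add: sets_nu')
    have "emeasure \<nu> B = emeasure L A * emeasure \<nu> B" by (simp add: LA)
    also have "\<dots> = (\<integral>\<^sup>+x. indicator A x * emeasure \<nu> B \<partial>L)"
      by (subst nn_integral_multc) auto
    also have "\<dots> = (\<integral>\<^sup>+x. (\<integral>\<^sup>+y. indicator A x * indicator B (add y x) \<partial>\<nu>) \<partial>L)"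
    proof (rule nn_integral_cong)
      fix x assume x[measurable]: "x \<in> space L"
      have [measurable]: "(\<lambda>y. add y x) \<in> measurable L L" by measurable
      have "(\<integral>\<^sup>+y. indicator A x * indicator B (add y x) \<partial>\<nu>)
          = indicator A x * (\<integral>\<^sup>+y. indicator B (add y x) \<partial>\<nu>)"
        by (rule nn_integral_cmult) measurable
      also have "(\<integral>\<^sup>+y. indicator B (add y x) \<partial>\<nu>) = (\<integral>\<^sup>+y. indicator B y \<partial>\<nu>)"
        by (rule inv_nu) (use x in auto)
      finally show "indicator A x * emeasure \<nu> B = (\<integral>\<^sup>+y. indicator A x * indicator B (add y x) \<partial>\<nu>)"
        using B by simp
    qed
    also have "\<dots> = (\<integral>\<^sup>+y. (\<integral>\<^sup>+x. indicator A x * indicator B (add y x) \<partial>L) \<partial>\<nu>)"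
      by (rule Fubini'[symmetric]) measurable
    also have "\<dots> = (\<integral>\<^sup>+y. (\<integral>\<^sup>+x. indicator A (add x (neg y)) * indicator B x \<partial>L) \<partial>\<nu>)"
    proof (rule nn_integral_cong)
      fix y assume "y \<in> space \<nu>"
      then have y[measurable]: "y \<in> space L" by (simp add: sp)
      have [measurable]: "(\<lambda>x. add y x) \<in> measurable L L" by measurable
      have "(\<integral>\<^sup>+x. indicator A x * indicator B (add y x) \<partial>L)
        = (\<integral>\<^sup>+x. indicator A (add x (neg y)) * indicator B (add y (add x (neg y))) \<partial>L)"
        by (rule inv_L[symmetric, where f = "\<lambda>x. indicator A x * indicator B (add y x)"])
          (auto simp: neg_sp)
      also have "\<dots> = (\<integral>\<^sup>+x. indicator A (add x (neg y)) * indicator B x \<partial>L)"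
        by (rule nn_integral_cong) (simp add: add_neg y)
      finally show "(\<integral>\<^sup>+x. indicator A x * indicator B (add y x) \<partial>L)
        = (\<integral>\<^sup>+x. indicator A (add x (neg y)) * indicator B x \<partial>L)" .
    qed
    also have "\<dots> = (\<integral>\<^sup>+x. (\<integral>\<^sup>+y. indicator A (add x (neg y)) * indicator B x \<partial>\<nu>) \<partial>L)"
      by (rule Fubini') measurable
    also have "\<dots> = (\<integral>\<^sup>+x. C * indicator B x \<partial>L)"
    proof (rule nn_integral_cong)
      fix x assume x[measurable]: "x \<in> space L"
      have [measurable]: "(\<lambda>y. add x y) \<in> measurable L L" by measurable
      have "(\<integral>\<^sup>+y. indicator A (add x (neg y)) * indicator B x \<partial>\<nu>)
        = (\<integral>\<^sup>+y. indicator A (add x (neg y)) \<partial>\<nu>) * indicator B x"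
        by (rule nn_integral_multc) measurable
      also have "(\<integral>\<^sup>+y. indicator A (add x (neg y)) \<partial>\<nu>)
        = (\<integral>\<^sup>+y. indicator A (add x (neg (add y x))) \<partial>\<nu>)"
        by (rule inv_nu[symmetric, where f = "\<lambda>y. indicator A (add x (neg y))"]) (use x in auto)
      also have "\<dots> = C" unfolding C_def
        by (rule nn_integral_cong) (simp add: add_neg x sp)
      finally show "(\<integral>\<^sup>+y. indicator A (add x (neg y)) * indicator B x \<partial>\<nu>) = C * indicator B x" .
    qed
    also have "\<dots> = C * emeasure L B" by (subst nn_integral_cmult) auto
    finally show ?thesis .
  qed
  thus ?thesis unfolding L_def by blast
qed


section \<open>Standard complex Gaussians and their unitary invariance\<close>

definition cgauss :: "complex measure" where
  "cgauss = density lborel (\<lambda>z. ennreal (exp (- (cmod z)\<^sup>2) / pi))"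

lemma sets_cgauss [simp, measurable_cong]: "sets cgauss = sets borel"
  and space_cgauss [simp]: "space cgauss = UNIV"
  by (simp_all add: cgauss_def)

lemma nn_integral_exp_square_real:
  assumes "b > 0"
  shows "(\<integral>\<^sup>+x. ennreal (exp (- b * x\<^sup>2)) \<partial>lborel) = ennreal (sqrt (pi / b))"
proof -
  define s where "s = sqrt (1 / (2 * b))"
  have s: "s > 0" "s\<^sup>2 = 1 / (2 * b)" using assms by (auto simp: s_def)
  have eq: "exp (- b * x\<^sup>2) = sqrt (pi / b) * normal_density 0 s x" for x
  proof -
    have "2 * pi * s\<^sup>2 = pi / b" "(x - 0)\<^sup>2 / (2 * s\<^sup>2) = b * x\<^sup>2"
      using assms by (simp_all add: s(2) field_simps)
    thus ?thesis using assms by (simp add: normal_density_def)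
  qed
  have "(\<integral>\<^sup>+x. ennreal (normal_density 0 s x) \<partial>lborel) = 1"
    using s by (subst nn_integral_eq_integral) (auto simp: normal_density_nonneg)
  thus ?thesis unfolding eq using assms
    by (simp add: ennreal_mult' nn_integral_cmult)
qed

lemma nn_integral_exp_square_complex:
  assumes "b > 0"
  shows "(\<integral>\<^sup>+z. ennreal (exp (- b * (cmod z)\<^sup>2)) \<partial>lborel) = ennreal (pi / b)"
proof -
  have "(\<integral>\<^sup>+z. ennreal (exp (- b * (cmod z)\<^sup>2)) \<partial>lborel)
     = (\<integral>\<^sup>+(z::complex). (\<Prod>e\<in>Basis. ennreal (exp (- b * (inner z e)\<^sup>2))) \<partial>lborel)"
    by (rule nn_integral_cong)
       (simp add: Basis_complex_def inner_complex_def cmod_power2 ennreal_mult'[symmetric]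
          exp_add[symmetric] algebra_simps)
  also have "\<dots> = (\<Prod>e\<in>(Basis::complex set). (\<integral>\<^sup>+x. ennreal (exp (- b * x\<^sup>2)) \<partial>lborel))"
    by (rule nn_integral_lborel_prod) auto
  also have "\<dots> = ennreal (pi / b)"
    using assms by (subst nn_integral_exp_square_real)
      (auto simp: Basis_complex_def ennreal_mult'[symmetric])
  finally show ?thesis .
qed

lemma prob_space_cgauss: "prob_space cgauss"
proof
  have "emeasure cgauss (space cgauss) = (\<integral>\<^sup>+z. ennreal (1 / pi) * ennreal (exp (- 1 * (cmod z)\<^sup>2)) \<partial>lborel)"
    unfolding cgauss_def
    by (subst emeasure_density) (auto simp: ennreal_mult'[symmetric] intro!: nn_integral_cong)
  also have "\<dots> = 1"
    by (subst nn_integral_cmult, simp, subst nn_integral_exp_square_complex)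
       (auto simp: ennreal_mult'[symmetric])
  finally show "emeasure cgauss (space cgauss) = 1" .
qed

text \<open>Under \<open>cgauss\<close> the variable |z|^2 is exponential with mean 1, so the
  squared norm of a finite family is a Gamma variable. All tail bounds come from this Laplace
  transform.\<close>

lemma nn_integral_cgauss_exp:
  assumes "\<theta> < 1"
  shows "(\<integral>\<^sup>+z. ennreal (exp (\<theta> * (cmod z)\<^sup>2)) \<partial>cgauss) = ennreal (1 / (1 - \<theta>))"
proof -
  have "(\<integral>\<^sup>+z. ennreal (exp (\<theta> * (cmod z)\<^sup>2)) \<partial>cgauss)
     = (\<integral>\<^sup>+z. ennreal (1 / pi) * ennreal (exp (- (1 - \<theta>) * (cmod z)\<^sup>2)) \<partial>lborel)"
    unfolding cgauss_def
    by (subst nn_integral_density)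
       (auto simp: ennreal_mult'[symmetric] exp_add[symmetric] algebra_simps intro!: nn_integral_cong)
  also have "\<dots> = ennreal (1 / (1 - \<theta>))"
    using assms by (subst nn_integral_cmult, simp, subst nn_integral_exp_square_complex)
       (auto simp: ennreal_mult'[symmetric])
  finally show ?thesis .
qed

abbreviation gauss :: "'i set \<Rightarrow> ('i \<Rightarrow> complex) measure" where
  "gauss K \<equiv> PiM K (\<lambda>_. cgauss)"

interpretation cgauss: product_sigma_finite "\<lambda>_. cgauss"
  by (simp add: product_sigma_finite_def prob_space_cgauss prob_space_imp_sigma_finite)

lemma sets_PiM_cgauss: "sets (gauss I) = sets (PiM I (\<lambda>_. lborel))"
  by (intro sets_PiM_cong) auto

lemma PiM_cgauss_density:
  assumes fin: "finite I"
  shows "gauss I =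
    density (PiM I (\<lambda>_. lborel)) (\<lambda>x. ennreal (exp (- (\<Sum>i\<in>I. (cmod (x i))\<^sup>2)) / pi ^ card I))"
proof (rule sym, rule cgauss.PiM_eqI[OF fin])
  interpret psf: product_sigma_finite "\<lambda>_::'a. lborel :: complex measure"
    by (simp add: product_sigma_finite_def sigma_finite_lborel)
  show "sets (density (PiM I (\<lambda>_. lborel)) (\<lambda>x. ennreal (exp (- (\<Sum>i\<in>I. (cmod (x i))\<^sup>2)) / pi ^ card I)))
     = sets (gauss I)"
    by (simp add: sets_PiM_cgauss)
  fix A :: "'a \<Rightarrow> complex set" assume "\<And>i. i \<in> I \<Longrightarrow> A i \<in> sets cgauss"
  then have A: "\<And>i. i \<in> I \<Longrightarrow> A i \<in> sets borel" by simp
  have box: "Pi\<^sub>E I A \<in> sets (PiM I (\<lambda>_. lborel))" using fin A by (intro sets_PiM_I_finite) auto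
  have "emeasure (density (PiM I (\<lambda>_. lborel)) (\<lambda>x. ennreal (exp (- (\<Sum>i\<in>I. (cmod (x i))\<^sup>2)) / pi ^ card I))) (Pi\<^sub>E I A)
    = (\<integral>\<^sup>+x. ennreal (exp (- (\<Sum>i\<in>I. (cmod (x i))\<^sup>2)) / pi ^ card I) * indicator (Pi\<^sub>E I A) x \<partial>(PiM I (\<lambda>_. lborel)))"
    using box by (subst emeasure_density) auto
  also have "\<dots> = (\<integral>\<^sup>+x. (\<Prod>i\<in>I. ennreal (exp (- (cmod (x i))\<^sup>2) / pi) * indicator (A i) (x i)) \<partial>(PiM I (\<lambda>_. lborel)))"
  proof (rule nn_integral_cong)
    fix x assume "x \<in> space (PiM I (\<lambda>_. lborel :: complex measure))"
    then have x: "x \<in> extensional I" by (auto simp: space_PiM PiE_def)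
    have 1: "(\<Prod>i\<in>I. ennreal (exp (- (cmod (x i))\<^sup>2) / pi)) = ennreal (exp (- (\<Sum>i\<in>I. (cmod (x i))\<^sup>2)) / pi ^ card I)"
      by (subst prod_ennreal) (auto simp: prod_dividef exp_sum[OF fin] sum_negf[symmetric])
    have 2: "(\<Prod>i\<in>I. indicator (A i) (x i)) = (indicator (Pi\<^sub>E I A) x :: ennreal)"
      using x fin by (auto simp: indicator_def PiE_iff prod_zero_iff)
    show "ennreal (exp (- (\<Sum>i\<in>I. (cmod (x i))\<^sup>2)) / pi ^ card I) * indicator (Pi\<^sub>E I A) x
      = (\<Prod>i\<in>I. ennreal (exp (- (cmod (x i))\<^sup>2) / pi) * indicator (A i) (x i))"
      by (simp add: prod.distrib 1 2)
  qed
  also have "\<dots> = (\<Prod>i\<in>I. \<integral>\<^sup>+z. ennreal (exp (- (cmod z)\<^sup>2) / pi) * indicator (A i) z \<partial>lborel)"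
    using A by (intro psf.product_nn_integral_prod[OF fin]) auto
  also have "\<dots> = (\<Prod>i\<in>I. emeasure cgauss (A i))"
    using A by (intro prod.cong) (auto simp: cgauss_def emeasure_density)
  finally show "emeasure (density (PiM I (\<lambda>_. lborel)) (\<lambda>x. ennreal (exp (- (\<Sum>i\<in>I. (cmod (x i))\<^sup>2)) / pi ^ card I))) (Pi\<^sub>E I A)
    = (\<Prod>i\<in>I. emeasure cgauss (A i))" .
qed

text \<open>The push-forward of \<open>M0\<close> under \<open>\<Phi>\<close> is translation
  invariant, hence \<open>C\<close> times Lebesgue measure, and the density depends on
  \<open>\<Phi>\<close> only. So the result is a constant multiple of \<open>gauss I\<close>, and
  both have mass 1. The left inverse \<open>\<Psi>\<close> makes the push-forward sigma-finite: it
  carries a countable cover by sets of finite measure over to \<open>L\<close>.\<close>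

lemma distr_gaussian_density:
  fixes \<Phi> :: "'b \<Rightarrow> 'i \<Rightarrow> complex" and L :: "('i \<Rightarrow> complex) measure"
  assumes L_def: "L = PiM I (\<lambda>_. lborel)"
    and fin: "finite I" and sf: "sigma_finite_measure M0"
    and \<Phi>[measurable]: "\<Phi> \<in> measurable M0 L" and \<Psi>[measurable]: "\<Psi> \<in> measurable L M0"
    and \<Psi>\<Phi>: "\<And>x. x \<in> space M0 \<Longrightarrow> \<Psi> (\<Phi> x) = x"
    and inv: "\<And>a. distr (distr M0 L \<Phi>) L (\<lambda>x. \<lambda>i\<in>I. x i + a i) = distr M0 L \<Phi>"
    and c: "c \<ge> 0"
    and prob: "prob_space (density M0 (\<lambda>x. ennreal (c * exp (- (\<Sum>i\<in>I. (cmod (\<Phi> x i))\<^sup>2)))))"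
  shows "distr (density M0 (\<lambda>x. ennreal (c * exp (- (\<Sum>i\<in>I. (cmod (\<Phi> x i))\<^sup>2))))) L \<Phi>
    = gauss I"
proof -
  interpret M0: sigma_finite_measure M0 by fact
  define \<nu> where "\<nu> = distr M0 L \<Phi>"
  define h where "h x = ennreal (c * exp (- (\<Sum>i\<in>I. (cmod (x i))\<^sup>2)))" for x :: "'i \<Rightarrow> complex"
  define D where "D = density M0 (\<lambda>x. h (\<Phi> x))"
  have h[measurable]: "h \<in> borel_measurable L" unfolding h_def L_def by measurable
  have sf_nu: "sigma_finite_measure \<nu>"
  proof -
    obtain A where A: "countable A" "A \<subseteq> sets M0" "\<Union>A = space M0" "\<forall>a\<in>A. emeasure M0 a \<noteq> \<infinity>"
      using M0.sigma_finite_countable by auto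
    let ?B = "(\<lambda>a. \<Psi> -` a \<inter> space L) ` A"
    have B: "?B \<subseteq> sets \<nu>" using A(2) measurable_sets[OF \<Psi>] by (auto simp: \<nu>_def)
    have fin_B: "emeasure \<nu> (\<Psi> -` a \<inter> space L) \<noteq> \<infinity>" if a: "a \<in> A" for a
    proof -
      have "a \<in> sets M0" using A a by auto
      have eq: "\<Phi> -` (\<Psi> -` a \<inter> space L) \<inter> space M0 = a"
        using \<Psi>\<Phi> measurable_space[OF \<Phi>] sets.sets_into_space[OF \<open>a \<in> sets M0\<close>] by auto
      have "emeasure \<nu> (\<Psi> -` a \<inter> space L) = emeasure M0 a"
        unfolding \<nu>_def using measurable_sets[OF \<Psi> \<open>a \<in> sets M0\<close>]
        by (subst emeasure_distr) (simp_all only: eq \<Phi> sets_distr)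
      thus ?thesis using A a by auto
    qed
    have "\<Union>?B = space \<nu>"
    proof -
      have "\<Psi> x \<in> space M0" if "x \<in> space L" for x using that measurable_space[OF \<Psi>] by auto
      thus ?thesis unfolding A(3)[symmetric] by (auto simp: \<nu>_def)
    qed
    thus ?thesis using A(1) B fin_B
      by (intro sigma_finite_measure.intro exI[of _ ?B]) auto
  qed
  obtain C where C: "\<And>B. B \<in> sets \<nu> \<Longrightarrow> emeasure \<nu> B = C * emeasure L B"
    using translation_invariant_unique[OF fin sf_nu] inv unfolding \<nu>_def L_def by auto
  have sets_nu: "sets \<nu> = sets L" by (simp add: \<nu>_def)
  have \<nu>: "\<nu> = density L (\<lambda>_. C)"
    by (rule measure_eqI) (simp_all add: C sets_nu emeasure_density_const)
  let ?G = "gauss I :: ('i \<Rightarrow> complex) measure"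
  interpret G: prob_space ?G by (intro prob_space_PiM prob_space_cgauss)
  have D1: "distr D L \<Phi> = density \<nu> h"
    unfolding D_def \<nu>_def by (rule density_distr[symmetric]) auto
  \<comment> \<open>\<open>C\<close> is an extended real and \<open>c\<close> an unspecified
    normalisation; total mass 1 pins down only this combination of the two.\<close>
  define k where "k = C * ennreal (c * pi ^ card I)"
  have D2: "distr D L \<Phi> = density ?G (\<lambda>_. k)"
  proof -
    let ?g = "\<lambda>x. ennreal (exp (- (\<Sum>i\<in>I. (cmod (x i))\<^sup>2)) / pi ^ card I)"
    have [measurable]: "?g \<in> borel_measurable L" unfolding L_def by measurable
    have h': "C * h x = ?g x * k" for x
    proof -
      have "h x = ennreal (c * pi ^ card I) * ?g x"
        using c by (simp add: h_def ennreal_mult'[symmetric])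
      thus ?thesis by (simp add: k_def mult_ac)
    qed
    have "distr D L \<Phi> = density L (\<lambda>x. C * h x)"
      unfolding D1 \<nu> by (rule density_density_eq) auto
    also have "\<dots> = density (density L ?g) (\<lambda>_. k)"
      unfolding h' by (rule density_density_eq[symmetric]) measurable
    also have "density L ?g = ?G" unfolding L_def by (rule PiM_cgauss_density[OF fin, symmetric])
    finally show ?thesis .
  qed
  have "prob_space (distr D L \<Phi>)"
    using prob unfolding D_def h_def by (intro prob_space.prob_space_distr) auto
  from prob_space.emeasure_space_1[OF this] have "k = 1"
    by (simp add: D2 emeasure_density_const G.emeasure_space_1)
  with D2 have "distr D L \<Phi> = ?G" by (simp add: density_1)
  thus ?thesis unfolding D_def h_def .
qed

text \<open>A translation after \<open>\<Phi>\<close> is a translation by the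
  \<open>\<Psi>\<close>-image before it, so Lebesgue measure pushed through \<open>\<Phi>\<close>
  stays translation invariant; the Gaussian weight is a function of the norm, which
  \<open>\<Phi>\<close> keeps.\<close>

lemma distr_PiM_cgauss_isometry:
  fixes \<Phi> \<Psi> :: "('i \<Rightarrow> complex) \<Rightarrow> 'i \<Rightarrow> complex"
  assumes fin: "finite I"
    and \<Phi>[measurable]: "\<Phi> \<in> measurable (gauss I) (gauss I)"
    and \<Psi>[measurable]: "\<Psi> \<in> measurable (gauss I) (gauss I)"
    and \<Psi>\<Phi>: "\<And>x. x \<in> extensional I \<Longrightarrow> \<Psi> (\<Phi> x) = x"
    and \<Phi>\<Psi>: "\<And>x. x \<in> extensional I \<Longrightarrow> \<Phi> (\<Psi> x) = x"
    and add: "\<And>x y. \<Phi> (\<lambda>i\<in>I. x i + y i) = (\<lambda>i\<in>I. \<Phi> x i + \<Phi> y i)"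
    and iso: "\<And>x. (\<Sum>i\<in>I. (cmod (\<Phi> x i))\<^sup>2) = (\<Sum>i\<in>I. (cmod (x i))\<^sup>2)"
  shows "distr (gauss I) (gauss I) \<Phi> = gauss I"
proof -
  interpret psf: product_sigma_finite "\<lambda>_::'i. lborel :: complex measure"
    by (simp add: product_sigma_finite_def sigma_finite_lborel)
  define L where "L = PiM I (\<lambda>_. lborel :: complex measure)"
  have \<Phi>L[measurable]: "\<Phi> \<in> measurable L L"
    using \<Phi> by (simp add: L_def measurable_cong_sets[OF sets_PiM_cgauss sets_PiM_cgauss])
  have \<Psi>L[measurable]: "\<Psi> \<in> measurable L L"
    using \<Psi> by (simp add: L_def measurable_cong_sets[OF sets_PiM_cgauss sets_PiM_cgauss])
  have spL: "space L = extensional I" by (auto simp: L_def space_PiM PiE_def)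
  have inv: "distr (distr L L \<Phi>) L (\<lambda>x. \<lambda>i\<in>I. x i + a i) = distr L L \<Phi>" for a
  proof -
    have [measurable]: "(\<lambda>x. \<lambda>i\<in>I. x i + b i) \<in> measurable L L" for b
      unfolding L_def by measurable
    have a': "(\<lambda>i\<in>I. a i) \<in> extensional I" by simp
    have "distr (distr L L \<Phi>) L (\<lambda>x. \<lambda>i\<in>I. x i + a i) = distr L L (\<lambda>x. \<lambda>i\<in>I. \<Phi> x i + a i)"
      by (subst distr_distr) (auto simp: comp_def)
    also have "\<dots> = distr L L (\<lambda>x. \<Phi> (\<lambda>i\<in>I. x i + \<Psi> (\<lambda>i\<in>I. a i) i))"
      using \<Phi>\<Psi>[OF a'] by (intro distr_cong) (auto simp: add fun_eq_iff)
    also have "\<dots> = distr (distr L L (\<lambda>x. \<lambda>i\<in>I. x i + \<Psi> (\<lambda>i\<in>I. a i) i)) L \<Phi>"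
      by (subst distr_distr) (auto simp: comp_def)
    also have "distr L L (\<lambda>x. \<lambda>i\<in>I. x i + \<Psi> (\<lambda>i\<in>I. a i) i) = L"
      unfolding L_def by (rule PiM_lborel_translate[OF fin])
    finally show ?thesis .
  qed
  have dens: "gauss I = density L (\<lambda>x. ennreal (1 / pi ^ card I * exp (- (\<Sum>i\<in>I. (cmod (\<Phi> x i))\<^sup>2))))"
    unfolding PiM_cgauss_density[OF fin] iso L_def by simp
  have sf: "sigma_finite_measure L" unfolding L_def by (rule psf.sigma_finite[OF fin])
  have prob: "prob_space (density L (\<lambda>x. ennreal (1 / pi ^ card I * exp (- (\<Sum>i\<in>I. (cmod (\<Phi> x i))\<^sup>2)))))"
    unfolding dens[symmetric] by (intro prob_space_PiM prob_space_cgauss)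
  have "distr (gauss I) (gauss I) \<Phi> = distr (gauss I) L \<Phi>"
    by (rule distr_cong) (auto simp: L_def sets_PiM_cgauss)
  also have "\<dots> = gauss I"

    by (subst dens, rule distr_gaussian_density[OF L_def fin sf \<Phi>L \<Psi>L _ inv _ prob]) (use \<Psi>\<Phi> spL in auto)
  finally show ?thesis .
qed

section \<open>Householder reflections and spiked events\<close>

definition sqnorm :: "'i set \<Rightarrow> ('i \<Rightarrow> complex) \<Rightarrow> real" where
  "sqnorm I x = (\<Sum>i\<in>I. (cmod (x i))\<^sup>2)"

text \<open>Without conjugation, so that row combinations are linear in the coefficients; conjugates
  are written out where they occur.\<close>

definition bilin :: "'i set \<Rightarrow> ('i \<Rightarrow> complex) \<Rightarrow> ('i \<Rightarrow> complex) \<Rightarrow> complex" where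
  "bilin I x y = (\<Sum>i\<in>I. x i * y i)"

text \<open>For a null vector \<open>w\<close> the division by zero makes this the identity, which
  is the right reading: no reflection is called for when two vectors already agree up to a
  phase.\<close>

definition householder :: "'i set \<Rightarrow> ('i \<Rightarrow> complex) \<Rightarrow> ('i \<Rightarrow> complex) \<Rightarrow> 'i \<Rightarrow> complex" where
  "householder I w x i = x i - 2 * w i * bilin I (\<lambda>i. cnj (w i)) x / complex_of_real (sqnorm I w)"

lemma sqnorm_nonneg [simp]: "sqnorm I x \<ge> 0"
  by (simp add: sqnorm_def sum_nonneg)

lemma sqnorm_cong: "(\<And>i. i \<in> I \<Longrightarrow> x i = y i) \<Longrightarrow> sqnorm I x = sqnorm I y"
  by (simp add: sqnorm_def)

lemma bilin_cong: "(\<And>i. i \<in> I \<Longrightarrow> x i = x' i) \<Longrightarrow> (\<And>i. i \<in> I \<Longrightarrow> y i = y' i) \<Longrightarrow> bilin I x y = bilin I x' y'"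
  by (simp add: bilin_def)

lemma bilin_commute: "bilin I x y = bilin I y x"
  by (simp add: bilin_def mult.commute)

lemma bilin_scale: "bilin I x (\<lambda>i. c * y i) = c * bilin I x y"
  by (simp add: bilin_def sum_distrib_left mult_ac)

lemma bilin_add: "bilin I x (\<lambda>i. y i + z i) = bilin I x y + bilin I x z"
  by (simp add: bilin_def sum.distrib algebra_simps)

lemma bilin_diff: "bilin I x (\<lambda>i. y i - z i) = bilin I x y - bilin I x z"
  by (simp add: bilin_def sum_subtractf algebra_simps)

lemma sqnorm_bilin: "complex_of_real (sqnorm I x) = bilin I (\<lambda>i. cnj (x i)) x"
  by (simp add: sqnorm_def bilin_def complex_norm_square mult.commute del: of_real_power)

lemma sqnorm_cnj [simp]: "sqnorm I (\<lambda>i. cnj (x i)) = sqnorm I x"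
  by (simp add: sqnorm_def)

lemma sqnorm_scale: "sqnorm I (\<lambda>i. c * x i) = (cmod c)\<^sup>2 * sqnorm I x"
  by (simp add: sqnorm_def norm_mult power_mult_distrib sum_distrib_left)

lemma sqnorm_add: "sqnorm I (\<lambda>i. x i + y i) = sqnorm I x + 2 * Re (bilin I (\<lambda>i. cnj (x i)) y) + sqnorm I y"
proof -
  have "(cmod (a + b))\<^sup>2 = (cmod a)\<^sup>2 + 2 * Re (cnj a * b) + (cmod b)\<^sup>2" for a b
    unfolding cmod_power2 by (simp add: power2_eq_square algebra_simps)
  thus ?thesis
    by (simp add: sqnorm_def bilin_def sum.distrib sum_distrib_left)
qed

lemma sqnorm_eq_0_iff: "finite I \<Longrightarrow> sqnorm I x = 0 \<longleftrightarrow> (\<forall>i\<in>I. x i = 0)"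
  by (auto simp: sqnorm_def sum_nonneg_eq_0_iff)

lemma householder_eq: "householder I w x = (\<lambda>i. x i - (2 * bilin I (\<lambda>i. cnj (w i)) x / complex_of_real (sqnorm I w)) * w i)"
  by (simp add: householder_def fun_eq_iff mult_ac)

lemma householder_add: "householder I w (\<lambda>i. x i + y i) = (\<lambda>i. householder I w x i + householder I w y i)"
  by (simp add: householder_def bilin_add fun_eq_iff add_divide_distrib algebra_simps)

lemma householder_scale: "householder I w (\<lambda>i. c * x i) = (\<lambda>i. c * householder I w x i)"
  by (simp add: householder_def bilin_scale fun_eq_iff algebra_simps)

lemma householder_cong: "(\<And>i. i \<in> I \<Longrightarrow> x i = y i) \<Longrightarrow> i \<in> I \<Longrightarrow> householder I w x i = householder I w y i"
  by (simp add: householder_def cong: bilin_cong)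

lemma householder_null:
  assumes "finite I" "sqnorm I w = 0" "i \<in> I" shows "householder I w x i = x i"
  using assms sqnorm_eq_0_iff[of I w] by (simp add: householder_def)

lemma bilin_cnj_householder: "bilin I (\<lambda>i. cnj (w i)) (householder I w x) = - bilin I (\<lambda>i. cnj (w i)) x" if "sqnorm I w \<noteq> 0"
  using that unfolding householder_eq bilin_diff bilin_scale sqnorm_bilin[symmetric] by simp

lemma householder_householder:
  assumes "finite I" "i \<in> I" shows "householder I w (householder I w x) i = x i"
proof (cases "sqnorm I w = 0")
  case True
  thus ?thesis using assms by (simp add: householder_null)
next
  case False
  show ?thesis
    by (simp add: householder_def[of I w "householder I w x"] bilin_cnj_householder[OF False])
       (simp add: householder_def)
qed

lemma sqnorm_householder:
  assumes "finite I" shows "sqnorm I (householder I w x) = sqnorm I x"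
proof (cases "sqnorm I w = 0")
  case True
  thus ?thesis using assms by (intro sqnorm_cong) (simp add: householder_null)
next
  case False
  define p where "p = bilin I (\<lambda>i. cnj (w i)) x"
  define c where "c = - (2 * p / complex_of_real (sqnorm I w))"
  have eq: "householder I w x = (\<lambda>i. c * w i + x i)" by (simp add: householder_eq c_def p_def)
  have "cnj c * p = - complex_of_real (2 * (cmod p)\<^sup>2 / sqnorm I w)"
    by (simp add: c_def complex_norm_square mult_ac del: of_real_power)
  hence r: "Re (cnj c * p) = - (2 * (cmod p)\<^sup>2 / sqnorm I w)" by simp
  have "(cmod c)\<^sup>2 = 4 * (cmod p)\<^sup>2 / (sqnorm I w)\<^sup>2"
    by (simp add: c_def norm_divide norm_mult power_divide power_mult_distrib)
  moreover have "bilin I (\<lambda>i. cnj (c * w i)) x = cnj c * p"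
    by (simp add: p_def bilin_def sum_distrib_left mult_ac)
  ultimately show ?thesis using False
    unfolding eq sqnorm_add sqnorm_scale by (simp only: r) (simp add: power2_eq_square)
qed

text \<open>A reflection is Hermitian, but \<open>bilin\<close> sees transposes rather than
  adjoints, and the transpose is the reflection along the conjugate vector.\<close>

lemma bilin_householder: "bilin I x (householder I w y) = bilin I (householder I (\<lambda>i. cnj (w i)) x) y"
proof -
  have "bilin I x (householder I w y) = bilin I x y - 2 * bilin I (\<lambda>i. cnj (w i)) y / complex_of_real (sqnorm I w) * bilin I x w"
    unfolding householder_eq bilin_diff bilin_scale by simp
  also have "\<dots> = bilin I y x - 2 * bilin I w x / complex_of_real (sqnorm I w) * bilin I y (\<lambda>i. cnj (w i))"
    by (simp add: bilin_commute[of I y] bilin_commute[of I w] mult_ac)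
  also have "\<dots> = bilin I y (householder I (\<lambda>i. cnj (w i)) x)"
    unfolding householder_eq bilin_diff bilin_scale by simp
  finally show ?thesis by (simp only: bilin_commute)
qed

text \<open>Choosing the phase \<open>c\<close> so that the inner product of \<open>u\<close> and \<open>c v\<close> is real makes the
  reflection along \<open>u - c v\<close> exchange the two vectors.\<close>

lemma householder_exists:
  assumes fin: "finite I" and eq: "sqnorm I u = sqnorm I v"
  shows "\<exists>w c. cmod c = 1 \<and> (\<forall>i\<in>I. householder I w u i = c * v i)"
proof -
  define p where "p = bilin I (\<lambda>i. cnj (v i)) u"
  define c where "c = (if p = 0 then 1 else p / complex_of_real (cmod p))"
  have c: "cmod c = 1" by (auto simp: c_def norm_divide)
  have cp: "cnj c * p = complex_of_real (cmod p)"
    using complex_norm_square[of p] by (simp add: c_def power2_eq_square field_simps)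
  define w where "w i = u i - c * v i" for i
  have "sqnorm I (\<lambda>i. (- c * v i) + u i) = sqnorm I (\<lambda>i. - c * v i) + 2 * Re (bilin I (\<lambda>i. cnj (- c * v i)) u) + sqnorm I u"
    by (rule sqnorm_add)
  also have "bilin I (\<lambda>i. cnj (- c * v i)) u = - (cnj c * p)"
    by (simp add: p_def bilin_def sum_distrib_left sum_negf mult_ac)
  finally have nw: "sqnorm I w = 2 * (sqnorm I u - cmod p)"
    using sqnorm_scale[of I "- c" v] c eq by (simp add: w_def[abs_def] cp)
  have "bilin I (\<lambda>i. cnj (w i)) u = complex_of_real (sqnorm I u) - cnj c * p"
    by (simp add: w_def p_def sqnorm_bilin bilin_def sum_distrib_left sum_subtractf algebra_simps)
  hence lw: "2 * bilin I (\<lambda>i. cnj (w i)) u = complex_of_real (sqnorm I w)" by (simp add: cp nw)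
  have "householder I w u i = c * v i" if i: "i \<in> I" for i
  proof (cases "sqnorm I w = 0")
    case True
    hence "w i = 0" using sqnorm_eq_0_iff[OF fin] i by auto
    thus ?thesis using householder_null[OF fin True i] by (simp add: w_def)
  next
    case False
    thus ?thesis unfolding householder_eq lw by (simp add: w_def)
  qed
  with c show ?thesis by blast
qed

section \<open>Spiked events, their measurability and their invariance under reflections\<close>

abbreviation upper_tail :: "'i set \<Rightarrow> real \<Rightarrow> real" where
  "upper_tail K a \<equiv> measure (gauss K) {x \<in> space (gauss K). \<not> sqnorm K x \<le> a}"

abbreviation lower_tail :: "'i set \<Rightarrow> real \<Rightarrow> real" where
  "lower_tail K a \<equiv> measure (gauss K) {x \<in> space (gauss K). sqnorm K x \<le> a}"

abbreviation comb :: "'i set \<Rightarrow> ('i \<Rightarrow> complex) \<Rightarrow> ('i \<times> 'j \<Rightarrow> complex) \<Rightarrow> 'j \<Rightarrow> complex" where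
  "comb I x G \<equiv> \<lambda>j. bilin I x (\<lambda>i. G (i, j))"

abbreviation gauss_matrix :: "'i set \<Rightarrow> 'j set \<Rightarrow> ('i \<times> 'j \<Rightarrow> complex) measure" where
  "gauss_matrix I J \<equiv> gauss (I \<times> J)"

lemma prob_space_PiM_cgauss: "prob_space (gauss K)"
  by (intro prob_space_PiM prob_space_cgauss)

abbreviation prob_not :: "'i set \<Rightarrow> 'j set \<Rightarrow> ('i \<times> 'j \<Rightarrow> complex) set \<Rightarrow> real" where
  "prob_not I J E \<equiv> measure (gauss_matrix I J) (space (gauss_matrix I J) - E)"

text \<open>\<open>spikeL\<close> is the event \<open>G G\<^sup>* + v v\<^sup>* \<le> t\<close> and \<open>spikeR\<close> the event \<open>G (1 + u u\<^sup>*) G\<^sup>* \<le> t\<close>,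
  up to complex conjugation of \<open>v\<close> and \<open>u\<close>.\<close>

definition spikeL :: "'i set \<Rightarrow> 'j set \<Rightarrow> ('i \<Rightarrow> complex) \<Rightarrow> real \<Rightarrow> ('i \<times> 'j \<Rightarrow> complex) set" where
  "spikeL I J v t = {G \<in> space (gauss_matrix I J).
     \<forall>x. sqnorm J (comb I x G) + (cmod (bilin I x v))\<^sup>2 \<le> t * sqnorm I x}"

definition spikeR :: "'i set \<Rightarrow> 'j set \<Rightarrow> ('j \<Rightarrow> complex) \<Rightarrow> real \<Rightarrow> ('i \<times> 'j \<Rightarrow> complex) set" where
  "spikeR I J u t = {G \<in> space (gauss_matrix I J).
     \<forall>x. sqnorm J (comb I x G) + (cmod (bilin J u (comb I x G)))\<^sup>2 \<le> t * sqnorm I x}"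

text \<open>By continuity the uncountable family of conditions may be tested on vectors with entries
  in a countable dense set. Continuity is assumed with respect to the finitely many coordinates in
  \<open>I\<close>, so countably many test vectors suffice.\<close>

lemma sets_Collect_all_le_0:
  fixes f :: "('i \<Rightarrow> complex) \<Rightarrow> 'b \<Rightarrow> real"
  assumes fin: "finite I"
    and meas: "\<And>x. f x \<in> borel_measurable M"
    and lim: "\<And>\<omega> X x. \<omega> \<in> space M \<Longrightarrow> (\<And>i. i \<in> I \<Longrightarrow> (\<lambda>k. X k i) \<longlonglongrightarrow> x i) \<Longrightarrow> (\<lambda>k. f (X k) \<omega>) \<longlonglongrightarrow> f x \<omega>"
  shows "{\<omega> \<in> space M. \<forall>x. f x \<omega> \<le> 0} \<in> sets M"
proof -
  obtain D :: "complex set" where D: "countable D" "\<And>X. open X \<Longrightarrow> X \<noteq> {} \<Longrightarrow> \<exists>d\<in>D. d \<in> X"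
    using countable_dense_exists by blast
  have cl: "\<exists>X. (\<forall>k. X k \<in> D) \<and> X \<longlonglongrightarrow> z" for z
  proof -
    have "z \<in> closure D"
      using D(2) by (auto simp: closure_iff_nhds_not_empty)
    thus ?thesis using closure_sequential by blast
  qed
  have "{\<omega> \<in> space M. \<forall>x. f x \<omega> \<le> 0} = {\<omega> \<in> space M. \<forall>x\<in>PiE I (\<lambda>_. D). f x \<omega> \<le> 0}"
  proof (intro Collect_cong conj_cong refl iffI ballI allI)
    fix \<omega> x assume \<omega>: "\<omega> \<in> space M" and le: "\<forall>x\<in>PiE I (\<lambda>_. D). f x \<omega> \<le> 0"
    have "\<forall>i::'i. \<exists>X. (\<forall>k. X k \<in> D) \<and> X \<longlonglongrightarrow> x i" using cl by blast
    then obtain X where X: "\<And>i k. X i k \<in> D" "\<And>i. X i \<longlonglongrightarrow> x i" by metis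
    have "(\<lambda>k. f (restrict (\<lambda>i. X i k) I) \<omega>) \<longlonglongrightarrow> f x \<omega>"
      using X(2) by (intro lim[OF \<omega>]) auto
    moreover have "f (restrict (\<lambda>i. X i k) I) \<omega> \<le> 0" for k using le X(1) by auto
    ultimately show "f x \<omega> \<le> 0" by - (rule LIMSEQ_le_const2, auto)
  qed auto
  moreover have "{\<omega> \<in> space M. \<forall>x\<in>PiE I (\<lambda>_. D). f x \<omega> \<le> 0} \<in> sets M"
  proof -
    have "{\<omega> \<in> space M. \<forall>x\<in>PiE I (\<lambda>_. D). f x \<omega> \<le> 0}
      = space M - (\<Union>x\<in>PiE I (\<lambda>_. D). {\<omega> \<in> space M. 0 < f x \<omega>})"
      by (auto simp: not_less)
    also have "\<dots> \<in> sets M"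
      using countable_PiE[OF fin, of "\<lambda>_. D"] D(1) meas
      by (intro sets.Diff sets.top sets.countable_UN') auto
    finally show ?thesis .
  qed
  ultimately show ?thesis by simp
qed

lemma tendsto_sqnorm: "(\<And>i. i \<in> I \<Longrightarrow> (\<lambda>k. X k i) \<longlonglongrightarrow> x i) \<Longrightarrow> (\<lambda>k. sqnorm I (X k)) \<longlonglongrightarrow> sqnorm I x"
  unfolding sqnorm_def by (intro tendsto_intros) auto

lemma tendsto_bilin: "(\<And>i. i \<in> I \<Longrightarrow> (\<lambda>k. X k i) \<longlonglongrightarrow> x i) \<Longrightarrow> (\<lambda>k. bilin I (X k) v) \<longlonglongrightarrow> bilin I x v"
  unfolding bilin_def by (intro tendsto_intros) auto

lemma measurable_PiM_cgauss_component [measurable (raw)]: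
  "k \<in> K \<Longrightarrow> (\<lambda>G. G k) \<in> borel_measurable (gauss K)"
  using measurable_component_singleton[of k K "\<lambda>_. cgauss"]
  by (simp cong: measurable_cong_sets)

lemma borel_measurable_sqnorm [measurable (raw)]:
  "(\<And>i. i \<in> I \<Longrightarrow> (\<lambda>\<omega>. X \<omega> i) \<in> borel_measurable M) \<Longrightarrow> (\<lambda>\<omega>. sqnorm I (X \<omega>)) \<in> borel_measurable M"
  unfolding sqnorm_def by measurable

lemma borel_measurable_bilin [measurable (raw)]:
  "(\<And>i. i \<in> I \<Longrightarrow> (\<lambda>\<omega>. X \<omega> i) \<in> borel_measurable M) \<Longrightarrow> (\<And>i. i \<in> I \<Longrightarrow> (\<lambda>\<omega>. Y \<omega> i) \<in> borel_measurable M)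
    \<Longrightarrow> (\<lambda>\<omega>. bilin I (X \<omega>) (Y \<omega>)) \<in> borel_measurable M"
  unfolding bilin_def by measurable

lemma sets_spikeL [measurable]:
  assumes "finite I" shows "spikeL I J v t \<in> sets (gauss_matrix I J)"
proof -
  have "spikeL I J v t = {G \<in> space (gauss_matrix I J).
     \<forall>x. sqnorm J (comb I x G) + (cmod (bilin I x v))\<^sup>2 - t * sqnorm I x \<le> 0}"
    by (simp add: spikeL_def)
  also have "\<dots> \<in> sets (gauss_matrix I J)"
    by (rule sets_Collect_all_le_0[OF assms]) (auto intro!: tendsto_intros tendsto_sqnorm tendsto_bilin)
  finally show ?thesis .
qed

lemma sets_spikeR [measurable]:
  assumes "finite I" shows "spikeR I J v t \<in> sets (gauss_matrix I J)"
proof -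
  have "spikeR I J v t = {G \<in> space (gauss_matrix I J).
     \<forall>x. sqnorm J (comb I x G) + (cmod (bilin J v (comb I x G)))\<^sup>2 - t * sqnorm I x \<le> 0}"
    by (simp add: spikeR_def)
  also have "\<dots> \<in> sets (gauss_matrix I J)"
    by (rule sets_Collect_all_le_0[OF assms])
       (auto intro!: tendsto_intros tendsto_sqnorm tendsto_bilin simp: bilin_commute[of J v])
  finally show ?thesis .
qed

lemma sqnorm_prod: "sqnorm (I \<times> J) G = (\<Sum>j\<in>J. sqnorm I (\<lambda>i. G (i, j)))" "sqnorm (I \<times> J) G = (\<Sum>i\<in>I. sqnorm J (\<lambda>j. G (i, j)))"
  unfolding sqnorm_def by (subst sum.swap, simp add: sum.cartesian_product) (simp add: sum.cartesian_product)

lemma measurable_householder [measurable (raw)]: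
  assumes "i \<in> I" "\<And>i. i \<in> I \<Longrightarrow> (\<lambda>\<omega>. X \<omega> i) \<in> borel_measurable M"
  shows "(\<lambda>\<omega>. householder I w (X \<omega>) i) \<in> borel_measurable M"
  using assms unfolding householder_def by measurable

lemma measurable_householder_left:
  "(\<lambda>G. \<lambda>(i,j)\<in>I\<times>J. householder I w (\<lambda>k. G (k, j)) i) \<in> measurable (gauss_matrix I J) (gauss_matrix I J)"
  unfolding case_prod_beta by (intro measurable_restrict) (auto cong: measurable_cong_sets)

lemma measurable_householder_right:
  "(\<lambda>G. \<lambda>(i,j)\<in>I\<times>J. householder J w (\<lambda>k. G (i, k)) j) \<in> measurable (gauss_matrix I J) (gauss_matrix I J)"
  unfolding case_prod_beta by (intro measurable_restrict) (auto cong: measurable_cong_sets)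

lemma distr_householder_left:
  assumes I: "finite I" and J: "finite J"
  shows "distr (gauss_matrix I J) (gauss_matrix I J) (\<lambda>G. \<lambda>(i,j)\<in>I\<times>J. householder I w (\<lambda>k. G (k, j)) i) = gauss_matrix I J"
proof -
  let ?\<Phi> = "\<lambda>G. \<lambda>(i,j)\<in>I\<times>J. householder I w (\<lambda>k. G (k, j)) i"
  have m: "?\<Phi> \<in> measurable (gauss_matrix I J) (gauss_matrix I J)" by (rule measurable_householder_left)
  have inv: "?\<Phi> (?\<Phi> G) = G" if "G \<in> extensional (I \<times> J)" for G
  proof (rule extensionalityI[OF _ that])
    fix p assume "p \<in> I \<times> J"
    then obtain i j where p: "p = (i, j)" "i \<in> I" "j \<in> J" by auto
    have "?\<Phi> (?\<Phi> G) p = householder I w (householder I w (\<lambda>k. G (k, j))) i"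
      using p by (auto intro!: householder_cong)
    thus "?\<Phi> (?\<Phi> G) p = G p" using p householder_householder[OF I, of i w "\<lambda>k. G (k, j)"] by simp
  qed auto
  show ?thesis
  proof (rule distr_PiM_cgauss_isometry[OF _ m m inv inv])
    show "?\<Phi> (\<lambda>p\<in>I\<times>J. G p + H p) = (\<lambda>p\<in>I\<times>J. ?\<Phi> G p + ?\<Phi> H p)" for G H
      by (auto simp: fun_eq_iff householder_add[THEN fun_cong, symmetric] intro!: householder_cong)
    show "(\<Sum>p\<in>I\<times>J. (cmod (?\<Phi> G p))\<^sup>2) = (\<Sum>p\<in>I\<times>J. (cmod (G p))\<^sup>2)" for G
      unfolding sqnorm_def[symmetric] sqnorm_prod(1) using I
      by (intro sum.cong refl, subst sqnorm_householder[OF I, symmetric, of _ w]) (auto intro!: sqnorm_cong)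
  qed (use I J in auto)
qed

lemma distr_householder_right:
  assumes I: "finite I" and J: "finite J"
  shows "distr (gauss_matrix I J) (gauss_matrix I J) (\<lambda>G. \<lambda>(i,j)\<in>I\<times>J. householder J w (\<lambda>k. G (i, k)) j) = gauss_matrix I J"
proof -
  let ?\<Phi> = "\<lambda>G. \<lambda>(i,j)\<in>I\<times>J. householder J w (\<lambda>k. G (i, k)) j"
  have m: "?\<Phi> \<in> measurable (gauss_matrix I J) (gauss_matrix I J)" by (rule measurable_householder_right)
  have inv: "?\<Phi> (?\<Phi> G) = G" if "G \<in> extensional (I \<times> J)" for G
  proof (rule extensionalityI[OF _ that])
    fix p assume "p \<in> I \<times> J"
    then obtain i j where p: "p = (i, j)" "i \<in> I" "j \<in> J" by auto
    have "?\<Phi> (?\<Phi> G) p = householder J w (householder J w (\<lambda>k. G (i, k))) j"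
      using p by (auto intro!: householder_cong)
    thus "?\<Phi> (?\<Phi> G) p = G p" using p householder_householder[OF J, of j w "\<lambda>k. G (i, k)"] by simp
  qed auto
  show ?thesis
  proof (rule distr_PiM_cgauss_isometry[OF _ m m inv inv])
    show "?\<Phi> (\<lambda>p\<in>I\<times>J. G p + H p) = (\<lambda>p\<in>I\<times>J. ?\<Phi> G p + ?\<Phi> H p)" for G H
      by (auto simp: fun_eq_iff householder_add[THEN fun_cong, symmetric] intro!: householder_cong)
    show "(\<Sum>p\<in>I\<times>J. (cmod (?\<Phi> G p))\<^sup>2) = (\<Sum>p\<in>I\<times>J. (cmod (G p))\<^sup>2)" for G
      unfolding sqnorm_def[symmetric] sqnorm_prod(2) using J
      by (intro sum.cong refl, subst sqnorm_householder[OF J, symmetric, of _ w]) (auto intro!: sqnorm_cong)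
  qed (use I J in auto)
qed

text \<open>A reflection of the rows keeps the law of \<open>G\<close> and turns \<open>v\<close>
  into a unimodular multiple of \<open>v'\<close>, whose phase disappears in the squared modulus.
  Hence only the length of the spike matters, and the recursion has a single real parameter.\<close>

lemma measure_spikeL_cong:
  assumes I: "finite I" and J: "finite J" and eq: "sqnorm I v = sqnorm I v'"
  shows "measure (gauss_matrix I J) (spikeL I J v t) = measure (gauss_matrix I J) (spikeL I J v' t)"
proof -
  obtain w c where c: "cmod c = 1" and w: "\<And>i. i \<in> I \<Longrightarrow> householder I w v i = c * v' i"
    using householder_exists[OF I eq] by blast
  let ?\<Phi> = "\<lambda>G. \<lambda>(i,j)\<in>I\<times>J. householder I w (\<lambda>k. G (k, j)) i"
  let ?h = "householder I (\<lambda>i. cnj (w i))"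
  have m: "?\<Phi> \<in> measurable (gauss_matrix I J) (gauss_matrix I J)" by (rule measurable_householder_left)
  have key: "sqnorm J (comb I x (?\<Phi> G)) = sqnorm J (comb I (?h x) G)"
    "(cmod (bilin I x v))\<^sup>2 = (cmod (bilin I (?h x) v'))\<^sup>2" for x G
  proof -
    show "sqnorm J (comb I x (?\<Phi> G)) = sqnorm J (comb I (?h x) G)"
      unfolding bilin_householder[symmetric] by (intro sqnorm_cong bilin_cong) auto
    have "bilin I x v = bilin I x (householder I w (householder I w v))"
      by (intro bilin_cong refl householder_householder[symmetric] I)
    also have "\<dots> = bilin I (?h x) (\<lambda>i. c * v' i)"
      unfolding bilin_householder[of I x] by (intro bilin_cong refl w)
    finally show "(cmod (bilin I x v))\<^sup>2 = (cmod (bilin I (?h x) v'))\<^sup>2"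
      by (simp add: bilin_scale norm_mult c)
  qed
  have "?\<Phi> -` spikeL I J v t \<inter> space (gauss_matrix I J) = spikeL I J v' t"
  proof -
    \<comment> \<open>Vectors are functions on the whole index type, but \<open>?h\<close> is known
      to be an involution on \<open>I\<close> only; the substitution is sound because the conditions
      look at \<open>I\<close> alone.\<close>
    have allI_h: "(\<forall>x. P (?h x)) \<longleftrightarrow> (\<forall>x. P x)" if P: "\<And>x y. (\<And>i. i \<in> I \<Longrightarrow> x i = y i) \<Longrightarrow> P x = P y" for P
    proof -
      have "P x = P (?h (?h x))" for x
        by (rule P) (simp add: householder_householder[OF I])
      thus ?thesis by metis
    qed
    have cong: "(sqnorm J (comb I x G) + (cmod (bilin I x v'))\<^sup>2 \<le> t * sqnorm I x)
      = (sqnorm J (comb I y G) + (cmod (bilin I y v'))\<^sup>2 \<le> t * sqnorm I y)"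
      if xy: "\<And>i. i \<in> I \<Longrightarrow> x i = y i" for x y G
    proof -
      have "bilin I x z = bilin I y z" for z using xy by (intro bilin_cong) auto
      moreover have "sqnorm I x = sqnorm I y" using xy by (intro sqnorm_cong) auto
      ultimately show ?thesis by simp
    qed
    have *: "(\<forall>x. sqnorm J (comb I (?h x) G) + (cmod (bilin I (?h x) v'))\<^sup>2 \<le> t * sqnorm I (?h x))
      \<longleftrightarrow> (\<forall>x. sqnorm J (comb I x G) + (cmod (bilin I x v'))\<^sup>2 \<le> t * sqnorm I x)" for G
      by (rule allI_h) (rule cong)
    have "?\<Phi> G \<in> spikeL I J v t \<longleftrightarrow> G \<in> spikeL I J v' t" if "G \<in> space (gauss_matrix I J)" for G
    proof -
      have "(\<forall>x. sqnorm J (comb I x (?\<Phi> G)) + (cmod (bilin I x v))\<^sup>2 \<le> t * sqnorm I x)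
        \<longleftrightarrow> (\<forall>x. sqnorm J (comb I (?h x) G) + (cmod (bilin I (?h x) v'))\<^sup>2 \<le> t * sqnorm I (?h x))"
        by (simp only: key sqnorm_householder[OF I])
      with * show ?thesis
        using that measurable_space[OF m that] unfolding spikeL_def mem_Collect_eq by metis
    qed
    thus ?thesis by (auto simp: spikeL_def[of I J v'])
  qed
  hence "measure (gauss_matrix I J) (spikeL I J v' t) = measure (distr (gauss_matrix I J) (gauss_matrix I J) ?\<Phi>) (spikeL I J v t)"
    by (subst measure_distr[OF m]) (auto simp: I)
  thus ?thesis by (simp only: distr_householder_left[OF I J])
qed

lemma bilin_householder_swap:
  "bilin I x (\<lambda>i. householder J w (\<lambda>k. G (i, k)) j) = householder J w (\<lambda>k. bilin I x (\<lambda>i. G (i, k))) j"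
proof -
  have "bilin I x (\<lambda>i. bilin J y (\<lambda>k. G (i, k))) = bilin J y (comb I x G)" for y
    unfolding bilin_def sum_distrib_left by (subst sum.swap) (simp add: mult_ac)
  moreover have "householder J w y j = y j - (2 * w j / complex_of_real (sqnorm J w)) * bilin J (\<lambda>k. cnj (w k)) y" for y
    by (simp add: householder_def)
  ultimately show ?thesis by (simp only: bilin_diff bilin_scale)
qed

text \<open>The same argument with columns. Reflecting them along the conjugate of \<open>w\<close>
  makes the transposed reflection act on \<open>u\<close> along \<open>w\<close> itself.\<close>

lemma measure_spikeR_cong:
  assumes I: "finite I" and J: "finite J" and eq: "sqnorm J u = sqnorm J u'"
  shows "measure (gauss_matrix I J) (spikeR I J u t) = measure (gauss_matrix I J) (spikeR I J u' t)"
proof -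
  obtain w c where c: "cmod c = 1" and w: "\<And>j. j \<in> J \<Longrightarrow> householder J w u j = c * u' j"
    using householder_exists[OF J eq] by blast
  let ?h = "householder J (\<lambda>j. cnj (w j))"
  let ?\<Phi> = "\<lambda>G. \<lambda>(i,j)\<in>I\<times>J. ?h (\<lambda>k. G (i, k)) j"
  have m: "?\<Phi> \<in> measurable (gauss_matrix I J) (gauss_matrix I J)" by (rule measurable_householder_right)
  have lfh: "bilin I x (\<lambda>i. ?\<Phi> G (i, j)) = ?h (comb I x G) j" if "j \<in> J" for x G j
  proof -
    have "bilin I x (\<lambda>i. ?\<Phi> G (i, j)) = bilin I x (\<lambda>i. ?h (\<lambda>k. G (i, k)) j)"
      using that by (intro bilin_cong) auto
    also have "\<dots> = ?h (comb I x G) j" by (rule bilin_householder_swap)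
    finally show ?thesis .
  qed
  have key: "sqnorm J (comb I x (?\<Phi> G)) = sqnorm J (comb I x G)"
    "(cmod (bilin J u (comb I x (?\<Phi> G))))\<^sup>2 = (cmod (bilin J u' (comb I x G)))\<^sup>2" for x G
  proof -
    show "sqnorm J (comb I x (?\<Phi> G)) = sqnorm J (comb I x G)"
      by (subst sqnorm_householder[OF J, symmetric, of _ "\<lambda>j. cnj (w j)"]) (rule sqnorm_cong, rule lfh)
    have "bilin J u (comb I x (?\<Phi> G)) = bilin J u (?h (comb I x G))"
      by (intro bilin_cong refl lfh)
    also have "\<dots> = bilin J (householder J w u) (comb I x G)"
      by (simp add: bilin_householder)
    also have "\<dots> = bilin J (\<lambda>j. c * u' j) (comb I x G)"
      by (intro bilin_cong refl w)
    also have "\<dots> = c * bilin J u' (comb I x G)"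
      by (simp add: bilin_def sum_distrib_left mult_ac)
    finally show "(cmod (bilin J u (comb I x (?\<Phi> G))))\<^sup>2 = (cmod (bilin J u' (comb I x G)))\<^sup>2"
      by (simp add: norm_mult c)
  qed
  have "?\<Phi> -` spikeR I J u t \<inter> space (gauss_matrix I J) = spikeR I J u' t"
  proof -
    have "?\<Phi> G \<in> spikeR I J u t \<longleftrightarrow> G \<in> spikeR I J u' t" if "G \<in> space (gauss_matrix I J)" for G
      using that measurable_space[OF m that] unfolding spikeR_def mem_Collect_eq key by simp
    thus ?thesis by (auto simp: spikeR_def[of I J u'])
  qed
  hence "measure (gauss_matrix I J) (spikeR I J u' t) = measure (distr (gauss_matrix I J) (gauss_matrix I J) ?\<Phi>) (spikeR I J u t)"
    by (subst measure_distr[OF m]) (auto simp: I)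
  thus ?thesis by (simp only: distr_householder_right[OF I J])
qed

section \<open>Eliminating a row\<close>

lemma merge_in_space:
  "x \<in> space (gauss K1) \<Longrightarrow> y \<in> space (gauss K2) \<Longrightarrow>
    merge K1 K2 (x, y) \<in> space (gauss (K1 \<union> K2))"
  by (auto simp: space_PiM merge_def PiE_iff extensional_def)

text \<open>Fubini over two independent blocks: on \<open>A\<close> the conditional probability is
  at most \<open>q\<close>, elsewhere at most 1. Each elimination of a row or column is an instance,
  with \<open>A\<close> a norm condition on the block that is removed.\<close>

lemma measure_PiM_Un_le:
  assumes fin: "finite K1" "finite K2" and disj: "K1 \<inter> K2 = {}"
    and E[measurable]: "E \<in> sets (gauss (K1 \<union> K2))" and A[measurable]: "A \<in> sets (gauss K1)"
    and q: "q \<ge> 0"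
      "\<And>x. x \<in> A \<Longrightarrow> measure (gauss K2) {y \<in> space (gauss K2). merge K1 K2 (x, y) \<in> E} \<le> q"
  shows "measure (gauss (K1 \<union> K2)) E
    \<le> q + measure (gauss K1) (space (gauss K1) - A)"
proof -
  let ?G = "\<lambda>K. gauss K"
  interpret P1: prob_space "?G K1" by (rule prob_space_PiM_cgauss)
  interpret P2: prob_space "?G K2" by (rule prob_space_PiM_cgauss)
  interpret P: prob_space "?G (K1 \<union> K2)" by (rule prob_space_PiM_cgauss)
  have "emeasure (?G (K1 \<union> K2)) E = (\<integral>\<^sup>+x. \<integral>\<^sup>+y. indicator E (merge K1 K2 (x, y)) \<partial>?G K2 \<partial>?G K1)"
    by (subst cgauss.product_nn_integral_fold[OF disj fin, symmetric]) auto
  also have "\<dots> \<le> (\<integral>\<^sup>+x. ennreal q + indicator (space (?G K1) - A) x \<partial>?G K1)"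
  proof (rule nn_integral_mono)
    fix x assume x: "x \<in> space (?G K1)"
    have m: "(\<lambda>y. merge K1 K2 (x, y)) \<in> measurable (?G K2) (?G (K1 \<union> K2))"
      using measurable_compose[OF measurable_Pair1'[OF x] measurable_merge] by simp
    let ?S = "{y \<in> space (?G K2). merge K1 K2 (x, y) \<in> E}"
    have S: "?S \<in> sets (?G K2)"
      using measurable_sets[OF m E] by (simp add: vimage_def Int_def conj_commute)
    have "(\<integral>\<^sup>+y. indicator E (merge K1 K2 (x, y)) \<partial>?G K2) = (\<integral>\<^sup>+y. indicator ?S y \<partial>?G K2)"
      by (intro nn_integral_cong) (auto simp: indicator_def)
    also have "\<dots> = emeasure (?G K2) ?S" using S by simp
    also have "\<dots> \<le> ennreal q + indicator (space (?G K1) - A) x"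
    proof (cases "x \<in> A")
      case True
      thus ?thesis using q(2)[OF True] by (simp add: P2.emeasure_eq_measure ennreal_leI)
    next
      case False
      thus ?thesis using x P2.emeasure_le_1 by (auto intro: add_increasing)
    qed
    finally show "(\<integral>\<^sup>+y. indicator E (merge K1 K2 (x, y)) \<partial>?G K2) \<le> ennreal q + indicator (space (?G K1) - A) x" .
  qed
  also have "\<dots> = ennreal q + emeasure (?G K1) (space (?G K1) - A)"
    by (subst nn_integral_add) (auto simp: P1.emeasure_space_1)
  finally show ?thesis
    using q(1) by (simp add: P.emeasure_eq_measure P1.emeasure_eq_measure ennreal_plus[symmetric] del: ennreal_plus)
qed

text \<open>AM-GM in the form 2 |c| |p| \<le> d |c|^2 + |p|^2 / d eliminates the coordinate
  \<open>c\<close> of the spiked row. Here \<open>A\<close> is the squared norm of that row,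
  \<open>p\<close> its inner product with the combination of the other rows, and \<open>Z\<close>,
  \<open>X\<close> belong to the other rows. A deterministic \<open>d\<close> replaces the random
  pivot \<open>t - s - A\<close>, so the reduced problem has no random denominator.\<close>

lemma schur_complement_le:
  fixes c p :: complex
  assumes d: "0 < d" "d \<le> t - s - A" and le: "Z + (cmod p)\<^sup>2 / d \<le> t * X"
  shows "((cmod c)\<^sup>2 * A + 2 * Re (cnj c * p) + Z) + (cmod c)\<^sup>2 * s \<le> t * ((cmod c)\<^sup>2 + X)"
proof -
  have "Re (cnj c * p) \<le> cmod c * cmod p"
    using complex_Re_le_cmod[of "cnj c * p"] by (simp add: norm_mult)
  moreover have "2 * (cmod c * cmod p) \<le> d * (cmod c)\<^sup>2 + (cmod p)\<^sup>2 / d"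
  proof -
    have "0 \<le> (d * cmod c - cmod p)\<^sup>2 / d" using d by simp
    also have "\<dots> = d * (cmod c)\<^sup>2 + (cmod p)\<^sup>2 / d - 2 * (cmod c * cmod p)"
      using d by (simp add: power2_eq_square field_simps)
    finally show ?thesis by simp
  qed
  moreover have "d * (cmod c)\<^sup>2 \<le> (t - s - A) * (cmod c)\<^sup>2" using d by (intro mult_right_mono) auto
  ultimately show ?thesis using le by (simp add: algebra_simps)
qed

text \<open>The value c = p / d gives equality in the AM-GM step of
  \<open>schur_complement_le\<close>, so testing there recovers the reduced condition. An upper
  bound on the pivot is enough, which covers a negative pivot as well.\<close>

lemma schur_complement_ge:
  fixes p :: complex
  assumes d: "0 < d" "t - s - A \<le> d"
    and le: "\<And>c. ((cmod c)\<^sup>2 * A + 2 * Re (cnj c * p) + Z) + (cmod c)\<^sup>2 * s \<le> t * ((cmod c)\<^sup>2 + X)"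
  shows "Z + (cmod p)\<^sup>2 / d \<le> t * X"
proof -
  define c where "c = p / complex_of_real d"
  have c2: "(cmod c)\<^sup>2 = (cmod p)\<^sup>2 / d\<^sup>2" using d by (simp add: c_def norm_divide power_divide)
  have "cnj c * p = complex_of_real ((cmod p)\<^sup>2 / d)"
    by (simp add: c_def complex_norm_square mult.commute del: of_real_power)
  hence re: "Re (cnj c * p) = (cmod p)\<^sup>2 / d" by simp
  have "(t - s - A) * (cmod c)\<^sup>2 \<le> d * (cmod c)\<^sup>2" using d by (intro mult_right_mono) auto
  also have "\<dots> = (cmod p)\<^sup>2 / d" using d unfolding c2 by (simp add: power2_eq_square)
  finally show ?thesis using le[of c] unfolding re by (simp add: algebra_simps)
qed

context
  fixes i0 :: 'i and I :: "'i set" and J :: "'j set" and t s d :: real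
    and G :: "'i \<times> 'j \<Rightarrow> complex" and u :: "'j \<Rightarrow> complex"
  assumes I: "finite I" "i0 \<notin> I" and d: "d > 0" and s: "s \<ge> 0"
  defines "u \<equiv> (\<lambda>j. complex_of_real (1 / sqrt d) * cnj (G (i0, j)))"
begin

private lemma split_forms:
  "bilin (insert i0 I) x (\<lambda>i. if i = i0 then complex_of_real (sqrt s) else 0) = x i0 * complex_of_real (sqrt s)"
  "sqnorm (insert i0 I) x = (cmod (x i0))\<^sup>2 + sqnorm I x"
  "sqnorm J (comb (insert i0 I) x G) = (cmod (x i0))\<^sup>2 * sqnorm J (\<lambda>j. G (i0, j))
     + 2 * Re (cnj (x i0) * bilin J (\<lambda>j. cnj (G (i0, j))) (comb I x G)) + sqnorm J (comb I x G)"
  "(cmod (bilin J u (comb I x G)))\<^sup>2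
     = (cmod (bilin J (\<lambda>j. cnj (G (i0, j))) (comb I x G)))\<^sup>2 / d"
proof -
  show "bilin (insert i0 I) x (\<lambda>i. if i = i0 then complex_of_real (sqrt s) else 0) = x i0 * complex_of_real (sqrt s)"
    using I by (auto simp: bilin_def intro!: sum.neutral)
  show "sqnorm (insert i0 I) x = (cmod (x i0))\<^sup>2 + sqnorm I x" using I by (simp add: sqnorm_def)
  have "sqnorm J (comb (insert i0 I) x G) = sqnorm J (\<lambda>j. x i0 * G (i0, j) + bilin I x (\<lambda>i. G (i, j)))"
    using I by (simp add: bilin_def)
  moreover have "bilin J (\<lambda>j. cnj (x i0 * G (i0, j))) z = cnj (x i0) * bilin J (\<lambda>j. cnj (G (i0, j))) z" for z
    by (simp add: bilin_def sum_distrib_left mult_ac)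
  ultimately show "sqnorm J (comb (insert i0 I) x G) = (cmod (x i0))\<^sup>2 * sqnorm J (\<lambda>j. G (i0, j))
     + 2 * Re (cnj (x i0) * bilin J (\<lambda>j. cnj (G (i0, j))) (comb I x G)) + sqnorm J (comb I x G)"
    by (simp only: sqnorm_add sqnorm_scale)
  have "bilin J u z = complex_of_real (1 / sqrt d) * bilin J (\<lambda>j. cnj (G (i0, j))) z" for z
    unfolding u_def bilin_commute[of J _ z] bilin_scale ..
  thus "(cmod (bilin J u (comb I x G)))\<^sup>2
     = (cmod (bilin J (\<lambda>j. cnj (G (i0, j))) (comb I x G)))\<^sup>2 / d"
    using d by (simp add: norm_mult power_mult_distrib power_divide norm_divide)
qed

text \<open>What remains of row \<open>i0\<close> is the term |p|^2 / d. Since p pairs the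
  conjugated row with \<open>comb I x G\<close>, this is a rank-one perturbation on the column side
  with \<open>u\<close> the conjugated row over sqrt d: a left spike has become a right
  spike.\<close>

lemma row_step_le:
  assumes "d \<le> t - s - sqnorm J (\<lambda>j. G (i0, j))"
    and "\<And>x. sqnorm J (comb I x G) + (cmod (bilin J u (comb I x G)))\<^sup>2 \<le> t * sqnorm I x"
  shows "sqnorm J (comb (insert i0 I) x G)
    + (cmod (bilin (insert i0 I) x (\<lambda>i. if i = i0 then complex_of_real (sqrt s) else 0)))\<^sup>2 \<le> t * sqnorm (insert i0 I) x"
  using schur_complement_le[OF d assms(1) assms(2)[of x, unfolded split_forms], of "x i0"] s
  unfolding split_forms by (simp add: norm_mult power_mult_distrib)

lemma row_step_ge:
  assumes "t - s - sqnorm J (\<lambda>j. G (i0, j)) \<le> d"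
    and "\<And>x. sqnorm J (comb (insert i0 I) x G)
    + (cmod (bilin (insert i0 I) x (\<lambda>i. if i = i0 then complex_of_real (sqrt s) else 0)))\<^sup>2 \<le> t * sqnorm (insert i0 I) x"
  shows "sqnorm J (comb I x G) + (cmod (bilin J u (comb I x G)))\<^sup>2 \<le> t * sqnorm I x"
  unfolding split_forms
proof (rule schur_complement_ge[OF d assms(1)])
  fix c :: complex
  \<comment> \<open>The reduced condition does not see the coordinate \<open>i0\<close>, so it may
    be overwritten with the test value.\<close>
  have *: "bilin I (x(i0 := c)) y = bilin I x y" "sqnorm I (x(i0 := c)) = sqnorm I x" for y
    using I by (auto intro!: bilin_cong sqnorm_cong)
  show "((cmod c)\<^sup>2 * sqnorm J (\<lambda>j. G (i0, j)) + 2 * Re (cnj c * bilin J (\<lambda>j. cnj (G (i0, j))) (comb I x G))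
     + sqnorm J (comb I x G)) + (cmod c)\<^sup>2 * s \<le> t * ((cmod c)\<^sup>2 + sqnorm I x)"
    using assms(2)[of "x(i0 := c)", unfolded split_forms *] s by (simp add: norm_mult power_mult_distrib)
qed

end

lemma sqnorm_single: "finite I \<Longrightarrow> i0 \<in> I \<Longrightarrow> s \<ge> 0 \<Longrightarrow> sqnorm I (\<lambda>i. if i = i0 then complex_of_real (sqrt s) else 0) = s"
  unfolding sqnorm_def by (subst sum.remove[of _ i0]) (auto intro!: sum.neutral)

lemma merge_space_forms:
  assumes "i0 \<notin> I" "x \<in> space (gauss_matrix {i0} J)" "y \<in> space (gauss_matrix I J)"
  shows "j \<in> J \<Longrightarrow> merge ({i0} \<times> J) (I \<times> J) (x, y) (i0, j) = x (i0, j)"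
    "i \<in> I \<Longrightarrow> j \<in> J \<Longrightarrow> merge ({i0} \<times> J) (I \<times> J) (x, y) (i, j) = y (i, j)"
  using assms by (auto simp: merge_def)

lemma row_step_merge:
  assumes I: "finite I" "i0 \<notin> I" and d: "d > 0" and s: "s \<ge> 0"
    and x: "x \<in> space (gauss_matrix {i0} J)" and y: "y \<in> space (gauss_matrix I J)"
  defines "u \<equiv> (\<lambda>j. complex_of_real (1 / sqrt d) * cnj (x (i0, j)))"
    and "v \<equiv> (\<lambda>i. if i = i0 then complex_of_real (sqrt s) else 0)"
  shows "d \<le> t - s - sqnorm J (\<lambda>j. x (i0, j)) \<Longrightarrow> y \<in> spikeR I J u t
      \<Longrightarrow> merge ({i0} \<times> J) (I \<times> J) (x, y) \<in> spikeL (insert i0 I) J v t"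
    "t - s - sqnorm J (\<lambda>j. x (i0, j)) \<le> d \<Longrightarrow> merge ({i0} \<times> J) (I \<times> J) (x, y) \<in> spikeL (insert i0 I) J v t
      \<Longrightarrow> y \<in> spikeR I J u t"
proof -
  let ?G = "merge ({i0} \<times> J) (I \<times> J) (x, y)"
  have un: "insert i0 I \<times> J = {i0} \<times> J \<union> I \<times> J" by auto
  have sp: "?G \<in> space (gauss_matrix (insert i0 I) J)" unfolding un by (rule merge_in_space[OF x y])
  note mf = merge_space_forms[OF I(2) x y]
  have lfG: "sqnorm J (comb I z y) = sqnorm J (comb I z ?G)"
    "bilin J u (comb I z y) = bilin J (\<lambda>j. complex_of_real (1 / sqrt d) * cnj (?G (i0, j))) (comb I z ?G)"
    "sqnorm J (\<lambda>j. x (i0, j)) = sqnorm J (\<lambda>j. ?G (i0, j))" for z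
    unfolding u_def using mf by (auto intro!: sqnorm_cong bilin_cong)
  show "?G \<in> spikeL (insert i0 I) J v t"
    if "d \<le> t - s - sqnorm J (\<lambda>j. x (i0, j))" "y \<in> spikeR I J u t"
    using row_step_le[OF I d s, of t J ?G] that sp
    unfolding spikeL_def spikeR_def mem_Collect_eq lfG v_def by blast
  show "y \<in> spikeR I J u t"
    if "t - s - sqnorm J (\<lambda>j. x (i0, j)) \<le> d" "?G \<in> spikeL (insert i0 I) J v t"
    using row_step_ge[OF I d s, of t J ?G] that y
    unfolding spikeL_def spikeR_def mem_Collect_eq lfG v_def by blast
qed

text \<open>If the row has squared norm at most \<alpha>, the pivot is at least t - S - \<alpha>,
  and the column spike that arises has squared norm at most \<alpha> / (t - S - \<alpha>). The spike
  is first rotated into the coordinate \<open>i0\<close>, where the Schur complement is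
  explicit.\<close>

lemma measure_not_spikeL_row:
  assumes I: "finite I" "i0 \<notin> I" and J: "finite J" and q: "q \<ge> 0"
    and d: "t - S - \<alpha> > 0" and \<kappa>: "\<alpha> / (t - S - \<alpha>) \<le> \<kappa>"
    and IH: "\<And>u. sqnorm J u \<le> \<kappa> \<Longrightarrow> prob_not I J (spikeR I J u t) \<le> q"
    and v: "sqnorm (insert i0 I) v \<le> S"
  shows "prob_not (insert i0 I) J (spikeL (insert i0 I) J v t)
    \<le> q + upper_tail ({i0} \<times> J) \<alpha>"
proof -
  let ?II = "insert i0 I"
  interpret P: prob_space "gauss_matrix ?II J" by (rule prob_space_PiM_cgauss)
  define s where "s = sqnorm ?II v"
  define w where "w = (\<lambda>i. if i = i0 then complex_of_real (sqrt s) else 0)"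
  have s: "s \<ge> 0" "s \<le> S" using v by (auto simp: s_def)
  have fI: "finite ?II" using I by simp
  have "measure (gauss_matrix ?II J) (spikeL ?II J v t) = measure (gauss_matrix ?II J) (spikeL ?II J w t)"
    by (rule measure_spikeL_cong[OF fI J]) (use fI s in \<open>simp add: w_def sqnorm_single\<close>, simp add: s_def)
  hence "prob_not ?II J (spikeL ?II J v t) = prob_not ?II J (spikeL ?II J w t)"
    using fI by (subst (1 2) P.prob_compl) auto
  also have un: "?II \<times> J = {i0} \<times> J \<union> I \<times> J" by auto
  hence "prob_not ?II J (spikeL ?II J w t)
    = measure (gauss ({i0} \<times> J \<union> I \<times> J)) (space (gauss_matrix ?II J) - spikeL ?II J w t)" by simp
  also have "\<dots> \<le> q + prob_not {i0} J ({x \<in> space (gauss_matrix {i0} J). sqnorm ({i0} \<times> J) x \<le> \<alpha>})"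
  proof (rule measure_PiM_Un_le)
    show "space (gauss_matrix ?II J) - spikeL ?II J w t \<in> sets (gauss ({i0} \<times> J \<union> I \<times> J))"
      unfolding un[symmetric] using fI by auto
    fix x assume x: "x \<in> {x \<in> space (gauss_matrix {i0} J). sqnorm ({i0} \<times> J) x \<le> \<alpha>}"
    then have xs: "x \<in> space (gauss_matrix {i0} J)" and xa: "sqnorm J (\<lambda>j. x (i0, j)) \<le> \<alpha>"
      by (auto simp: sqnorm_prod(2))
    let ?d = "t - S - \<alpha>"
    let ?u = "\<lambda>j. complex_of_real (1 / sqrt ?d) * cnj (x (i0, j))"
    have "sqnorm J ?u = sqnorm J (\<lambda>j. x (i0, j)) / ?d"
      unfolding sqnorm_scale sqnorm_cnj using d by (simp add: norm_divide power_divide)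
    also have "\<dots> \<le> \<kappa>" using xa d \<kappa> by (smt (verit) divide_right_mono)
    finally have u: "sqnorm J ?u \<le> \<kappa>" .
    have "{y \<in> space (gauss_matrix I J). merge ({i0} \<times> J) (I \<times> J) (x, y) \<in> space (gauss_matrix ?II J) - spikeL ?II J w t}
      \<subseteq> space (gauss_matrix I J) - spikeR I J ?u t"
      using row_step_merge(1)[OF I d s(1) xs, of _ t] s xa unfolding w_def by auto
    hence "measure (gauss_matrix I J) {y \<in> space (gauss_matrix I J). merge ({i0} \<times> J) (I \<times> J) (x, y) \<in> space (gauss_matrix ?II J) - spikeL ?II J w t}
      \<le> prob_not I J (spikeR I J ?u t)"
      using I by (intro finite_measure.finite_measure_mono prob_space.finite_measure prob_space_PiM_cgauss) auto
    thus "measure (gauss_matrix I J) {y \<in> space (gauss_matrix I J). merge ({i0} \<times> J) (I \<times> J) (x, y) \<in> space (gauss_matrix ?II J) - spikeL ?II J w t} \<le> q"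
      using IH[OF u] by linarith
  qed (use I J q in auto)
  also have "space (gauss_matrix {i0} J) - {x \<in> space (gauss_matrix {i0} J). sqnorm ({i0} \<times> J) x \<le> \<alpha>} = {x \<in> space (gauss_matrix {i0} J). \<not> sqnorm ({i0} \<times> J) x \<le> \<alpha>}"
    by auto
  finally show ?thesis .
qed

text \<open>Mirror image of \<open>measure_not_spikeL_row\<close>: a row of squared norm at least
  \<alpha> and a spike of at least \<open>S\<close> push the pivot to t - S - \<alpha> or below, and
  putting this larger number in place of the pivot weakens the condition, the right direction for
  bounding its probability from above.\<close>

lemma measure_spikeL_row:
  assumes I: "finite I" "i0 \<notin> I" and J: "finite J" and q: "q \<ge> 0"
    and d: "t - S - \<alpha> > 0" and \<kappa>: "\<kappa> \<le> \<alpha> / (t - S - \<alpha>)" and S: "0 \<le> S"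
    and IH: "\<And>u. sqnorm J u \<ge> \<kappa> \<Longrightarrow> measure (gauss_matrix I J) (spikeR I J u t) \<le> q"
    and v: "sqnorm (insert i0 I) v \<ge> S"
  shows "measure (gauss_matrix (insert i0 I) J) (spikeL (insert i0 I) J v t)
    \<le> q + lower_tail ({i0} \<times> J) \<alpha>"
proof -
  let ?II = "insert i0 I"
  define s where "s = sqnorm ?II v"
  define w where "w = (\<lambda>i. if i = i0 then complex_of_real (sqrt s) else 0)"
  have s: "s \<ge> 0" "s \<ge> S" using v by (auto simp: s_def)
  have fI: "finite ?II" using I by simp
  have "measure (gauss_matrix ?II J) (spikeL ?II J v t) = measure (gauss_matrix ?II J) (spikeL ?II J w t)"
    by (rule measure_spikeL_cong[OF fI J]) (use fI s in \<open>simp add: w_def sqnorm_single\<close>, simp add: s_def)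
  also have un: "?II \<times> J = {i0} \<times> J \<union> I \<times> J" by auto
  hence "measure (gauss_matrix ?II J) (spikeL ?II J w t)
    = measure (gauss ({i0} \<times> J \<union> I \<times> J)) (spikeL ?II J w t)" by simp
  also have "\<dots> \<le> q + prob_not {i0} J ({x \<in> space (gauss_matrix {i0} J). \<not> sqnorm ({i0} \<times> J) x \<le> \<alpha>})"
  proof (rule measure_PiM_Un_le)
    show "spikeL ?II J w t \<in> sets (gauss ({i0} \<times> J \<union> I \<times> J))"
      unfolding un[symmetric] using fI by auto
    fix x assume x: "x \<in> {x \<in> space (gauss_matrix {i0} J). \<not> sqnorm ({i0} \<times> J) x \<le> \<alpha>}"
    then have xs: "x \<in> space (gauss_matrix {i0} J)" and xa: "sqnorm J (\<lambda>j. x (i0, j)) \<ge> \<alpha>"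
      by (auto simp: sqnorm_prod(2))
    let ?d = "t - S - \<alpha>"
    let ?u = "\<lambda>j. complex_of_real (1 / sqrt ?d) * cnj (x (i0, j))"
    have "\<kappa> \<le> sqnorm J (\<lambda>j. x (i0, j)) / ?d" using xa d \<kappa> by (smt (verit) divide_right_mono)
    also have "\<dots> = sqnorm J ?u"
      unfolding sqnorm_scale sqnorm_cnj using d by (simp add: norm_divide power_divide)
    finally have u: "\<kappa> \<le> sqnorm J ?u" .
    have "{y \<in> space (gauss_matrix I J). merge ({i0} \<times> J) (I \<times> J) (x, y) \<in> spikeL ?II J w t} \<subseteq> spikeR I J ?u t"
      using row_step_merge(2)[OF I d s(1) xs, of _ t] s xa unfolding w_def by auto
    hence "measure (gauss_matrix I J) {y \<in> space (gauss_matrix I J). merge ({i0} \<times> J) (I \<times> J) (x, y) \<in> spikeL ?II J w t}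
      \<le> measure (gauss_matrix I J) (spikeR I J ?u t)"
      using I by (intro finite_measure.finite_measure_mono prob_space.finite_measure prob_space_PiM_cgauss) auto
    thus "measure (gauss_matrix I J) {y \<in> space (gauss_matrix I J). merge ({i0} \<times> J) (I \<times> J) (x, y) \<in> spikeL ?II J w t} \<le> q"
      using IH[OF u] by linarith
  qed (use I J q in auto)
  also have "space (gauss_matrix {i0} J) - {x \<in> space (gauss_matrix {i0} J). \<not> sqnorm ({i0} \<times> J) x \<le> \<alpha>} = {x \<in> space (gauss_matrix {i0} J). sqnorm ({i0} \<times> J) x \<le> \<alpha>}"
    by auto
  finally show ?thesis .
qed

lemma distr_PiM_cgauss_restrict:
  assumes "finite K" "K \<subseteq> K'"
  shows "distr (gauss K') (gauss K) (\<lambda>G. restrict G K) = gauss K"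
proof -
  interpret product_prob_space "\<lambda>_. cgauss" K'
    by (simp add: product_prob_space_def product_prob_space_axioms_def prob_space_cgauss cgauss.product_sigma_finite_axioms)
  show ?thesis by (rule distr_PiM_restrict_finite[OF assms])
qed

text \<open>Testing the form on the basis vector of the spiked row gives |row|^2 + s \<le> t. Once t
  - S has dropped to \<alpha>, this is a lower tail event of a single row and the recursion can
  stop.\<close>

lemma measure_spikeL_row_dead:
  assumes I: "finite I" and i0: "i0 \<in> I" and J: "finite J"
    and d: "t - S \<le> \<alpha>" and S: "0 \<le> S"
    and v: "sqnorm I v \<ge> S"
  shows "measure (gauss_matrix I J) (spikeL I J v t)
    \<le> lower_tail ({i0} \<times> J) \<alpha>"
proof -
  interpret P: prob_space "gauss_matrix I J" by (rule prob_space_PiM_cgauss)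
  define s where "s = sqnorm I v"
  define w where "w = (\<lambda>i. if i = i0 then complex_of_real (sqrt s) else 0)"
  have s: "s \<ge> 0" "s \<ge> S" using v by (auto simp: s_def)
  have sub: "{i0} \<times> J \<subseteq> I \<times> J" using i0 by auto
  have "measure (gauss_matrix I J) (spikeL I J v t) = measure (gauss_matrix I J) (spikeL I J w t)"
    by (rule measure_spikeL_cong[OF I J]) (use I i0 s in \<open>simp add: w_def sqnorm_single\<close>, simp add: s_def)
  also have "\<dots> \<le> measure (gauss_matrix I J) ((\<lambda>G. restrict G ({i0} \<times> J)) -` {x \<in> space (gauss_matrix {i0} J). sqnorm ({i0} \<times> J) x \<le> \<alpha>} \<inter> space (gauss_matrix I J))"
  proof (rule P.finite_measure_mono)
    show "(\<lambda>G. restrict G ({i0} \<times> J)) -` {x \<in> space (gauss_matrix {i0} J). sqnorm ({i0} \<times> J) x \<le> \<alpha>} \<inter> space (gauss_matrix I J) \<in> sets (gauss_matrix I J)"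
      by (rule measurable_sets[OF measurable_restrict_subset[OF sub]]) measurable
    show "spikeL I J w t \<subseteq> (\<lambda>G. restrict G ({i0} \<times> J)) -` {x \<in> space (gauss_matrix {i0} J). sqnorm ({i0} \<times> J) x \<le> \<alpha>} \<inter> space (gauss_matrix I J)"
    proof
      fix G assume "G \<in> spikeL I J w t"
      then have G: "G \<in> space (gauss_matrix I J)" and le: "sqnorm J (comb I x G) + (cmod (bilin I x w))\<^sup>2 \<le> t * sqnorm I x" for x
        by (auto simp: spikeL_def)
      define e where "e = (\<lambda>i. if i = i0 then 1 else (0::complex))"
      have lfe: "bilin I e y = y i0" for y
        unfolding bilin_def using I i0 by (subst sum.remove[of _ i0]) (auto simp: e_def intro!: sum.neutral)
      have ne: "sqnorm I e = 1"
        unfolding sqnorm_def using I i0 by (subst sum.remove[of _ i0]) (auto simp: e_def intro!: sum.neutral)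
      have "sqnorm J (\<lambda>j. G (i0, j)) + s \<le> t" using le[of e] s by (simp add: lfe ne w_def)
      hence "sqnorm ({i0} \<times> J) (restrict G ({i0} \<times> J)) \<le> \<alpha>"
        using d s by (simp add: sqnorm_prod(2) cong: sqnorm_cong)
      with G show "G \<in> (\<lambda>G. restrict G ({i0} \<times> J)) -` {x \<in> space (gauss_matrix {i0} J). sqnorm ({i0} \<times> J) x \<le> \<alpha>} \<inter> space (gauss_matrix I J)"
        by (auto simp: space_PiM)
    qed
  qed
  also have "\<dots> = measure (distr (gauss_matrix I J) (gauss_matrix {i0} J) (\<lambda>G. restrict G ({i0} \<times> J))) {x \<in> space (gauss_matrix {i0} J). sqnorm ({i0} \<times> J) x \<le> \<alpha>}"
    by (rule measure_distr[symmetric, OF measurable_restrict_subset[OF sub]]) measurable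
  also have "distr (gauss_matrix I J) (gauss_matrix {i0} J) (\<lambda>G. restrict G ({i0} \<times> J)) = gauss_matrix {i0} J"
    using sub I J by (intro distr_PiM_cgauss_restrict) (auto intro: finite_subset)
  finally show ?thesis .
qed

section \<open>Eliminating a column and the recursion\<close>

text \<open>A column spike concentrated in \<open>j0\<close> gives that column the weight 1 +
  \<kappa> in the form. Split off, the column acts on the remaining matrix as a row spike along
  itself, scaled by sqrt (1 + \<kappa>).\<close>

lemma col_step_merge:
  assumes J: "finite J" "j0 \<notin> J" and \<kappa>: "\<kappa> \<ge> 0"
    and x: "x \<in> space (gauss_matrix I {j0})" and y: "y \<in> space (gauss_matrix I J)"
  shows "merge (I \<times> {j0}) (I \<times> J) (x, y) \<in> spikeR I (insert j0 J) (\<lambda>j. if j = j0 then complex_of_real (sqrt \<kappa>) else 0) t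
    \<longleftrightarrow> y \<in> spikeL I J (\<lambda>i. complex_of_real (sqrt (1 + \<kappa>)) * x (i, j0)) t"
proof -
  let ?G = "merge (I \<times> {j0}) (I \<times> J) (x, y)"
  let ?w = "\<lambda>j. if j = j0 then complex_of_real (sqrt \<kappa>) else 0"
  have un: "I \<times> insert j0 J = I \<times> {j0} \<union> I \<times> J" by auto
  have sp: "?G \<in> space (gauss_matrix I (insert j0 J))" unfolding un by (rule merge_in_space[OF x y])
  have mf: "?G (i, j0) = x (i, j0)" "j \<in> J \<Longrightarrow> ?G (i, j) = y (i, j)" if "i \<in> I" for i j
    using that J by (auto simp: merge_def)
  have b: "bilin I z (\<lambda>i. ?G (i, j0)) = bilin I z (\<lambda>i. x (i, j0))"
    "j \<in> J \<Longrightarrow> bilin I z (\<lambda>i. ?G (i, j)) = bilin I z (\<lambda>i. y (i, j))" for z j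
    using mf by (auto intro!: bilin_cong)
  have 1: "sqnorm (insert j0 J) (comb I z ?G) = (cmod (bilin I z (\<lambda>i. x (i, j0))))\<^sup>2 + sqnorm J (comb I z y)" for z
    using J b by (simp add: sqnorm_def)
  have 2: "bilin (insert j0 J) ?w (comb I z ?G) = complex_of_real (sqrt \<kappa>) * bilin I z (\<lambda>i. x (i, j0))" for z
    unfolding bilin_def[of "insert j0 J"] using J b(1) by (auto simp: sum.neutral)
  have eq: "sqnorm (insert j0 J) (comb I z ?G) + (cmod (bilin (insert j0 J) ?w (comb I z ?G)))\<^sup>2
    = sqnorm J (comb I z y) + (cmod (bilin I z (\<lambda>i. complex_of_real (sqrt (1 + \<kappa>)) * x (i, j0))))\<^sup>2" for z
    unfolding 1 2 bilin_scale using \<kappa> by (simp add: norm_mult power_mult_distrib algebra_simps)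
  show ?thesis
    using sp y unfolding spikeL_def spikeR_def mem_Collect_eq eq by simp
qed

text \<open>The new row spike has squared norm (1 + k) |column|^2. Combined with the row step this
  is one turn of the recursion, s' = \<beta> (1 + \<alpha> / (t - s - \<alpha>)).\<close>

lemma measure_not_spikeR_col:
  assumes I: "finite I" and J: "finite J" "j0 \<notin> J" and q: "q \<ge> 0"
    and \<beta>: "(1 + \<kappa>) * \<beta> \<le> S" "\<beta> \<ge> 0"
    and IH: "\<And>v. sqnorm I v \<le> S \<Longrightarrow> prob_not I J (spikeL I J v t) \<le> q"
    and u: "sqnorm (insert j0 J) u \<le> \<kappa>"
  shows "prob_not I (insert j0 J) (spikeR I (insert j0 J) u t)
    \<le> q + upper_tail (I \<times> {j0}) \<beta>"
proof -
  let ?JJ = "insert j0 J"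
  interpret P: prob_space "gauss_matrix I ?JJ" by (rule prob_space_PiM_cgauss)
  define k where "k = sqnorm ?JJ u"
  define w where "w = (\<lambda>j. if j = j0 then complex_of_real (sqrt k) else 0)"
  have k: "k \<ge> 0" "k \<le> \<kappa>" using u by (auto simp: k_def)
  have fJ: "finite ?JJ" using J by simp
  have "measure (gauss_matrix I ?JJ) (spikeR I ?JJ u t) = measure (gauss_matrix I ?JJ) (spikeR I ?JJ w t)"
    by (rule measure_spikeR_cong[OF I fJ]) (use fJ k in \<open>simp add: w_def sqnorm_single\<close>, simp add: k_def)
  hence "prob_not I ?JJ (spikeR I ?JJ u t) = prob_not I ?JJ (spikeR I ?JJ w t)"
    using I by (subst (1 2) P.prob_compl) auto
  also have un: "I \<times> ?JJ = I \<times> {j0} \<union> I \<times> J" by auto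
  hence "prob_not I ?JJ (spikeR I ?JJ w t)
    = measure (gauss (I \<times> {j0} \<union> I \<times> J)) (space (gauss_matrix I ?JJ) - spikeR I ?JJ w t)" by simp
  also have "\<dots> \<le> q + prob_not I {j0} ({x \<in> space (gauss_matrix I {j0}). sqnorm (I \<times> {j0}) x \<le> \<beta>})"
  proof (rule measure_PiM_Un_le)
    show "space (gauss_matrix I ?JJ) - spikeR I ?JJ w t \<in> sets (gauss (I \<times> {j0} \<union> I \<times> J))"
      unfolding un[symmetric] using I by auto
    fix x assume x: "x \<in> {x \<in> space (gauss_matrix I {j0}). sqnorm (I \<times> {j0}) x \<le> \<beta>}"
    then have xs: "x \<in> space (gauss_matrix I {j0})" and xb: "sqnorm I (\<lambda>i. x (i, j0)) \<le> \<beta>"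
      by (auto simp: sqnorm_prod(1))
    let ?v = "\<lambda>i. complex_of_real (sqrt (1 + k)) * x (i, j0)"
    have "sqnorm I ?v = (1 + k) * sqnorm I (\<lambda>i. x (i, j0))"
      unfolding sqnorm_scale using k by simp
    also have "\<dots> \<le> (1 + \<kappa>) * \<beta>" using xb k \<beta>(2) by (intro mult_mono) auto
    finally have v: "sqnorm I ?v \<le> S" using \<beta> by linarith
    have "{y \<in> space (gauss_matrix I J). merge (I \<times> {j0}) (I \<times> J) (x, y) \<in> space (gauss_matrix I ?JJ) - spikeR I ?JJ w t}
      \<subseteq> space (gauss_matrix I J) - spikeL I J ?v t"
      using col_step_merge[OF J k(1) xs, of _ t] unfolding w_def by auto
    hence "measure (gauss_matrix I J) {y \<in> space (gauss_matrix I J). merge (I \<times> {j0}) (I \<times> J) (x, y) \<in> space (gauss_matrix I ?JJ) - spikeR I ?JJ w t}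
      \<le> prob_not I J (spikeL I J ?v t)"
      using I by (intro finite_measure.finite_measure_mono prob_space.finite_measure prob_space_PiM_cgauss) auto
    thus "measure (gauss_matrix I J) {y \<in> space (gauss_matrix I J). merge (I \<times> {j0}) (I \<times> J) (x, y) \<in> space (gauss_matrix I ?JJ) - spikeR I ?JJ w t} \<le> q"
      using IH[OF v] by linarith
  qed (use I J q in auto)
  also have "space (gauss_matrix I {j0}) - {x \<in> space (gauss_matrix I {j0}). sqnorm (I \<times> {j0}) x \<le> \<beta>} = {x \<in> space (gauss_matrix I {j0}). \<not> sqnorm (I \<times> {j0}) x \<le> \<beta>}"
    by auto
  finally show ?thesis .
qed

lemma measure_spikeR_col:
  assumes I: "finite I" and J: "finite J" "j0 \<notin> J" and q: "q \<ge> 0"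
    and \<beta>: "S \<le> (1 + \<kappa>) * \<beta>" "\<beta> \<ge> 0"
    and IH: "\<And>v. S \<le> sqnorm I v \<Longrightarrow> measure (gauss_matrix I J) (spikeL I J v t) \<le> q"
    and u: "\<kappa> \<le> sqnorm (insert j0 J) u"
  shows "measure (gauss_matrix I (insert j0 J)) (spikeR I (insert j0 J) u t)
    \<le> q + lower_tail (I \<times> {j0}) \<beta>"
proof -
  let ?JJ = "insert j0 J"
  define k where "k = sqnorm ?JJ u"
  define w where "w = (\<lambda>j. if j = j0 then complex_of_real (sqrt k) else 0)"
  have k: "k \<ge> 0" "k \<ge> \<kappa>" using u by (auto simp: k_def)
  have fJ: "finite ?JJ" using J by simp
  have "measure (gauss_matrix I ?JJ) (spikeR I ?JJ u t) = measure (gauss_matrix I ?JJ) (spikeR I ?JJ w t)"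
    by (rule measure_spikeR_cong[OF I fJ]) (use fJ k in \<open>simp add: w_def sqnorm_single\<close>, simp add: k_def)
  also have un: "I \<times> ?JJ = I \<times> {j0} \<union> I \<times> J" by auto
  hence "measure (gauss_matrix I ?JJ) (spikeR I ?JJ w t)
    = measure (gauss (I \<times> {j0} \<union> I \<times> J)) (spikeR I ?JJ w t)" by simp
  also have "\<dots> \<le> q + prob_not I {j0} ({x \<in> space (gauss_matrix I {j0}). \<not> sqnorm (I \<times> {j0}) x \<le> \<beta>})"
  proof (rule measure_PiM_Un_le)
    show "spikeR I ?JJ w t \<in> sets (gauss (I \<times> {j0} \<union> I \<times> J))"
      unfolding un[symmetric] using I by auto
    fix x assume x: "x \<in> {x \<in> space (gauss_matrix I {j0}). \<not> sqnorm (I \<times> {j0}) x \<le> \<beta>}"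
    then have xs: "x \<in> space (gauss_matrix I {j0})" and xb: "\<beta> \<le> sqnorm I (\<lambda>i. x (i, j0))"
      by (auto simp: sqnorm_prod(1))
    let ?v = "\<lambda>i. complex_of_real (sqrt (1 + k)) * x (i, j0)"
    have "(1 + \<kappa>) * \<beta> \<le> (1 + k) * sqnorm I (\<lambda>i. x (i, j0))" using xb k \<beta>(2) by (intro mult_mono) auto
    also have "\<dots> = sqnorm I ?v"
      unfolding sqnorm_scale using k by simp
    finally have v: "S \<le> sqnorm I ?v" using \<beta> by linarith
    have "{y \<in> space (gauss_matrix I J). merge (I \<times> {j0}) (I \<times> J) (x, y) \<in> spikeR I ?JJ w t} \<subseteq> spikeL I J ?v t"
      using col_step_merge[OF J k(1) xs, of _ t] unfolding w_def by auto
    hence "measure (gauss_matrix I J) {y \<in> space (gauss_matrix I J). merge (I \<times> {j0}) (I \<times> J) (x, y) \<in> spikeR I ?JJ w t}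
      \<le> measure (gauss_matrix I J) (spikeL I J ?v t)"
      using I by (intro finite_measure.finite_measure_mono prob_space.finite_measure prob_space_PiM_cgauss) auto
    thus "measure (gauss_matrix I J) {y \<in> space (gauss_matrix I J). merge (I \<times> {j0}) (I \<times> J) (x, y) \<in> spikeR I ?JJ w t} \<le> q"
      using IH[OF v] by linarith
  qed (use I J q in auto)
  also have "space (gauss_matrix I {j0}) - {x \<in> space (gauss_matrix I {j0}). \<not> sqnorm (I \<times> {j0}) x \<le> \<beta>} = {x \<in> space (gauss_matrix I {j0}). sqnorm (I \<times> {j0}) x \<le> \<beta>}"
    by auto
  finally show ?thesis .
qed

section \<open>Iterating the elimination\<close>

text \<open>By \<open>fix_le\<close>, one turn with the worst-case values \<alpha> and \<beta> maps
  spikes of size at most \<open>S\<close> to spikes of size at most \<open>S\<close>, so the same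
  \<open>S\<close> serves at every stage. Each row costs one row tail and one column tail, hence the
  factor 2. The tail bounds are asked for all index sets up to the initial sizes because the matrix
  shrinks during the induction.\<close>

lemma measure_not_spikeL_le:
  fixes I :: "'i set" and J :: "'j set"
  assumes pos: "\<alpha> \<ge> 0" "\<beta> \<ge> 0" "S \<ge> 0" "t - S - \<alpha> > 0" and fix_le: "\<beta> * (1 + \<alpha> / (t - S - \<alpha>)) \<le> S"
    and tail\<alpha>: "\<And>K::('i \<times> 'j) set. finite K \<Longrightarrow> card K \<le> m \<Longrightarrow>
       upper_tail K \<alpha> \<le> \<delta>"
    and tail\<beta>: "\<And>K::('i \<times> 'j) set. finite K \<Longrightarrow> card K \<le> n \<Longrightarrow>
       upper_tail K \<beta> \<le> \<delta>"
    and \<delta>: "\<delta> \<ge> 0"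
    and I: "finite I" "card I \<le> n" and J: "finite J" "card J \<le> m" and v: "sqnorm I v \<le> S"
  shows "prob_not I J (spikeL I J v t) \<le> 2 * real (card I) * \<delta>"
  using I J v
proof (induction I arbitrary: J v rule: finite_induct)
  case empty
  have "space (gauss_matrix {} J) - spikeL {} J v t = {}" by (auto simp: spikeL_def bilin_def sqnorm_def)
  thus ?case by (simp only: measure_empty) simp
next
  case (insert i0 I)
  have t: "t \<ge> 0" using pos by linarith
  have row\<alpha>: "upper_tail ({i0} \<times> J) \<alpha> \<le> \<delta>"
    using insert.prems by (intro tail\<alpha>) (auto simp: card_cartesian_product)
  have cI: "card I \<le> n" using insert by auto
  define \<kappa> where "\<kappa> = \<alpha> / (t - S - \<alpha>)"
  have \<kappa>: "\<kappa> \<ge> 0" using pos by (simp add: \<kappa>_def)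
  show ?case
  proof (cases "J = {}")
    case True
    \<comment> \<open>No column is left to split off: the reduced event only asks for 0 \<le> t
      |x|^2, and the row tail alone pays for this turn.\<close>
    have "space (gauss_matrix I J) - spikeR I J u t = {}" for u
      using True t by (auto simp: spikeR_def bilin_def sqnorm_def intro!: sum_nonneg mult_nonneg_nonneg)
    hence "prob_not I J (spikeR I J u t) \<le> 0" for u
      by (simp only: measure_empty)
    hence "prob_not (insert i0 I) J (spikeL (insert i0 I) J v t)
      \<le> 0 + upper_tail ({i0} \<times> J) \<alpha>"
      using insert pos by (intro measure_not_spikeL_row[where \<kappa> = \<kappa> and S = S]) (auto simp: \<kappa>_def)
    also have "\<dots> \<le> \<delta>" using row\<alpha> by simp
    also have "\<dots> \<le> 2 * real (card (insert i0 I)) * \<delta>"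
      using insert \<delta> by (simp add: algebra_simps)
    finally show ?thesis .
  next
    case False
    then obtain j0 J' where J': "J = insert j0 J'" "j0 \<notin> J'" by (meson Set.set_insert ex_in_conv)
    have fJ': "finite J'" "card J' \<le> m" using insert.prems J' by auto
    have IH: "prob_not I J' (spikeL I J' v t) \<le> 2 * real (card I) * \<delta>" if "sqnorm I v \<le> S" for v
      using insert.IH[OF cI fJ' that] .
    have colb: "upper_tail (I \<times> {j0}) \<beta> \<le> \<delta>"
      using insert cI by (intro tail\<beta>) (auto simp: card_cartesian_product)
    have R: "prob_not I J (spikeR I J u t) \<le> 2 * real (card I) * \<delta> + \<delta>" if "sqnorm J u \<le> \<kappa>" for u
    proof -
      have "prob_not I J (spikeR I J u t)
        \<le> 2 * real (card I) * \<delta> + upper_tail (I \<times> {j0}) \<beta>"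
        unfolding J'(1) using fix_le pos that fJ' J' \<delta> insert.hyps
        by (intro measure_not_spikeR_col[where S = S and \<kappa> = \<kappa>] IH) (auto simp: \<kappa>_def mult.commute)
      thus ?thesis using colb by linarith
    qed
    have "prob_not (insert i0 I) J (spikeL (insert i0 I) J v t)
      \<le> (2 * real (card I) * \<delta> + \<delta>) + upper_tail ({i0} \<times> J) \<alpha>"
      using insert pos \<delta> R by (intro measure_not_spikeL_row[where \<kappa> = \<kappa> and S = S]) (auto simp: \<kappa>_def)
    also have "\<dots> \<le> 2 * real (card (insert i0 I)) * \<delta>"
      using row\<alpha> insert.hyps by (simp add: algebra_simps)
    finally show ?thesis .
  qed
qed

text \<open>One turn sends w = t - S to at most t - \<beta> w / (w - \<alpha>), which
  \<open>decr\<close> bounds by w - \<eta>; after \<open>k\<close> turns w is at most \<alpha> and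
  \<open>measure_spikeL_row_dead\<close> applies. The sizes leave room for the \<open>k\<close> rows
  and columns removed on the way and for one last row. Two tails per turn and one at the end add up
  to 2 k + 1.\<close>

lemma measure_spikeL_le:
  fixes I :: "'i set" and J :: "'j set"
  assumes pos: "\<alpha> \<ge> 0" "\<beta> \<ge> 0"
    and decr: "\<And>w. \<alpha> < w \<Longrightarrow> w \<le> w0 \<Longrightarrow> t + \<eta> \<le> w + \<beta> * w / (w - \<alpha>)" and \<eta>: "\<eta> \<ge> 0"
    and tail\<alpha>: "\<And>K::('i \<times> 'j) set. finite K \<Longrightarrow> m \<le> card K \<Longrightarrow>
       lower_tail K \<alpha> \<le> \<delta>"
    and tail\<beta>: "\<And>K::('i \<times> 'j) set. finite K \<Longrightarrow> n \<le> card K \<Longrightarrow>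
       lower_tail K \<beta> \<le> \<delta>"
    and \<delta>: "\<delta> \<ge> 0"
    and I: "finite I" "n + k + 1 \<le> card I" and J: "finite J" "m + k \<le> card J"
    and S: "0 \<le> S" "t - S \<le> \<alpha> + real k * \<eta>" "t - S \<le> w0" and v: "S \<le> sqnorm I v"
  shows "measure (gauss_matrix I J) (spikeL I J v t) \<le> (2 * real k + 1) * \<delta>"
  using I J S v
proof (induction k arbitrary: I J S v)
  case (0 I J S v)
  then obtain i0 where i0: "i0 \<in> I" by (metis add.commute add_is_0 card.empty ex_in_conv le_zero_eq one_neq_zero)
  have "measure (gauss_matrix I J) (spikeL I J v t) \<le> lower_tail ({i0} \<times> J) \<alpha>"
    using 0 i0 by (intro measure_spikeL_row_dead[where S = S]) auto
  also have "\<dots> \<le> \<delta>" using 0 by (intro tail\<alpha>) (auto simp: card_cartesian_product)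
  finally show ?case by simp
next
  case (Suc k I J S v)
  have "I \<noteq> {}" using Suc.prems by auto
  then obtain i0 I' where I': "I = insert i0 I'" "i0 \<notin> I'" by (meson Set.set_insert ex_in_conv)
  have fI': "finite I'" "n + k + 1 \<le> card I'" using Suc.prems I' by auto
  have "J \<noteq> {}" using Suc.prems by auto
  then obtain j0 J' where J': "J = insert j0 J'" "j0 \<notin> J'" by (meson Set.set_insert ex_in_conv)
  have fJ': "finite J'" "m + k \<le> card J'" using Suc.prems J' by auto
  have row\<alpha>: "lower_tail ({i0} \<times> J) \<alpha> \<le> \<delta>"
    using Suc.prems by (intro tail\<alpha>) (auto simp: card_cartesian_product)
  show ?case
  proof (cases "t - S \<le> \<alpha>")
    \<comment> \<open>The orbit may reach \<alpha> before its budget of turns is spent; the single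
      row then ends the argument at once.\<close>
    case True
    have "measure (gauss_matrix I J) (spikeL I J v t) \<le> lower_tail ({i0} \<times> J) \<alpha>"
      using Suc.prems I' True by (intro measure_spikeL_row_dead[where S = S]) auto
    also have "\<dots> \<le> \<delta>" by (rule row\<alpha>)
    also have "\<dots> \<le> (2 * real (Suc k) + 1) * \<delta>" using \<delta> by (simp add: algebra_simps)
    finally show ?thesis .
  next
    case False
    define w where "w = t - S"
    have w: "\<alpha> < w" "w \<le> w0" using False Suc.prems by (auto simp: w_def)
    define \<kappa> where "\<kappa> = \<alpha> / (t - S - \<alpha>)"
    define S' where "S' = (1 + \<kappa>) * \<beta>"
    have \<kappa>: "\<kappa> \<ge> 0" using pos w by (simp add: \<kappa>_def w_def)
    have S'_eq: "S' = \<beta> * w / (w - \<alpha>)"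
      using w by (simp add: S'_def \<kappa>_def w_def[symmetric] field_simps)
    have "t + \<eta> \<le> w + S'" using decr[OF w] by (simp add: S'_eq)
    \<comment> \<open>The new w is below the old one, so it stays in the region w \<le> w0 where
      \<open>decr\<close> is available.\<close>
    hence S': "0 \<le> S'" "t - S' \<le> \<alpha> + real k * \<eta>" "t - S' \<le> w0"
      using Suc.prems \<eta> \<kappa> pos w by (auto simp: S'_def w_def algebra_simps)
    have IH: "measure (gauss_matrix I' J') (spikeL I' J' v t) \<le> (2 * real k + 1) * \<delta>" if "S' \<le> sqnorm I' v" for v
      using Suc.IH[OF fI' fJ' S' that] .
    have colb: "lower_tail (I' \<times> {j0}) \<beta> \<le> \<delta>"
      using fI' by (intro tail\<beta>) (auto simp: card_cartesian_product)
    have R: "measure (gauss_matrix I' J) (spikeR I' J u t) \<le> (2 * real k + 1) * \<delta> + \<delta>" if "\<kappa> \<le> sqnorm J u" for u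
    proof -
      have "measure (gauss_matrix I' J) (spikeR I' J u t)
        \<le> (2 * real k + 1) * \<delta> + lower_tail (I' \<times> {j0}) \<beta>"
        unfolding J'(1) using pos that fJ' J' \<delta> fI'
        by (intro measure_spikeR_col[where S = S' and \<kappa> = \<kappa>] IH) (auto simp: S'_def)
      thus ?thesis using colb by linarith
    qed
    have "measure (gauss_matrix (insert i0 I') J) (spikeL (insert i0 I') J v t)
      \<le> ((2 * real k + 1) * \<delta> + \<delta>) + lower_tail ({i0} \<times> J) \<alpha>"
      using Suc.prems I' fI' w \<delta> R by (intro measure_spikeL_row[where \<kappa> = \<kappa> and S = S]) (auto simp: \<kappa>_def w_def)
    also have "\<dots> \<le> (2 * real (Suc k) + 1) * \<delta>"
      using row\<alpha> by (simp add: algebra_simps)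
    finally show ?thesis using I' by simp
  qed
qed

section \<open>Chernoff bounds for Gamma tails\<close>

lemma nn_integral_exp_sqnorm:
  assumes "finite K" "\<theta> < 1"
  shows "(\<integral>\<^sup>+x. ennreal (exp (\<theta> * sqnorm K x)) \<partial>gauss K) = ennreal ((1 / (1 - \<theta>)) ^ card K)"
proof -
  have "(\<integral>\<^sup>+x. ennreal (exp (\<theta> * sqnorm K x)) \<partial>gauss K)
    = (\<integral>\<^sup>+x. (\<Prod>k\<in>K. ennreal (exp (\<theta> * (cmod (x k))\<^sup>2))) \<partial>gauss K)"
    by (simp add: sqnorm_def sum_distrib_left exp_sum assms prod_ennreal)
  also have "\<dots> = (\<Prod>k\<in>K. \<integral>\<^sup>+z. ennreal (exp (\<theta> * (cmod z)\<^sup>2)) \<partial>cgauss)"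
    using assms by (intro cgauss.product_nn_integral_prod) auto
  also have "\<dots> = ennreal ((1 / (1 - \<theta>)) ^ card K)"
    using assms by (simp add: nn_integral_cgauss_exp ennreal_power)
  finally show ?thesis .
qed

text \<open>The sign of \<theta> selects the tail, positive for the upper and negative for the lower
  one. Keeping \<open>P\<close> general lets one application of Markov's inequality serve
  both.\<close>

lemma chernoff_cgauss:
  assumes K: "finite K" and \<theta>: "\<theta> < 1"
    and [measurable]: "Measurable.pred (gauss K) P"
    and P: "\<And>x. P x \<Longrightarrow> a \<le> \<theta> * sqnorm K x"
  shows "measure (gauss K) {x \<in> space (gauss K). P x}
    \<le> exp (- a) * (1 / (1 - \<theta>)) ^ card K"
proof -
  interpret prob_space "gauss K" by (rule prob_space_PiM_cgauss)
  have "emeasure (gauss K) {x \<in> space (gauss K). P x}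
    = (\<integral>\<^sup>+x. indicator {x \<in> space (gauss K). P x} x \<partial>gauss K)"
    by (subst nn_integral_indicator) auto
  also have "\<dots> \<le> (\<integral>\<^sup>+x. ennreal (exp (- a)) * ennreal (exp (\<theta> * sqnorm K x)) \<partial>gauss K)"
    using P by (intro nn_integral_mono)
      (auto simp: indicator_def ennreal_mult'[symmetric] exp_add[symmetric] simp flip: ennreal_1)
  also have "\<dots> = ennreal (exp (- a)) * ennreal ((1 / (1 - \<theta>)) ^ card K)"
    using K by (subst nn_integral_cmult) (auto simp: nn_integral_exp_sqnorm[OF K \<theta>])
  finally show ?thesis using \<theta> by (simp add: emeasure_eq_measure ennreal_mult'[symmetric])
qed

text \<open>The deviation is measured on a common scale \<open>L\<close> rather than relative to
  \<open>m\<close>, so that rows of length about M and columns of length about N share the same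
  rate.\<close>

lemma cgauss_upper_tail:
  assumes K: "finite K" "real (card K) \<le> m" "m \<le> L" and \<epsilon>: "\<epsilon> > 0"
  shows "upper_tail K (m + \<epsilon> * L)
    \<le> exp (- (\<epsilon>\<^sup>2 / (4 + 2 * \<epsilon>)) * L)"
proof -
  \<comment> \<open>This makes 1 / (1 - \<theta>) equal to 1 + \<epsilon> / 2, which exp (\<epsilon>
    / 2) bounds; the surplus left in the exponent is \<epsilon>^2 (L - m) / (4 + 2 \<epsilon>) \<ge>
    0.\<close>
  define \<theta> where "\<theta> = \<epsilon> / (2 + \<epsilon>)"
  have \<theta>: "0 < \<theta>" "\<theta> < 1" using \<epsilon> by (auto simp: \<theta>_def)
  have "1 / (1 - \<theta>) = 1 + \<epsilon> / 2" using \<epsilon> by (simp add: \<theta>_def field_simps)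
  also have "\<dots> \<le> exp (\<epsilon> / 2)" by (rule exp_ge_add_one_self)
  finally have le: "1 / (1 - \<theta>) \<le> exp (\<epsilon> / 2)" .
  have "upper_tail K (m + \<epsilon> * L)
    \<le> exp (- (\<theta> * (m + \<epsilon> * L))) * (1 / (1 - \<theta>)) ^ card K"
    using K \<theta> by (intro chernoff_cgauss) auto
  also have "\<dots> \<le> exp (- (\<theta> * (m + \<epsilon> * L))) * exp (\<epsilon> / 2) ^ card K"
    using le \<theta> by (intro mult_left_mono power_mono) auto
  also have "\<dots> = exp (- (\<theta> * (m + \<epsilon> * L)) + real (card K) * (\<epsilon> / 2))"
    unfolding exp_add exp_of_nat_mult ..
  also have "\<dots> \<le> exp (- (\<epsilon>\<^sup>2 / (4 + 2 * \<epsilon>)) * L)"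
  proof -
    have "real (card K) * (\<epsilon> / 2) \<le> m * (\<epsilon> / 2)" using K \<epsilon> by (intro mult_right_mono) auto
    moreover have "\<theta> * (m + \<epsilon> * L) - m * (\<epsilon> / 2) - (\<epsilon>\<^sup>2 / (4 + 2 * \<epsilon>)) * L = \<epsilon>\<^sup>2 * (L - m) / (4 + 2 * \<epsilon>)"
    proof -
      define d where "d = 4 + 2 * \<epsilon>"
      have d: "d \<noteq> 0" "\<theta> = 2 * \<epsilon> / d" using \<epsilon> by (auto simp: d_def \<theta>_def field_simps)
      have swap: "a - b - c = a - c - b" for a b c :: real by simp
      have E1: "\<theta> * (m + \<epsilon> * L) - \<epsilon>\<^sup>2 / d * L = (2 * \<epsilon> * m + \<epsilon>\<^sup>2 * L) / d"
        using d by (simp add: field_simps power2_eq_square)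
      have E2: "m * (\<epsilon> / 2) = m * (2 * \<epsilon> + \<epsilon>\<^sup>2) / d"
        using d by (simp add: eq_divide_eq) (simp add: d_def power2_eq_square algebra_simps)
      have "\<theta> * (m + \<epsilon> * L) - m * (\<epsilon> / 2) - \<epsilon>\<^sup>2 / d * L
        = \<theta> * (m + \<epsilon> * L) - \<epsilon>\<^sup>2 / d * L - m * (\<epsilon> / 2)"
        by (rule swap)
      also have "\<dots> = (2 * \<epsilon> * m + \<epsilon>\<^sup>2 * L) / d - m * (2 * \<epsilon> + \<epsilon>\<^sup>2) / d"
        by (rule arg_cong2[where f = "(-)", OF E1 E2])
      also have "\<dots> = \<epsilon>\<^sup>2 * (L - m) / d"
        by (simp add: diff_divide_distrib[symmetric] algebra_simps)
      finally show ?thesis by (simp add: d_def)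
    qed
    moreover have "\<epsilon>\<^sup>2 * (L - m) / (4 + 2 * \<epsilon>) \<ge> 0" using K \<epsilon> by (intro divide_nonneg_nonneg mult_nonneg_nonneg) auto
    moreover have "- a + x \<le> - q" if "x \<le> y" "a - y - q = z" "0 \<le> z" for a x y q z :: real
      using that by linarith
    ultimately have "- (\<theta> * (m + \<epsilon> * L)) + real (card K) * (\<epsilon> / 2) \<le> - ((\<epsilon>\<^sup>2 / (4 + 2 * \<epsilon>)) * L)" by blast
    thus ?thesis by simp
  qed
  finally show ?thesis .
qed

lemma cgauss_lower_tail:
  assumes K: "finite K" "m \<le> real (card K)" "0 \<le> m" "m \<le> L" and \<epsilon>: "\<epsilon> > 0" "\<epsilon> \<le> 1"
  shows "lower_tail K (m - \<epsilon> * L)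
    \<le> exp (- (\<epsilon>\<^sup>2 / 4) * L)"
proof -
  \<comment> \<open>With parameter - \<theta> and ln (1 + \<theta>) \<ge> \<theta> - \<theta>^2 the
    exponent is at most (\<theta>^2 - \<theta> \<epsilon>) L, and \<epsilon> / 2 minimises
    this.\<close>
  define \<theta> where "\<theta> = \<epsilon> / 2"
  have \<theta>: "0 < \<theta>" "\<theta> \<le> 1" using \<epsilon> by (auto simp: \<theta>_def)
  have ln: "\<theta> - \<theta>\<^sup>2 \<le> ln (1 + \<theta>)" using \<theta> by (intro ln_one_plus_pos_lower_bound) auto
  have nn: "0 \<le> \<theta> - \<theta>\<^sup>2" using \<theta> by (simp add: power2_eq_square mult_left_le)
  have "lower_tail K (m - \<epsilon> * L)
    \<le> exp (- (- \<theta> * (m - \<epsilon> * L))) * (1 / (1 - (- \<theta>))) ^ card K"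
    using K \<theta> by (intro chernoff_cgauss) auto
  also have "(1 / (1 - (- \<theta>))) ^ card K = exp (- (real (card K) * ln (1 + \<theta>)))"
    using \<theta> by (simp add: exp_minus exp_of_nat_mult power_divide inverse_eq_divide)
  also have "\<dots> \<le> exp (- (m * (\<theta> - \<theta>\<^sup>2)))"
    using K ln nn by (simp add: mult_mono)
  also have "exp (- (- \<theta> * (m - \<epsilon> * L))) * exp (- (m * (\<theta> - \<theta>\<^sup>2))) = exp (\<theta>\<^sup>2 * m - \<theta> * \<epsilon> * L)"
    by (simp add: exp_add[symmetric] algebra_simps)
  also have "\<dots> \<le> exp (- (\<epsilon>\<^sup>2 / 4) * L)"
  proof -
    have "\<theta>\<^sup>2 * m \<le> \<theta>\<^sup>2 * L" using K by (intro mult_left_mono) auto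
    thus ?thesis by (simp add: \<theta>_def power2_eq_square)
  qed
  finally show ?thesis by simp
qed

section \<open>Limits of the recursion\<close>

text \<open>A vector close in each coordinate to the conjugate of \<open>x\<close> pairs with
  \<open>x\<close> to nearly |x|^2 = 1. The candidates take their entries from a finite
  \<delta>-cover of the unit disc and are extended by 0 outside \<open>U\<close>, so that they are
  also spikes on the full set of rows.\<close>

lemma finite_net_unit_sphere:
  assumes fin: "finite U" and \<eta>: "\<eta> > 0"
  shows "\<exists>F. finite F \<and> (\<forall>u\<in>F. sqnorm U u \<le> 1 + \<eta> \<and> (\<forall>i. i \<notin> U \<longrightarrow> u i = 0))
    \<and> (\<forall>x. sqnorm U x = 1 \<longrightarrow> (\<exists>u\<in>F. 1 - \<eta> \<le> (cmod (bilin U x u))\<^sup>2))"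
proof -
  \<comment> \<open>3 card U \<delta> \<le> \<eta> covers the error 2 card U \<delta> + card U
    \<delta> in the squared norm of \<open>u\<close> and the error 2 card U \<delta> in the squared
    pairing. The summand 1 takes care of empty \<open>U\<close>, and \<delta> \<le> 1 gives
    \<delta>^2 \<le> \<delta>.\<close>
  define \<delta> where "\<delta> = min 1 (\<eta> / (3 * (real (card U) + 1)))"
  have \<delta>: "\<delta> > 0" "\<delta> \<le> 1" using \<eta> by (auto simp: \<delta>_def)
  have "3 * (real (card U) + 1) * \<delta> \<le> \<eta>"
    using \<eta> mult_left_mono[of \<delta> "\<eta> / (3 * (real (card U) + 1))" "3 * (real (card U) + 1)"]
    by (simp add: \<delta>_def)
  hence \<delta>\<eta>: "3 * real (card U) * \<delta> \<le> \<eta>" using \<delta> by (simp add: algebra_simps)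
  obtain Z :: "complex set" where Z: "finite Z" "cball 0 1 \<subseteq> (\<Union>z\<in>Z. ball z \<delta>)"
    using compact_imp_seq_compact[OF compact_cball, of "0::complex" 1, THEN seq_compact_imp_totally_bounded] \<delta>(1) by blast
  define ext where "ext = (\<lambda>u i. if i \<in> U then (u i :: complex) else 0)"
  define F where "F = {u \<in> ext ` PiE U (\<lambda>_. Z). sqnorm U u \<le> 1 + \<eta>}"
  have "finite (ext ` PiE U (\<lambda>_. Z))" using fin Z by (intro finite_imageI finite_PiE) auto
  hence "finite F" unfolding F_def by (rule finite_subset[rotated]) auto
  moreover have "\<exists>u\<in>F. 1 - \<eta> \<le> (cmod (bilin U x u))\<^sup>2" if x: "sqnorm U x = 1" for x
  proof -
    have x1: "cmod (x i) \<le> 1" if "i \<in> U" for i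
    proof -
      have "(cmod (x i))\<^sup>2 \<le> sqnorm U x" unfolding sqnorm_def using that fin by (intro member_le_sum) auto
      thus ?thesis using x power2_le_imp_le[of "cmod (x i)" 1] by simp
    qed
    have "\<forall>i\<in>U. \<exists>z\<in>Z. dist z (cnj (x i)) < \<delta>"
      using Z(2) x1 by (auto simp: subset_iff)
    then obtain z where z: "\<And>i. i \<in> U \<Longrightarrow> z i \<in> Z \<and> dist (z i) (cnj (x i)) < \<delta>" by metis
    define u where "u = ext (restrict z U)"
    define e where "e i = u i - cnj (x i)" for i
    have e: "cmod (e i) \<le> \<delta>" if "i \<in> U" for i
      using z[OF that] that by (simp add: e_def u_def ext_def dist_norm)
    have "cmod (bilin U x e) \<le> (\<Sum>i\<in>U. cmod (x i * e i))" unfolding bilin_def by (rule norm_sum)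
    also have "\<dots> \<le> (\<Sum>i\<in>U. 1 * \<delta>)" unfolding norm_mult using x1 e \<delta> by (intro sum_mono mult_mono) auto
    finally have lfe: "cmod (bilin U x e) \<le> real (card U) * \<delta>" by simp
    have ne: "sqnorm U e \<le> real (card U) * \<delta>"
    proof -
      have "sqnorm U e \<le> (\<Sum>i\<in>U. \<delta> * 1)" unfolding sqnorm_def power2_eq_square using e \<delta>
        by (intro sum_mono mult_mono) (auto intro: order_trans)
      thus ?thesis by simp
    qed
    have u_eq: "u = (\<lambda>i. cnj (x i) + e i)" by (simp add: e_def)
    have "sqnorm U u = 1 + 2 * Re (bilin U x e) + sqnorm U e" unfolding u_eq sqnorm_add using x by simp
    also have "Re (bilin U x e) \<le> real (card U) * \<delta>" using lfe complex_Re_le_cmod order_trans by blast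
    finally have nu: "sqnorm U u \<le> 1 + \<eta>" using ne \<delta>\<eta> by (simp add: algebra_simps)
    have "bilin U x u = 1 + bilin U x e"
      unfolding u_eq bilin_add using sqnorm_bilin[of U x] x by (simp add: bilin_commute)
    hence "1 - real (card U) * \<delta> \<le> cmod (bilin U x u)"
      using norm_triangle_ineq2[of 1 "- bilin U x e"] lfe by simp
    hence "1 - \<eta> \<le> (cmod (bilin U x u))\<^sup>2"
    proof (cases "1 - real (card U) * \<delta> \<ge> 0")
      case True
      have "(1 - real (card U) * \<delta>)\<^sup>2 \<le> (cmod (bilin U x u))\<^sup>2"
        using True \<open>1 - real (card U) * \<delta> \<le> cmod (bilin U x u)\<close> by (intro power_mono) auto
      moreover have "1 - 2 * (real (card U) * \<delta>) \<le> (1 - real (card U) * \<delta>)\<^sup>2"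
        using \<delta> by (simp add: power2_eq_square algebra_simps)
      moreover have "0 \<le> real (card U) * \<delta>" using \<delta> by simp
      ultimately show ?thesis using \<delta>\<eta> by linarith
    next
      case False
      have "0 \<le> real (card U) * \<delta>" using \<delta> by simp
      hence "1 - \<eta> \<le> 0" using False \<delta>\<eta> by linarith
      thus ?thesis by (rule order_trans) simp
    qed
    moreover have "u \<in> F" unfolding F_def u_def using nu z by (auto simp: u_def)
    ultimately show ?thesis by blast
  qed
  ultimately show ?thesis
    by (intro exI[of _ F]) (auto simp: F_def ext_def)
qed

lemma finite_net:
  assumes fin: "finite U" and \<eta>: "\<eta> > 0"
  shows "\<exists>F. finite F \<and> (\<forall>u\<in>F. sqnorm U u \<le> 1 + \<eta> \<and> (\<forall>i. i \<notin> U \<longrightarrow> u i = 0))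
    \<and> (\<forall>x. \<exists>u\<in>F. (1 - \<eta>) * sqnorm U x \<le> (cmod (bilin U x u))\<^sup>2)"
proof -
  obtain F where F: "finite F" "\<And>u. u \<in> F \<Longrightarrow> sqnorm U u \<le> 1 + \<eta> \<and> (\<forall>i. i \<notin> U \<longrightarrow> u i = 0)"
    "\<And>x. sqnorm U x = 1 \<Longrightarrow> \<exists>u\<in>F. 1 - \<eta> \<le> (cmod (bilin U x u))\<^sup>2"
    using finite_net_unit_sphere[OF fin \<eta>] by blast
  \<comment> \<open>The zero vector settles the case that \<open>x\<close> vanishes on
    \<open>U\<close>, even if \<open>F\<close> is empty.\<close>
  have "\<exists>u\<in>insert (\<lambda>_. 0) F. (1 - \<eta>) * sqnorm U x \<le> (cmod (bilin U x u))\<^sup>2" for x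
  proof (cases "sqnorm U x = 0")
    case False
    define c where "c = complex_of_real (1 / sqrt (sqnorm U x))"
    have pos: "sqnorm U x > 0" using False sqnorm_nonneg[of U x] by linarith
    have c2: "(cmod c)\<^sup>2 = 1 / sqnorm U x" using pos by (simp add: c_def norm_divide power_divide)
    have "sqnorm U (\<lambda>i. c * x i) = 1" using pos by (simp add: sqnorm_scale c2)
    then obtain u where u: "u \<in> F" "1 - \<eta> \<le> (cmod (bilin U (\<lambda>i. c * x i) u))\<^sup>2" using F(3) by blast
    have "bilin U (\<lambda>i. c * x i) u = c * bilin U x u" by (simp add: bilin_commute[of U _ u] bilin_scale)
    hence "1 - \<eta> \<le> (cmod (bilin U x u))\<^sup>2 / sqnorm U x" using u(2) by (simp add: norm_mult power_mult_distrib c2)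
    hence "(1 - \<eta>) * sqnorm U x \<le> (cmod (bilin U x u))\<^sup>2" using pos by (simp add: pos_le_divide_eq)
    with u show ?thesis by blast
  qed auto
  thus ?thesis using F(1,2) \<eta> by (intro exI[of _ "insert (\<lambda>_. 0) F"]) (auto simp: sqnorm_def)
qed

section \<open>From a diagonal covariance to single spikes, and the limits on both sides\<close>

text \<open>With D the diagonal matrix of \<open>e\<close>, the form of D^(1/2) G at z is written in
  the variable x = D^(1/2) z. This puts the eigenvalues on the right-hand side and leaves
  \<open>G\<close> with its standard law.\<close>

definition cov_le :: "'i set \<Rightarrow> 'j set \<Rightarrow> ('i \<Rightarrow> real) \<Rightarrow> real \<Rightarrow> ('i \<times> 'j \<Rightarrow> complex) set" where
  "cov_le I J e t = {G \<in> space (gauss_matrix I J).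
     \<forall>x. sqnorm J (comb I x G) \<le> t * (\<Sum>i\<in>I. (cmod (x i))\<^sup>2 / e i)}"

lemma sets_cov_le [measurable]:
  assumes "finite I" shows "cov_le I J e t \<in> sets (gauss_matrix I J)"
proof -
  have "cov_le I J e t = {G \<in> space (gauss_matrix I J).
     \<forall>x. sqnorm J (comb I x G) - t * (\<Sum>i\<in>I. (cmod (x i))\<^sup>2 * inverse (e i)) \<le> 0}"
    by (simp add: cov_le_def divide_inverse)
  also have "\<dots> \<in> sets (gauss_matrix I J)"
    by (rule sets_Collect_all_le_0[OF assms]) (auto intro!: tendsto_intros tendsto_sqnorm tendsto_bilin)
  finally show ?thesis .
qed

text \<open>Raising every \<open>e i\<close> on \<open>U\<close> to the bound \<open>l\<close> makes
  the condition harder, and its right side becomes t |x|^2 - s |x_U|^2, where x_U is the part on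
  \<open>U\<close>: a spike of rank card U. The net trades it for finitely many rank-one spikes. The
  best squared pairing misses |x_U|^2 by at most \<eta> |x_U|^2, and this loss is charged to the
  level, which drops to t - s \<eta>.\<close>

lemma measure_not_cov_le:
  assumes I: "finite I" "U \<subseteq> I" and F: "finite F"
    and u: "\<And>u i. u \<in> F \<Longrightarrow> i \<notin> U \<Longrightarrow> u i = 0"
    and net: "\<And>x. \<exists>u\<in>F. (1 - \<eta>) * sqnorm U x \<le> (cmod (bilin U x u))\<^sup>2"
    and \<eta>: "\<eta> \<ge> 0" and l: "l \<ge> 1" and t: "t \<ge> 0"
    and e: "\<And>i. i \<in> U \<Longrightarrow> 0 < e i \<and> e i \<le> l" "\<And>i. i \<in> I - U \<Longrightarrow> e i = 1"
  defines "s \<equiv> t * (1 - 1 / l)"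
  shows "prob_not I J (cov_le I J e t)
    \<le> (\<Sum>u\<in>F. prob_not I J (spikeL I J (\<lambda>i. complex_of_real (sqrt s) * u i) (t - s * \<eta>)))"
proof -
  interpret prob_space "gauss_matrix I J" by (rule prob_space_PiM_cgauss)
  have s: "s \<ge> 0" using t l by (simp add: s_def)
  have fU: "finite U" using I finite_subset by blast
  have "space (gauss_matrix I J) - cov_le I J e t \<subseteq> (\<Union>u\<in>F. space (gauss_matrix I J) - spikeL I J (\<lambda>i. complex_of_real (sqrt s) * u i) (t - s * \<eta>))"
  proof (rule ccontr)
    assume "\<not> ?thesis"
    then obtain G where G: "G \<in> space (gauss_matrix I J)" "G \<notin> cov_le I J e t"
      and sp: "\<And>u. u \<in> F \<Longrightarrow> G \<in> spikeL I J (\<lambda>i. complex_of_real (sqrt s) * u i) (t - s * \<eta>)"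
      by blast
    have "sqnorm J (comb I x G) \<le> t * (\<Sum>i\<in>I. (cmod (x i))\<^sup>2 / e i)" for x
    proof -
      obtain u0 where u0: "u0 \<in> F" "(1 - \<eta>) * sqnorm U x \<le> (cmod (bilin U x u0))\<^sup>2" using net by blast
      have "bilin I x u0 = bilin U x u0"
        unfolding bilin_def using u[OF u0(1)] I by (intro sum.mono_neutral_right) auto
      hence A1: "(cmod (bilin I x (\<lambda>i. complex_of_real (sqrt s) * u0 i)))\<^sup>2 = s * (cmod (bilin U x u0))\<^sup>2"
        using s by (simp add: bilin_scale norm_mult power_mult_distrib)
      have A2: "s * ((1 - \<eta>) * sqnorm U x) \<le> s * (cmod (bilin U x u0))\<^sup>2" using u0 s by (intro mult_left_mono)
      have "sqnorm J (comb I x G) + s * ((1 - \<eta>) * sqnorm U x) \<le> (t - s * \<eta>) * sqnorm I x"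
      proof -
        have "sqnorm J (comb I x G) + (cmod (bilin I x (\<lambda>i. complex_of_real (sqrt s) * u0 i)))\<^sup>2 \<le> (t - s * \<eta>) * sqnorm I x"
          using sp[OF u0(1)] unfolding spikeL_def by blast
        with A1 A2 show ?thesis by linarith
      qed
      moreover have "s * \<eta> * sqnorm U x \<le> s * \<eta> * sqnorm I x"
        unfolding sqnorm_def using s \<eta> I by (intro mult_left_mono sum_mono2) auto
      ultimately have 1: "sqnorm J (comb I x G) \<le> t * sqnorm I x - s * sqnorm U x"
        by (simp add: algebra_simps)
      have split: "(\<Sum>i\<in>I. f i) = (\<Sum>i\<in>U. f i) + (\<Sum>i\<in>I - U. f i)" for f :: "'a \<Rightarrow> real"
        using sum.subset_diff[OF I(2) I(1), of f] by simp
      have "(\<Sum>i\<in>U. (cmod (x i))\<^sup>2 / l) \<le> (\<Sum>i\<in>U. (cmod (x i))\<^sup>2 / e i)"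
        using e(1) by (intro sum_mono divide_left_mono) (auto intro: mult_pos_pos less_le_trans)
      moreover have "(\<Sum>i\<in>I - U. (cmod (x i))\<^sup>2 / e i) = sqnorm (I - U) x"
        using e(2) by (simp add: sqnorm_def)
      ultimately have "sqnorm U x / l + sqnorm (I - U) x \<le> (\<Sum>i\<in>I. (cmod (x i))\<^sup>2 / e i)"
        unfolding split[of "\<lambda>i. (cmod (x i))\<^sup>2 / e i"] by (simp add: sqnorm_def sum_divide_distrib)
      hence "t * (sqnorm U x / l + sqnorm (I - U) x) \<le> t * (\<Sum>i\<in>I. (cmod (x i))\<^sup>2 / e i)"
        using t by (rule mult_left_mono)
      moreover have "t * (sqnorm U x / l + sqnorm (I - U) x) = t * sqnorm I x - s * sqnorm U x"
      proof -
        have "sqnorm I x = sqnorm U x + sqnorm (I - U) x" unfolding sqnorm_def by (rule split)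
        thus ?thesis by (simp add: s_def algebra_simps)
      qed
      ultimately show ?thesis using 1 by linarith
    qed
    with G show False by (simp add: cov_le_def)
  qed
  hence "prob_not I J (cov_le I J e t)
    \<le> measure (gauss_matrix I J) (\<Union>u\<in>F. space (gauss_matrix I J) - spikeL I J (\<lambda>i. complex_of_real (sqrt s) * u i) (t - s * \<eta>))"
    by (rule finite_measure_mono) (intro sets.finite_UN sets.Diff sets.top sets_spikeL F I)
  also have "\<dots> \<le> (\<Sum>u\<in>F. prob_not I J (spikeL I J (\<lambda>i. complex_of_real (sqrt s) * u i) (t - s * \<eta>)))"
    using F I by (intro measure_UNION_le) auto
  finally show ?thesis .
qed

text \<open>The bound \<open>l\<close> on the spikes is free, and l (1 + c / (l - 1)) is smallest at
  l = 1 + sqrt c; hence spikes up to the threshold are best bounded by the threshold itself. The net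
  parameter \<eta> doubles as the deviation of row and column norms and is chosen once, for the
  limiting parameters.\<close>

lemma cov_le_upper_tendsto:
  fixes M N :: "nat \<Rightarrow> nat" and \<tau> l :: "nat \<Rightarrow> real" and e :: "nat \<Rightarrow> nat \<Rightarrow> real" and J :: "nat \<Rightarrow> 'j set"
  assumes M: "filterlim M at_top sequentially" and NM: "\<And>n. N n \<le> M n" and r: "\<And>n. r \<le> N n"
    and c: "(\<lambda>n. real (N n) / real (M n)) \<longlonglongrightarrow> c" "c \<ge> 0"
    and l: "l \<longlonglongrightarrow> l0" "l0 > 1"
    and \<tau>: "\<tau> \<longlonglongrightarrow> \<tau>0" "\<tau>0 > l0 * (1 + c / (l0 - 1))"
    and e: "\<And>n i. i < r \<Longrightarrow> 0 < e n i \<and> e n i \<le> l n" "\<And>n i. r \<le> i \<Longrightarrow> i < N n \<Longrightarrow> e n i = 1"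
    and J: "\<And>n. finite (J n)" "\<And>n. card (J n) \<le> M n"
  shows "(\<lambda>n. prob_not {..<N n} (J n) (cov_le {..<N n} (J n) (e n) (real (M n) * \<tau> n))) \<longlonglongrightarrow> 0"
proof -
  \<comment> \<open>In units of M, \<open>\<sigma>\<close> is the spike size s (1 + \<eta>) and
    \<open>w\<close> is the level t - s \<eta> minus that size. H \<ge> 0 is the hypothesis
    \<open>fix_le\<close> of \<open>measure_not_spikeL_le\<close> with \<alpha> = 1 + \<eta> and
    \<beta> = c + \<eta>.\<close>
  define w where "w \<eta> t l = t * (1 - (1 + 2 * \<eta>) * (1 - 1 / l))" for \<eta> t l :: real
  define \<sigma> where "\<sigma> \<eta> t l = (1 + \<eta>) * t * (1 - 1 / l)" for \<eta> t l :: real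
  define H where "H \<eta> t l = \<sigma> \<eta> t l - (c + \<eta>) * (1 + (1 + \<eta>) / (w \<eta> t l - (1 + \<eta>)))" for \<eta> t l :: real
  have \<tau>0l0: "\<tau>0 / l0 > 1 + c / (l0 - 1)" using \<tau>(2) l(2) by (simp add: field_simps)
  have w0: "w 0 \<tau>0 l0 = \<tau>0 / l0" using l by (simp add: w_def field_simps)
  have cl: "c / (l0 - 1) \<ge> 0" using c l by simp
  hence \<tau>0l0': "\<tau>0 / l0 - 1 > 0" using \<tau>0l0 by linarith
  \<comment> \<open>At \<eta> = 0 one has w = \<tau>0 / l0, and positivity of \<open>H\<close>
    amounts to c < (w - 1) (l0 - 1), which is the hypothesis on \<open>\<tau>0\<close>. As an open
    condition it survives for small \<eta> > 0.\<close>
  have "c < (\<tau>0 / l0 - 1) * (l0 - 1)"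
    using \<tau>0l0 l(2) by (simp add: pos_divide_less_eq[symmetric] less_diff_eq add.commute)
  hence "c / (\<tau>0 / l0 - 1) < l0 - 1" using \<tau>0l0' by (simp add: pos_divide_less_eq mult.commute)
  moreover have "\<sigma> 0 \<tau>0 l0 = \<tau>0 / l0 * (l0 - 1)" using l by (simp add: \<sigma>_def field_simps)
  moreover have "c * (1 + 1 / (\<tau>0 / l0 - 1)) = \<tau>0 / l0 * (c / (\<tau>0 / l0 - 1))"
  proof -
    have "c * (1 + 1 / (q - 1)) = q * (c / (q - 1))" if "q - 1 > 0" for q :: real
      using that by (simp add: field_simps)
    from this[OF \<tau>0l0'] show ?thesis .
  qed
  ultimately have "c * (1 + 1 / (\<tau>0 / l0 - 1)) < \<sigma> 0 \<tau>0 l0"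
    using \<tau>0l0' by (simp only:) (rule mult_strict_left_mono, auto)
  hence H0: "H 0 \<tau>0 l0 > 0"
    by (simp add: H_def w0)
  have l0: "l0 \<noteq> 0" using l by simp
  have limw: "((\<lambda>\<eta>. w \<eta> \<tau>0 l0 - (1 + \<eta>)) \<longlongrightarrow> w 0 \<tau>0 l0 - (1 + 0)) (at_right 0)"
    unfolding w_def by (intro tendsto_intros)
  have "((\<lambda>\<eta>. H \<eta> \<tau>0 l0) \<longlongrightarrow> H 0 \<tau>0 l0) (at_right 0)"
    unfolding H_def \<sigma>_def using \<tau>0l0' w0 by (intro tendsto_intros limw) auto
  hence "\<forall>\<^sub>F \<eta> in at_right 0. H \<eta> \<tau>0 l0 > 0" using H0 by (rule order_tendstoD)
  moreover have "\<forall>\<^sub>F \<eta> in at_right 0. w \<eta> \<tau>0 l0 - (1 + \<eta>) > 0"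
    using limw \<tau>0l0' w0 by (intro order_tendstoD(1)) auto
  moreover have "\<forall>\<^sub>F \<eta> in at_right (0::real). \<eta> > 0" by (simp add: eventually_at_right_less)
  ultimately have "\<forall>\<^sub>F \<eta> in at_right 0. H \<eta> \<tau>0 l0 > 0 \<and> w \<eta> \<tau>0 l0 - (1 + \<eta>) > 0 \<and> \<eta> > 0"
    by eventually_elim auto
  then obtain \<eta> where \<eta>: "H \<eta> \<tau>0 l0 > 0" "w \<eta> \<tau>0 l0 - (1 + \<eta>) > 0" "\<eta> > 0"
    using eventually_happens'[OF trivial_limit_at_right_real] by blast
  have limw: "(\<lambda>n. w \<eta> (\<tau> n) (l n) - (1 + \<eta>)) \<longlonglongrightarrow> w \<eta> \<tau>0 l0 - (1 + \<eta>)"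
    unfolding w_def by (intro tendsto_intros \<tau> l l0)
  have limH: "(\<lambda>n. \<sigma> \<eta> (\<tau> n) (l n) - (real (N n) / real (M n) + \<eta>) * (1 + (1 + \<eta>) / (w \<eta> (\<tau> n) (l n) - (1 + \<eta>)))) \<longlonglongrightarrow> H \<eta> \<tau>0 l0"
    unfolding H_def \<sigma>_def using \<eta>(2) by (intro tendsto_intros limw c \<tau> l l0) auto
  obtain F where F: "finite F" "\<And>u. u \<in> F \<Longrightarrow> sqnorm {..<r} u \<le> 1 + \<eta>" "\<And>u i. u \<in> F \<Longrightarrow> i \<notin> {..<r} \<Longrightarrow> u i = 0"
    "\<And>x. \<exists>u\<in>F. (1 - \<eta>) * sqnorm {..<r} x \<le> (cmod (bilin {..<r} x u))\<^sup>2"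
    using finite_net[of "{..<r}" \<eta>] \<eta>(3) by auto
  define h where "h = \<eta>\<^sup>2 / (4 + 2 * \<eta>)"
  have h: "h > 0" using \<eta> by (simp add: h_def)
  have \<tau>0: "\<tau>0 > 0" using \<tau>0l0' l by (simp add: field_simps)
  have Mr: "filterlim (\<lambda>n. real (M n)) at_top sequentially"
    by (rule filterlim_compose[OF filterlim_real_sequentially M])
  \<comment> \<open>Each of the card F rank-one spikes costs 2 N \<le> 2 M tails.\<close>
  have ev: "\<forall>\<^sub>F n in sequentially. prob_not {..<N n} (J n) (cov_le {..<N n} (J n) (e n) (real (M n) * \<tau> n))
    \<le> real (card F) * (2 * (real (M n) * exp (- h * real (M n))))"
    using order_tendstoD(1)[OF limw \<eta>(2)] order_tendstoD(1)[OF limH \<eta>(1)] order_tendstoD(1)[OF l(1,2)]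
      order_tendstoD(1)[OF \<tau>(1) \<tau>0] filterlim_at_top_dense[THEN iffD1, OF Mr, rule_format, of 0]
  proof eventually_elim
    case (elim n)
    define t where "t = real (M n) * \<tau> n"
    define s where "s = t * (1 - 1 / l n)"
    have t: "t \<ge> 0" using elim by (simp add: t_def)
    have s: "s \<ge> 0" using elim t by (simp add: s_def)
    have Mp: "real (M n) > 0" using elim by simp
    have "prob_not {..<N n} (J n) (cov_le {..<N n} (J n) (e n) t)
      \<le> (\<Sum>u\<in>F. prob_not {..<N n} (J n) (spikeL {..<N n} (J n) (\<lambda>i. complex_of_real (sqrt s) * u i) (t - s * \<eta>)))"
      unfolding s_def
      by (rule measure_not_cov_le[where U = "{..<r}"]) (use F \<eta> t elim r[of n] e in auto)
    also have "\<dots> \<le> (\<Sum>u\<in>F. 2 * (real (M n) * exp (- h * real (M n))))"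
    proof (rule sum_mono)
      fix u assume u: "u \<in> F"
      let ?\<alpha> = "real (M n) + \<eta> * real (M n)" and ?\<beta> = "real (N n) + \<eta> * real (M n)" and ?S = "s * (1 + \<eta>)"
      have S: "?S = real (M n) * \<sigma> \<eta> (\<tau> n) (l n)" by (simp add: s_def t_def \<sigma>_def)
      have D: "t - s * \<eta> - ?S - ?\<alpha> = real (M n) * (w \<eta> (\<tau> n) (l n) - (1 + \<eta>))"
      proof -
        define y where "y = 1 / l n"
        show ?thesis unfolding s_def t_def w_def y_def[symmetric] by (simp add: algebra_simps)
      qed
      have "prob_not {..<N n} (J n) (spikeL {..<N n} (J n) (\<lambda>i. complex_of_real (sqrt s) * u i) (t - s * \<eta>))
        \<le> 2 * real (card {..<N n}) * exp (- h * real (M n))"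
      proof (rule measure_not_spikeL_le[where \<alpha> = ?\<alpha> and \<beta> = ?\<beta> and S = ?S and m = "M n" and n = "N n"])
        show "t - s * \<eta> - ?S - ?\<alpha> > 0" unfolding D using elim Mp by simp
        show "?\<beta> * (1 + ?\<alpha> / (t - s * \<eta> - ?S - ?\<alpha>)) \<le> ?S"
        proof -
          have "?\<beta> = real (M n) * (real (N n) / real (M n) + \<eta>)" using Mp by (simp add: algebra_simps)
          moreover have "?\<alpha> / (t - s * \<eta> - ?S - ?\<alpha>) = (1 + \<eta>) / (w \<eta> (\<tau> n) (l n) - (1 + \<eta>))"
          proof -
            have "?\<alpha> = real (M n) * (1 + \<eta>)" by (simp add: algebra_simps)
            thus ?thesis unfolding D using Mp by simp
          qed
          ultimately have "?\<beta> * (1 + ?\<alpha> / (t - s * \<eta> - ?S - ?\<alpha>))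
            = real (M n) * ((real (N n) / real (M n) + \<eta>) * (1 + (1 + \<eta>) / (w \<eta> (\<tau> n) (l n) - (1 + \<eta>))))"
            by (simp only: mult.assoc)
          also have "\<dots> \<le> real (M n) * \<sigma> \<eta> (\<tau> n) (l n)" using elim by (intro mult_left_mono) auto
          finally show ?thesis unfolding S .
        qed
        show "upper_tail K ?\<alpha> \<le> exp (- h * real (M n))"
          if "finite K" "card K \<le> M n" for K :: "(nat \<times> 'j) set"
          unfolding h_def using that \<eta> by (intro cgauss_upper_tail) auto
        show "upper_tail K ?\<beta> \<le> exp (- h * real (M n))"
          if "finite K" "card K \<le> N n" for K :: "(nat \<times> 'j) set"
          unfolding h_def using that \<eta> NM[of n] by (intro cgauss_upper_tail) auto
        have "sqnorm {..<N n} u = sqnorm {..<r} u"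
          unfolding sqnorm_def using F(3)[OF u] r[of n] by (intro sum.mono_neutral_right) auto
        hence "sqnorm {..<N n} (\<lambda>i. complex_of_real (sqrt s) * u i) = s * sqnorm {..<r} u"
          using s by (simp add: sqnorm_scale)
        also have "\<dots> \<le> ?S" using F(2)[OF u] s by (intro mult_left_mono)
        finally show "sqnorm {..<N n} (\<lambda>i. complex_of_real (sqrt s) * u i) \<le> ?S" .
      qed (use \<eta> s J in auto)
      also have "\<dots> \<le> 2 * real (M n) * exp (- h * real (M n))"
        using NM[of n] by (intro mult_right_mono) auto
      finally show "prob_not {..<N n} (J n) (spikeL {..<N n} (J n) (\<lambda>i. complex_of_real (sqrt s) * u i) (t - s * \<eta>))
        \<le> 2 * (real (M n) * exp (- h * real (M n)))" by (simp add: mult_ac)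
    qed
    also have "\<dots> = real (card F) * (2 * (real (M n) * exp (- h * real (M n))))" by simp
    finally show ?case by (simp add: t_def)
  qed
  have "((\<lambda>x::real. x * exp (- h * x)) \<longlongrightarrow> 0) at_top" using h by real_asymp
  hence "(\<lambda>n. real (M n) * exp (- h * real (M n))) \<longlonglongrightarrow> 0"
    by (rule filterlim_compose) (rule filterlim_compose[OF filterlim_real_sequentially M])
  hence "(\<lambda>n. real (card F) * (2 * (real (M n) * exp (- h * real (M n))))) \<longlonglongrightarrow> 0"
    by (intro tendsto_mult_right_zero)
  thus ?thesis
    by (rule tendsto_sandwich[OF _ ev tendsto_const, rotated]) auto
qed


text \<open>Vectors vanishing outside \<open>I'\<close> see only the rows in \<open>I'\<close>, so
  every spike except the one at \<open>i0\<close> drops out. For them the right side is t |x|^2 - t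
  (1 - 1 / l) |x i0|^2, a single spike condition; l = 1 means no spike at all.\<close>

lemma measure_cov_le_le:
  assumes I: "finite I" "I' \<subseteq> I" "i0 \<in> I'" and J: "finite J" and l: "l \<ge> 1" and t: "t \<ge> 0"
    and e: "e i0 = l" "\<And>i. i \<in> I' - {i0} \<Longrightarrow> e i = 1"
  shows "measure (gauss_matrix I J) (cov_le I J e t)
    \<le> measure (gauss_matrix I' J) (spikeL I' J (\<lambda>i. if i = i0 then complex_of_real (sqrt (t * (1 - 1 / l))) else 0) t)"
proof -
  interpret P: prob_space "gauss_matrix I J" by (rule prob_space_PiM_cgauss)
  let ?v = "\<lambda>i. if i = i0 then complex_of_real (sqrt (t * (1 - 1 / l))) else 0"
  let ?R = "\<lambda>G. restrict G (I' \<times> J)"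
  have sub: "I' \<times> J \<subseteq> I \<times> J" using I by auto
  have fI': "finite I'" using I finite_subset by blast
  have "measure (gauss_matrix I J) (cov_le I J e t) \<le> measure (gauss_matrix I J) (?R -` spikeL I' J ?v t \<inter> space (gauss_matrix I J))"
  proof (rule P.finite_measure_mono)
    show "?R -` spikeL I' J ?v t \<inter> space (gauss_matrix I J) \<in> sets (gauss_matrix I J)"
      by (rule measurable_sets[OF measurable_restrict_subset[OF sub] sets_spikeL[OF fI']])
    show "cov_le I J e t \<subseteq> ?R -` spikeL I' J ?v t \<inter> space (gauss_matrix I J)"
    proof
      fix G assume "G \<in> cov_le I J e t"
      then have G: "G \<in> space (gauss_matrix I J)"
        and le: "sqnorm J (comb I x G) \<le> t * (\<Sum>i\<in>I. (cmod (x i))\<^sup>2 / e i)" for x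
        by (auto simp: cov_le_def)
      have "sqnorm J (comb I' x (?R G)) + (cmod (bilin I' x ?v))\<^sup>2 \<le> t * sqnorm I' x" for x
      proof -
        define x' where "x' i = (if i \<in> I' then x i else 0)" for i
        have bilin': "bilin I x' y = bilin I' x y" for y
          unfolding bilin_def using I by (intro sum.mono_neutral_cong_right) (auto simp: x'_def)
        have "sqnorm J (comb I' x (?R G)) = sqnorm J (comb I x' G)"
          unfolding bilin' by (intro sqnorm_cong bilin_cong) auto
        moreover have "(\<Sum>i\<in>I. (cmod (x' i))\<^sup>2 / e i) = (\<Sum>i\<in>I'. (cmod (x i))\<^sup>2 / e i)"
          using I by (intro sum.mono_neutral_cong_right) (auto simp: x'_def)
        moreover have "(\<Sum>i\<in>I'. (cmod (x i))\<^sup>2 / e i) = (cmod (x i0))\<^sup>2 / l + sqnorm (I' - {i0}) x"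
          unfolding sum.remove[OF fI' I(3)] sqnorm_def using e by (intro arg_cong2[where f = "(+)"] sum.cong) auto
        moreover have "sqnorm I' x = (cmod (x i0))\<^sup>2 + sqnorm (I' - {i0}) x"
          unfolding sqnorm_def by (rule sum.remove[OF fI' I(3)])
        moreover have "(cmod (bilin I' x ?v))\<^sup>2 = t * (1 - 1 / l) * (cmod (x i0))\<^sup>2"
        proof -
          have "bilin I' x ?v = x i0 * complex_of_real (sqrt (t * (1 - 1 / l)))"
            unfolding bilin_def sum.remove[OF fI' I(3)] by (auto intro!: sum.neutral)
          moreover have "t * (1 - 1 / l) \<ge> 0" using t l by simp
          ultimately show ?thesis by (simp add: norm_mult power_mult_distrib)
        qed
        ultimately show ?thesis using le[of x'] by (simp add: algebra_simps)
      qed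
      moreover have "?R G \<in> space (gauss_matrix I' J)" using measurable_space[OF measurable_restrict_subset[OF sub] G] .
      ultimately show "G \<in> ?R -` spikeL I' J ?v t \<inter> space (gauss_matrix I J)" using G by (simp add: spikeL_def)
    qed
  qed
  also have "\<dots> = measure (distr (gauss_matrix I J) (gauss_matrix I' J) ?R) (spikeL I' J ?v t)"
    by (rule measure_distr[symmetric, OF measurable_restrict_subset[OF sub] sets_spikeL[OF fI']])
  also have "distr (gauss_matrix I J) (gauss_matrix I' J) ?R = gauss_matrix I' J"
    using sub fI' J by (intro distr_PiM_cgauss_restrict) auto
  finally show ?thesis .
qed

text \<open>In units of M, \<open>a\<close> and \<open>b\<close> are lower estimates of row and
  column norms, \<tau> / l is the start of the orbit, and \<open>decr\<close> is a decrease by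
  \<eta> per turn as long as w \<le> w0. None of these constants depends on the sequence index, so
  the number of turns is bounded.\<close>

lemma cov_le_lower_tendsto:
  fixes M N :: "nat \<Rightarrow> nat" and \<tau> l :: "nat \<Rightarrow> real" and e :: "nat \<Rightarrow> nat \<Rightarrow> real" and J :: "nat \<Rightarrow> 'j set"
    and I' :: "nat \<Rightarrow> nat set" and i0 :: "nat \<Rightarrow> nat"
  assumes M: "filterlim M at_top sequentially"
    and c: "(\<lambda>n. real (N n) / real (M n)) \<longlonglongrightarrow> c" "c \<le> 1"
    and ab: "0 \<le> a" "a < 1" "0 \<le> b" "b < c"
    and decr: "\<And>w. a < w \<Longrightarrow> w \<le> w0 \<Longrightarrow> t0 + \<eta> \<le> w + b * w / (w - a)" and \<eta>: "\<eta> > 0"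
    and \<tau>: "\<forall>\<^sub>F n in sequentially. 0 \<le> \<tau> n \<and> \<tau> n \<le> t0 \<and> 1 \<le> l n \<and> \<tau> n / l n \<le> w0"
    and I': "\<forall>\<^sub>F n in sequentially. I' n \<subseteq> {..<N n} \<and> i0 n \<in> I' n \<and> N n - r \<le> card (I' n)
       \<and> e n (i0 n) = l n \<and> (\<forall>i\<in>I' n - {i0 n}. e n i = 1)"
    and J: "\<And>n. finite (J n)" "\<And>n. M n \<le> card (J n) + 1"
  shows "(\<lambda>n. measure (gauss_matrix {..<N n} (J n)) (cov_le {..<N n} (J n) (e n) (real (M n) * \<tau> n))) \<longlonglongrightarrow> 0"
proof -
  \<comment> \<open>The orbit starts at \<tau> / l \<le> t0 and loses \<eta> per turn, so this many
    turns bring it below \<open>a\<close>.\<close>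
  define k where "k = nat \<lceil>t0 / \<eta>\<rceil>"
  have k: "t0 \<le> real k * \<eta>"
  proof -
    have "t0 / \<eta> \<le> real k" unfolding k_def by linarith
    thus ?thesis using \<eta> by (simp add: pos_divide_le_eq)
  qed
  \<comment> \<open>One half of each gap 1 - a and c - b absorbs the boundedly many lost columns and
    rows, the other half the random deviation.\<close>
  define ea eb where "ea = (1 - a) / 2" and "eb = (c - b) / 2"
  have eab: "0 < ea" "ea \<le> 1" "0 < eb" "eb \<le> 1" using ab c by (auto simp: ea_def eb_def)
  define h where "h = min (ea\<^sup>2 / 4) (eb\<^sup>2 / 4)"
  have h: "h > 0" using eab by (simp add: h_def)
  have Mr: "filterlim (\<lambda>n. real (M n)) at_top sequentially"
    by (rule filterlim_compose[OF filterlim_real_sequentially M])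
  have cM: "(\<lambda>n. C / real (M n)) \<longlonglongrightarrow> 0" for C
    by (rule tendsto_divide_0[OF tendsto_const]) (rule filterlim_at_top_imp_at_infinity[OF Mr])
  have "(\<lambda>n. 1 - real (k + 1) / real (M n)) \<longlonglongrightarrow> 1 - 0" by (intro tendsto_intros cM)
  hence evA: "\<forall>\<^sub>F n in sequentially. 1 - real (k + 1) / real (M n) > 1 - ea"
    using eab by (intro order_tendstoD(1)) auto
  have "(\<lambda>n. real (N n) / real (M n) - real (r + k + 1) / real (M n)) \<longlonglongrightarrow> c - 0" by (intro tendsto_intros cM c)
  hence evB: "\<forall>\<^sub>F n in sequentially. real (N n) / real (M n) - real (r + k + 1) / real (M n) > c - eb"
    using eab by (intro order_tendstoD(1)) auto
  have ev: "\<forall>\<^sub>F n in sequentially. measure (gauss_matrix {..<N n} (J n)) (cov_le {..<N n} (J n) (e n) (real (M n) * \<tau> n))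
    \<le> (2 * real k + 1) * exp (- h * real (M n))"
    using evA evB \<tau> I' filterlim_at_top_dense[THEN iffD1, OF Mr, rule_format, of 0]
  proof eventually_elim
    case (elim n)
    define t where "t = real (M n) * \<tau> n"
    define s where "s = t * (1 - 1 / l n)"
    define v where "v = (\<lambda>i. if i = i0 n then complex_of_real (sqrt s) else 0)"
    have Mp: "real (M n) > 0" using elim by simp
    have t: "t \<ge> 0" using elim by (simp add: t_def)
    have s: "s \<ge> 0" using elim t by (simp add: s_def)
    have fI': "finite (I' n)" using elim finite_subset by blast
    have A: "(1 - ea) * real (M n) + real (k + 1) < real (M n)"
      using elim(1) Mp by (simp add: field_simps)
    have "(c - eb) * real (M n) < (real (N n) / real (M n) - real (r + k + 1) / real (M n)) * real (M n)"
      using elim(2) Mp by (intro mult_strict_right_mono) auto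
    hence B: "(c - eb) * real (M n) + real (r + k + 1) < real (N n)" using Mp by (simp add: left_diff_distrib)
    have "(1 - ea) * real (M n) \<ge> 0" using eab by simp
    hence kM: "k + 1 \<le> M n" using A by linarith
    have "(c - eb) * real (M n) \<ge> 0" using ab by (simp add: eb_def field_simps)
    hence kN: "r + k + 1 \<le> N n" using B by linarith
    have h_le: "exp (- (ea\<^sup>2 / 4) * real (M n)) \<le> exp (- h * real (M n))" "exp (- (eb\<^sup>2 / 4) * real (M n)) \<le> exp (- h * real (M n))"
      using mult_right_mono[of h "ea\<^sup>2 / 4" "real (M n)"] mult_right_mono[of h "eb\<^sup>2 / 4" "real (M n)"]
      by (simp_all add: h_def)
    have "measure (gauss_matrix {..<N n} (J n)) (cov_le {..<N n} (J n) (e n) t) \<le> measure (gauss_matrix (I' n) (J n)) (spikeL (I' n) (J n) v t)"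
      unfolding v_def s_def using elim J t by (intro measure_cov_le_le) auto
    also have "\<dots> \<le> (2 * real k + 1) * exp (- h * real (M n))"
    \<comment> \<open>One column is missing because of the sample mean and \<open>k\<close> go to
      the recursion; up to \<open>r\<close> rows were discarded beforehand and k + 1 are reserved
      for the recursion.\<close>
    proof (rule measure_spikeL_le[where \<alpha> = "a * real (M n)" and \<beta> = "b * real (M n)" and ?w0.0 = "w0 * real (M n)"
          and \<eta> = "\<eta> * real (M n)" and m = "M n - 1 - k" and n = "N n - r - k - 1" and S = s])
      show "t + \<eta> * real (M n) \<le> w + b * real (M n) * w / (w - a * real (M n))"
        if w: "a * real (M n) < w" "w \<le> w0 * real (M n)" for w
      proof -
        define u where "u = w / real (M n)"
        have wu: "w = u * real (M n)" using Mp by (simp add: u_def)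
        have u: "a < u" "u \<le> w0" using w Mp unfolding wu by auto
        have "t + \<eta> * real (M n) \<le> (t0 + \<eta>) * real (M n)"
          using elim Mp by (simp add: t_def algebra_simps)
        also have "\<dots> \<le> (u + b * u / (u - a)) * real (M n)" using decr[OF u] Mp by (intro mult_right_mono) auto
        also have "\<dots> = w + b * real (M n) * w / (w - a * real (M n))"
        proof -
          have "w - a * real (M n) = (u - a) * real (M n)" by (simp add: wu algebra_simps)
          hence "b * real (M n) * w / (w - a * real (M n)) = b * u / (u - a) * real (M n)" using Mp by (simp add: wu)
          moreover have "(u + b * u / (u - a)) * real (M n) = u * real (M n) + b * u / (u - a) * real (M n)"
            by (rule distrib_right)
          ultimately show ?thesis using wu by simp
        qed
        finally show ?thesis .
      qed
      show "lower_tail K (a * real (M n)) \<le> exp (- h * real (M n))"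
        if "finite K" "M n - 1 - k \<le> card K" for K :: "(nat \<times> 'j) set"
      proof -
        have "a * real (M n) = (1 - ea) * real (M n) - ea * real (M n)" by (simp add: ea_def field_simps)
        moreover have "(1 - ea) * real (M n) \<le> real (card K)" using A that kM by linarith
        ultimately have "lower_tail K (a * real (M n)) \<le> exp (- (ea\<^sup>2 / 4) * real (M n))"
          using cgauss_lower_tail[of K "(1 - ea) * real (M n)" "real (M n)" ea] that eab by (simp add: mult_left_le_one_le)
        also note h_le(1)
        finally show ?thesis .
      qed
      show "lower_tail K (b * real (M n)) \<le> exp (- h * real (M n))"
        if "finite K" "N n - r - k - 1 \<le> card K" for K :: "(nat \<times> 'j) set"
      proof -
        have "b * real (M n) = (c - eb) * real (M n) - eb * real (M n)" by (simp add: eb_def field_simps)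
        moreover have "(c - eb) * real (M n) \<le> real (card K)" using B that kN by linarith
        moreover have "c - eb \<le> 1" "0 \<le> c - eb" using ab c eab by (auto simp: eb_def field_simps)
        ultimately have "lower_tail K (b * real (M n)) \<le> exp (- (eb\<^sup>2 / 4) * real (M n))"
          using cgauss_lower_tail[of K "(c - eb) * real (M n)" "real (M n)" eb] that eab by (simp add: mult_left_le_one_le)
        also note h_le(2)
        finally show ?thesis .
      qed
      show "N n - r - k - 1 + k + 1 \<le> card (I' n)" using elim kN by linarith
      show "M n - 1 - k + k \<le> card (J n)" using J(2)[of n] kM by linarith
      have ts: "t - s = t / l n" by (simp add: s_def algebra_simps)
      have l1: "1 \<le> l n" using elim by auto
      have "t / l n \<le> t" using mult_left_mono[of 1 "l n" t] l1 t by (simp add: pos_divide_le_eq)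
      also have "t \<le> real (M n) * t0" unfolding t_def using elim by (intro mult_left_mono) auto
      also have "\<dots> \<le> real (M n) * (real k * \<eta>)" using k by (intro mult_left_mono) auto
      also have "\<dots> \<le> a * real (M n) + real k * (\<eta> * real (M n))" using ab by simp
      finally show "t - s \<le> a * real (M n) + real k * (\<eta> * real (M n))" unfolding ts .
      have "t / l n = real (M n) * (\<tau> n / l n)" by (simp add: t_def)
      also have "\<dots> \<le> real (M n) * w0" using elim by (intro mult_left_mono) auto
      finally show "t - s \<le> w0 * real (M n)" unfolding ts by (simp add: mult.commute)
      show "s \<le> sqnorm (I' n) v" unfolding v_def using sqnorm_single[OF fI' _ s, of "i0 n"] elim by simp
    qed (use ab \<eta> J s fI' in auto)
    finally show ?case by (simp add: t_def)
  qed
  have "((\<lambda>x::real. exp (- h * x)) \<longlongrightarrow> 0) at_top" using h by real_asymp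
  hence "(\<lambda>n. exp (- h * real (M n))) \<longlonglongrightarrow> 0" by (rule filterlim_compose) (rule Mr)
  hence "(\<lambda>n. (2 * real k + 1) * exp (- h * real (M n))) \<longlonglongrightarrow> 0" by (rule tendsto_mult_right_zero)
  thus ?thesis by (rule tendsto_sandwich[OF _ ev tendsto_const, rotated]) auto
qed

section \<open>Uniform decrease of the one-dimensional recursion\<close>

text \<open>With y = w - a the right side is y + a b / y + a + b, at least (sqrt a + sqrt b)^2 by
  AM-GM. The choice a = 1 - \<epsilon>, b = c (1 - \<epsilon>) turns this into (1 - \<epsilon>) (1 +
  sqrt c)^2, still above q for small \<epsilon>.\<close>

lemma decrease_null:
  fixes c q :: real
  assumes c: "0 < c" and q: "q < (1 + sqrt c)\<^sup>2"
  shows "\<exists>a b \<eta>. 0 \<le> a \<and> a < 1 \<and> 0 \<le> b \<and> b < c \<and> \<eta> > 0 \<and> (\<forall>w. a < w \<longrightarrow> q + \<eta> \<le> w + b * w / (w - a))"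
proof -
  define C where "C = (1 + sqrt c)\<^sup>2"
  have C: "C > 0" unfolding C_def using c by (intro zero_less_power add_pos_nonneg) auto
  \<comment> \<open>Half of the gap C - q pays for the loss \<epsilon> C, the other half becomes
    \<eta>; the cap 1/2 keeps \<open>a\<close> and \<open>b\<close> positive when q is very
    negative.\<close>
  define \<epsilon> where "\<epsilon> = min (1/2) ((C - q) / (2 * C))"
  have \<epsilon>: "0 < \<epsilon>" "\<epsilon> < 1" using q C by (auto simp: \<epsilon>_def C_def)
  have "\<epsilon> * C \<le> (C - q) / (2 * C) * C" using C by (intro mult_right_mono) (auto simp: \<epsilon>_def)
  hence \<epsilon>C: "\<epsilon> * C \<le> (C - q) / 2" using C by simp
  define a b where "a = 1 - \<epsilon>" and "b = c * (1 - \<epsilon>)"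
  have "q + (C - q) / 2 \<le> w + b * w / (w - a)" if w: "a < w" for w
  proof -
    define y where "y = w - a"
    have y: "y > 0" using w by (simp add: y_def)
    have sc: "sqrt c * sqrt c = c" using c by simp
    have "0 \<le> (y - a * sqrt c)\<^sup>2 / y" using y by simp
    also have "\<dots> = y + a * b / y - 2 * (a * sqrt c)"
    proof -
      have "(y - a * sqrt c)\<^sup>2 = y * y + a * b - 2 * (a * sqrt c) * y"
        using sc by (simp add: a_def b_def power2_eq_square algebra_simps)
      thus ?thesis using y by (simp add: add_divide_distrib diff_divide_distrib)
    qed
    finally have "2 * (a * sqrt c) \<le> y + a * b / y" by simp
    moreover have "w + b * w / (w - a) = y + a * b / y + a + b"
      using y by (simp add: y_def field_simps)
    moreover have "a + b + 2 * (a * sqrt c) = (1 - \<epsilon>) * C"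
      using sc by (simp add: a_def b_def C_def power2_eq_square algebra_simps)
    moreover have "(1 - \<epsilon>) * C = C - \<epsilon> * C" by (simp add: algebra_simps)
    moreover have "q + (C - q) / 2 \<le> W"
      if "2 * z \<le> Y" "W = Y + a + b" "a + b + 2 * z = V" "V = C - E" "E \<le> (C - q) / 2" for W Y z V E :: real
      using that by (simp add: field_simps)
    ultimately show ?thesis using \<epsilon>C by blast
  qed
  moreover have "0 \<le> a" "a < 1" "0 \<le> b" "b < c" "(C - q) / 2 > 0"
    using \<epsilon> c q by (auto simp: a_def b_def C_def)
  ultimately show ?thesis by blast
qed

text \<open>Left of 1 + sqrt c the function w + c w / (w - 1) decreases, so on w \<le> w0 it is
  smallest at w0, where exceeding l w0 is equivalent to w0 < 1 + c / (l - 1). The hypothesis c < (l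
  - 1)^2 puts 1 + c / (l - 1), and with it w0, left of the minimum.\<close>

lemma decrease_spiked:
  fixes c l q :: real
  assumes c: "0 < c" and l: "l > 1" "c < (l - 1)\<^sup>2" and q: "q < 1 + c / (l - 1)"
  shows "\<exists>a b w0 \<eta>. 0 \<le> a \<and> a < 1 \<and> 0 \<le> b \<and> b < c \<and> \<eta> > 0 \<and> q < w0
    \<and> (\<forall>w. a < w \<longrightarrow> w \<le> w0 \<longrightarrow> l * w0 + \<eta> \<le> w + b * w / (w - a))"
proof -
  have "0 < c / (l - 1)" using c l by simp
  hence "max q 1 < 1 + c / (l - 1)" using q by simp
  then obtain w0 where w0: "max q 1 < w0" "w0 < 1 + c / (l - 1)" using dense by blast
  have w1: "w0 - 1 > 0" using w0 by simp
  have w0l: "(w0 - 1) * (l - 1) < c" using w0 l by (simp add: pos_less_divide_eq[symmetric])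
  have "(w0 - 1) * (w0 - 1) < c"
  proof -
    have "w0 - 1 < l - 1"
    proof -
      have "w0 - 1 < c / (l - 1)" using w0 by simp
      also have "\<dots> < l - 1" using l by (simp add: pos_divide_less_eq power2_eq_square)
      finally show ?thesis .
    qed
    hence "(w0 - 1) * (w0 - 1) < (w0 - 1) * (l - 1)" using w1 by (intro mult_strict_left_mono) auto
    with w0l show ?thesis by simp
  qed
  \<comment> \<open>\<open>E1\<close> says that w0 is left of the minimum, \<open>E2\<close> that
    the value there exceeds l w0. Both are strict at \<epsilon> = 0 and written so that continuity
    in \<epsilon> carries them over to a = 1 - \<epsilon>, b = c (1 - \<epsilon>).\<close>
  hence E1: "(1 - 0) * (c * (1 - 0)) - (w0 - (1 - 0)) * (w0 - (1 - 0)) > (0::real)" by simp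
  have E2: "w0 + c * (1 - 0) * w0 / (w0 - (1 - 0)) - l * w0 > (0::real)"
  proof -
    have "l - 1 < c / (w0 - 1)" using w0l w1 by (simp add: pos_less_divide_eq mult.commute)
    hence "w0 * (l - 1) < w0 * (c / (w0 - 1))" using w1 by (intro mult_strict_left_mono) auto
    thus ?thesis by (simp add: algebra_simps)
  qed
  have "((\<lambda>\<epsilon>. (1 - \<epsilon>) * (c * (1 - \<epsilon>)) - (w0 - (1 - \<epsilon>)) * (w0 - (1 - \<epsilon>))) \<longlongrightarrow>
      (1 - 0) * (c * (1 - 0)) - (w0 - (1 - 0)) * (w0 - (1 - 0))) (at_right (0::real))"
    by (intro tendsto_intros)
  from order_tendstoD(1)[OF this E1]
  have "\<forall>\<^sub>F \<epsilon> in at_right 0. 0 < (1 - \<epsilon>) * (c * (1 - \<epsilon>)) - (w0 - (1 - \<epsilon>)) * (w0 - (1 - \<epsilon>))" .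
  moreover have "((\<lambda>\<epsilon>. w0 + c * (1 - \<epsilon>) * w0 / (w0 - (1 - \<epsilon>)) - l * w0) \<longlongrightarrow>
      w0 + c * (1 - 0) * w0 / (w0 - (1 - 0)) - l * w0) (at_right (0::real))"
    using w1 by (intro tendsto_intros) auto
  from order_tendstoD(1)[OF this E2]
  have "\<forall>\<^sub>F \<epsilon> in at_right 0. 0 < w0 + c * (1 - \<epsilon>) * w0 / (w0 - (1 - \<epsilon>)) - l * w0" .
  moreover have "\<forall>\<^sub>F \<epsilon> in at_right (0::real). \<epsilon> > 0" by (simp add: eventually_at_right_less)
  moreover have "\<forall>\<^sub>F \<epsilon> in at_right (0::real). \<epsilon> < 1" by (rule order_tendstoD(2)[OF tendsto_ident_at]) simp
  ultimately have "\<forall>\<^sub>F \<epsilon> in at_right 0. 0 < (1 - \<epsilon>) * (c * (1 - \<epsilon>)) - (w0 - (1 - \<epsilon>)) * (w0 - (1 - \<epsilon>))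
     \<and> 0 < w0 + c * (1 - \<epsilon>) * w0 / (w0 - (1 - \<epsilon>)) - l * w0 \<and> 0 < \<epsilon> \<and> \<epsilon> < 1"
    by eventually_elim auto
  then obtain \<epsilon> where \<epsilon>: "0 < (1 - \<epsilon>) * (c * (1 - \<epsilon>)) - (w0 - (1 - \<epsilon>)) * (w0 - (1 - \<epsilon>))"
     "0 < w0 + c * (1 - \<epsilon>) * w0 / (w0 - (1 - \<epsilon>)) - l * w0" "0 < \<epsilon>" "\<epsilon> < 1"
    using eventually_happens'[OF trivial_limit_at_right_real] by blast
  define a b where "a = 1 - \<epsilon>" and "b = c * (1 - \<epsilon>)"
  define \<eta> where "\<eta> = w0 + b * w0 / (w0 - a) - l * w0"
  have \<eta>: "\<eta> > 0" using \<epsilon> by (simp add: \<eta>_def a_def b_def)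
  have wa: "w0 - a > 0" using w1 \<epsilon> by (simp add: a_def)
  have sq: "(w0 - a) * (w0 - a) < a * b" using \<epsilon> by (simp add: a_def b_def)
  have "l * w0 + \<eta> \<le> w + b * w / (w - a)" if w: "a < w" "w \<le> w0" for w
  proof -
    have f: "x + b * x / (x - a) = x + b + a * b / (x - a)" if "x - a > 0" for x
      using that by (simp add: field_simps)
    have "(w - a) * (w0 - a) \<le> (w0 - a) * (w0 - a)" using w wa by (intro mult_right_mono) auto
    hence "(w - a) * (w0 - a) \<le> a * b" using sq by linarith
    hence 1: "1 \<le> a * b / ((w - a) * (w0 - a))" using w wa by (simp add: pos_le_divide_eq)
    have "a * b / (w - a) - a * b / (w0 - a) = (w0 - w) * (a * b / ((w - a) * (w0 - a)))"
      using w wa by (simp add: diff_frac_eq) (simp add: algebra_simps)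
    moreover have "(w0 - w) * 1 \<le> (w0 - w) * (a * b / ((w - a) * (w0 - a)))"
      using w 1 by (intro mult_left_mono) auto
    ultimately have "w0 + b * w0 / (w0 - a) \<le> w + b * w / (w - a)"
      using f[of w] f[of w0] w wa by simp
    thus ?thesis by (simp add: \<eta>_def)
  qed
  moreover have "0 \<le> a" "a < 1" "0 \<le> b" "b < c" "q < w0"
    using \<epsilon> c w0 by (auto simp: a_def b_def)
  ultimately show ?thesis using \<eta> by blast
qed

section \<open>Unitary diagonalization of Hermitian matrices\<close>

lemma dim_mat_adjoint [simp]: "dim_row (mat_adjoint A) = dim_col A" "dim_col (mat_adjoint A) = dim_row A"
  by (auto simp: mat_adjoint_def)

lemma mat_adjoint_carrier [simp]: "A \<in> carrier_mat n m \<Longrightarrow> mat_adjoint A \<in> carrier_mat m n"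
  by (intro carrier_matI) auto

lemma index_mat_adjoint [simp]:
  "i < dim_col A \<Longrightarrow> j < dim_row A \<Longrightarrow> mat_adjoint (A :: complex mat) $$ (i, j) = cnj (A $$ (j, i))"
  unfolding mat_adjoint_def by (simp add: mat_of_rows_def)

lemma index_mat_adjoint_carrier:
  "A \<in> carrier_mat n m \<Longrightarrow> i < m \<Longrightarrow> j < n \<Longrightarrow> mat_adjoint (A :: complex mat) $$ (i, j) = cnj (A $$ (j, i))"
  by simp

lemma mat_adjoint_mult:
  fixes A B :: "complex mat"
  assumes A: "A \<in> carrier_mat n m" and B: "B \<in> carrier_mat m k"
  shows "mat_adjoint (A * B) = mat_adjoint B * mat_adjoint A"
proof (rule eq_matI)
  have AB: "A * B \<in> carrier_mat n k" using A B by simp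
  show "dim_row (mat_adjoint (A * B)) = dim_row (mat_adjoint B * mat_adjoint A)"
    "dim_col (mat_adjoint (A * B)) = dim_col (mat_adjoint B * mat_adjoint A)"
    using A B mat_adjoint_carrier[OF AB] mat_adjoint_carrier[OF A] mat_adjoint_carrier[OF B] by auto
  fix i j assume "i < dim_row (mat_adjoint B * mat_adjoint A)" "j < dim_col (mat_adjoint B * mat_adjoint A)"
  then have ij: "i < k" "j < n" using mat_adjoint_carrier[OF A] mat_adjoint_carrier[OF B] by auto
  have "mat_adjoint (A * B) $$ (i, j) = cnj ((A * B) $$ (j, i))" using index_mat_adjoint_carrier[OF AB ij] .
  also have "\<dots> = (\<Sum>l<m. cnj (B $$ (l, i)) * cnj (A $$ (j, l)))"
    using A B ij by (simp add: scalar_prod_def atLeast0LessThan mult.commute)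
  also have "\<dots> = (\<Sum>l<m. mat_adjoint B $$ (i, l) * mat_adjoint A $$ (l, j))"
    using ij by (intro sum.cong) (auto simp: index_mat_adjoint_carrier[OF A] index_mat_adjoint_carrier[OF B])
  also have "\<dots> = (mat_adjoint B * mat_adjoint A) $$ (i, j)"
    using ij A B by (simp add: scalar_prod_def atLeast0LessThan)
  finally show "mat_adjoint (A * B) $$ (i, j) = (mat_adjoint B * mat_adjoint A) $$ (i, j)" .
qed

lemma mat_adjoint_adjoint: "A \<in> carrier_mat n m \<Longrightarrow> mat_adjoint (mat_adjoint A) = (A :: complex mat)"
  using mat_adjoint_carrier[of A n m] mat_adjoint_carrier[of "mat_adjoint A" m n]
  by (intro eq_matI) auto

lemma scalar_prod_conjugate_adjoint:
  fixes A :: "complex mat"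
  assumes A: "A \<in> carrier_mat n m" and v: "v \<in> carrier_vec m" and u: "u \<in> carrier_vec n"
  shows "(A *\<^sub>v v) \<bullet>c u = v \<bullet>c (mat_adjoint A *\<^sub>v u)"
proof -
  have "(A *\<^sub>v v) \<bullet>c u = (\<Sum>i<n. \<Sum>j<m. A $$ (i, j) * v $ j * cnj (u $ i))"
    using A v u by (simp add: scalar_prod_def atLeast0LessThan sum_distrib_right)
  also have "\<dots> = (\<Sum>j<m. \<Sum>i<n. A $$ (i, j) * v $ j * cnj (u $ i))" by (rule sum.swap)
  also have "\<dots> = (\<Sum>j<m. v $ j * cnj (\<Sum>i<n. mat_adjoint A $$ (j, i) * u $ i))"
    using A by (intro sum.cong) (auto simp: sum_distrib_left mult_ac)
  also have "\<dots> = v \<bullet>c (mat_adjoint A *\<^sub>v u)"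
    using A v u by (simp add: scalar_prod_def atLeast0LessThan)
  finally show ?thesis .
qed

lemma mat_adjoint_four_block_one:
  fixes W :: "complex mat"
  assumes W: "W \<in> carrier_mat m m"
  shows "mat_adjoint (four_block_mat (1\<^sub>m 1) (0\<^sub>m 1 m) (0\<^sub>m m 1) W)
    = four_block_mat (1\<^sub>m 1) (0\<^sub>m 1 m) (0\<^sub>m m 1) (mat_adjoint W)" (is "mat_adjoint ?V = ?V'")
proof -
  have V: "?V \<in> carrier_mat (Suc m) (Suc m)" "?V' \<in> carrier_mat (Suc m) (Suc m)"
    using W mat_adjoint_carrier[OF W] by (auto intro!: carrier_matI)
  show ?thesis
  proof (rule eq_matI)
    fix i j assume "i < dim_row ?V'" "j < dim_col ?V'"
    then have ij: "i < Suc m" "j < Suc m" using V by auto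
    show "mat_adjoint ?V $$ (i, j) = ?V' $$ (i, j)"
      using ij W mat_adjoint_carrier[OF W] by (simp add: index_mat_adjoint_carrier[OF V(1) ij] index_mat_adjoint_carrier[OF W])
  qed (use V mat_adjoint_carrier[OF V(1)] in auto)
qed

definition diag_of :: "complex list \<Rightarrow> complex mat" where
  "diag_of es = mat (length es) (length es) (\<lambda>(i, j). if i = j then es ! i else 0)"

lemma householder_mult_mat:
  fixes w :: "nat \<Rightarrow> complex" and n :: nat
  defines "H \<equiv> mat n n (\<lambda>(i, k). householder {..<n} w (\<lambda>j. if j = k then 1 else 0) i)"
  shows "H \<in> carrier_mat n n" "mat_adjoint H = H" "H * H = 1\<^sub>m n"
    "\<And>x i. i < n \<Longrightarrow> (H *\<^sub>v Matrix.vec n x) $ i = householder {..<n} w x i"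
proof -
  show H: "H \<in> carrier_mat n n" by (simp add: H_def)
  have bilin_delta: "bilin {..<n} y (\<lambda>j. if j = k then 1 else 0) = y k" if "k < n" for y k
    using that by (simp add: bilin_def if_distrib[of "\<lambda>z. y _ * z"] sum.delta cong: if_cong)
  have H_index: "H $$ (i, k) = (if i = k then 1 else 0) - 2 * w i * cnj (w k) / complex_of_real (sqnorm {..<n} w)"
    if "i < n" "k < n" for i k
    using that by (simp add: H_def householder_def bilin_delta)
  show mv: "(H *\<^sub>v Matrix.vec n x) $ i = householder {..<n} w x i" if i: "i < n" for x i
  proof -
    have "(H *\<^sub>v Matrix.vec n x) $ i = (\<Sum>k<n. H $$ (i, k) * x k)"
      using H i by (simp add: scalar_prod_def atLeast0LessThan)
    also have "\<dots> = (\<Sum>k<n. (if k = i then x k else 0) - 2 * w i / complex_of_real (sqnorm {..<n} w) * (cnj (w k) * x k))"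
      using i by (intro sum.cong) (auto simp: H_index algebra_simps)
    also have "\<dots> = x i - 2 * w i / complex_of_real (sqnorm {..<n} w) * bilin {..<n} (\<lambda>k. cnj (w k)) x"
      unfolding sum_subtractf sum_distrib_left[symmetric] bilin_def using i by simp
    finally show ?thesis by (simp add: householder_def)
  qed
  show "mat_adjoint H = H"
  proof (rule eq_matI)
    fix i j assume "i < dim_row H" "j < dim_col H"
    then have "i < n" "j < n" using H by auto
    thus "mat_adjoint H $$ (i, j) = H $$ (i, j)"
      by (simp add: index_mat_adjoint_carrier[OF H] H_index mult.commute)
  qed (use H mat_adjoint_carrier[OF H] in auto)
  show "H * H = 1\<^sub>m n"
  proof (rule eq_matI)
    fix i j assume "i < dim_row (1\<^sub>m n)" "j < dim_col (1\<^sub>m n)"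
    then have ij: "i < n" "j < n" by auto
    have "col H j = Matrix.vec n (householder {..<n} w (\<lambda>k. if k = j then 1 else 0))"
      using H ij by (intro eq_vecI) (auto simp: H_def)
    moreover have "(H * H) $$ (i, j) = (H *\<^sub>v col H j) $ i" using H ij by simp
    ultimately have "(H * H) $$ (i, j) = householder {..<n} w (householder {..<n} w (\<lambda>k. if k = j then 1 else 0)) i"
      using mv[OF ij(1)] by simp
    thus "(H * H) $$ (i, j) = 1\<^sub>m n $$ (i, j)" using ij by (simp add: householder_householder)
  qed (use H in auto)
qed

text \<open>Deflation: a Householder reflection moves an eigenvector to the first basis vector.\<close>

theorem hermitian_unitary_diagonalization:
  fixes A :: "complex mat"
  assumes "A \<in> carrier_mat n n" "mat_adjoint A = A" "char_poly A = (\<Prod>a\<leftarrow>es. [:- a, 1:])"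
  shows "\<exists>U. U \<in> carrier_mat n n \<and> mat_adjoint U * U = 1\<^sub>m n \<and> U * mat_adjoint U = 1\<^sub>m n
    \<and> mat_adjoint U * A * U = diag_of es"
  using assms
proof (induction es arbitrary: n A)
  case Nil
  then have "n = 0" using degree_monic_char_poly[of A n] by auto
  thus ?case using Nil by (intro exI[of _ "1\<^sub>m 0"]) (auto simp: diag_of_def intro!: eq_matI)
next
  case (Cons e es n A)
  note A = Cons.prems(1) and herm = Cons.prems(2) and cp = Cons.prems(3)
  have len: "n = Suc (length es)"
    using degree_monic_char_poly[OF A] cp degree_linear_factors[of uminus "e # es"] by auto
  define m where "m = length es"
  have n: "n = Suc m" using len by (simp add: m_def)
  have "eigenvalue A e" unfolding eigenvalue_root_char_poly[OF A] cp by simp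
  then obtain v where v: "v \<in> carrier_vec n" "v \<noteq> 0\<^sub>v n" "A *\<^sub>v v = e \<cdot>\<^sub>v v"
    using A by (auto simp: eigenvalue_def eigenvector_def)
  define \<nu> where "\<nu> = sqrt (sqnorm {..<n} (\<lambda>i. v $ i))"
  have "sqnorm {..<n} (\<lambda>i. v $ i) \<noteq> 0"
    using v sqnorm_eq_0_iff[of "{..<n}" "\<lambda>i. v $ i"] by (auto intro!: eq_vecI)
  hence \<nu>: "\<nu> \<noteq> 0" "\<nu>\<^sup>2 = sqnorm {..<n} (\<lambda>i. v $ i)" by (auto simp: \<nu>_def)
  \<comment> \<open>The first basis vector scaled to the length of \<open>v\<close>, so that a
    reflection can carry it to a multiple of \<open>v\<close>.\<close>
  let ?u = "\<lambda>i. complex_of_real \<nu> * (if i = 0 then 1 else (0::complex))"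
  have "sqnorm {..<n} ?u = sqnorm {..<n} (\<lambda>i. v $ i)"
    unfolding sqnorm_scale using \<nu> sqnorm_single[of "{..<n}" 0 1] n by (simp add: if_distrib cong: if_cong)
  then obtain w c where c: "cmod c = 1" and w: "\<And>i. i \<in> {..<n} \<Longrightarrow> householder {..<n} w ?u i = c * v $ i"
    using householder_exists[of "{..<n}" ?u "\<lambda>i. v $ i"] by auto
  define H where "H = mat n n (\<lambda>(i, k). householder {..<n} w (\<lambda>j. if j = k then 1 else 0) i)"
  note H = householder_mult_mat[where w = w and n = n, folded H_def]
  define e0 where "e0 = (Matrix.vec n (\<lambda>i. if i = 0 then 1 else 0) :: complex vec)"
  have e0: "e0 \<in> carrier_vec n" by (simp add: e0_def)
  have He0: "H *\<^sub>v e0 = (c / complex_of_real \<nu>) \<cdot>\<^sub>v v"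
  proof (rule eq_vecI)
    fix i assume "i < dim_vec ((c / complex_of_real \<nu>) \<cdot>\<^sub>v v)"
    then have i: "i < n" using v by simp
    have "complex_of_real \<nu> * householder {..<n} w (\<lambda>i. if i = 0 then 1 else 0) i = c * v $ i"
      using w[of i] i by (simp add: householder_scale)
    hence "householder {..<n} w (\<lambda>i. if i = 0 then 1 else 0) i = c / complex_of_real \<nu> * v $ i"
      using \<nu> by (simp add: field_simps)
    thus "(H *\<^sub>v e0) $ i = ((c / complex_of_real \<nu>) \<cdot>\<^sub>v v) $ i"
      using i v H(4)[OF i] by (simp add: e0_def)
  qed (use H v in auto)
  define B where "B = H * A * H"
  have B: "B \<in> carrier_mat n n" using H A by (simp add: B_def)
  have B_herm: "mat_adjoint B = B"
    unfolding B_def using H A herm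
    by (simp add: mat_adjoint_mult[of _ n n _ n] assoc_mult_mat[of _ n n _ n _ n])
  have "B *\<^sub>v e0 = H *\<^sub>v (A *\<^sub>v (H *\<^sub>v e0))"
    unfolding B_def using H A e0 by (simp add: assoc_mult_mat_vec[of _ n n _ n])
  also have "A *\<^sub>v (H *\<^sub>v e0) = e \<cdot>\<^sub>v (H *\<^sub>v e0)"
    unfolding He0 using A v by (simp add: mult_mat_vec smult_smult_assoc mult.commute)
  also have "H *\<^sub>v (e \<cdot>\<^sub>v (H *\<^sub>v e0)) = e \<cdot>\<^sub>v ((H * H) *\<^sub>v e0)"
  proof -
    have "H *\<^sub>v (e \<cdot>\<^sub>v (H *\<^sub>v e0)) = e \<cdot>\<^sub>v (H *\<^sub>v (H *\<^sub>v e0))"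
      by (rule mult_mat_vec[OF H(1)]) (use H(1) e0 in auto)
    also have "H *\<^sub>v (H *\<^sub>v e0) = (H * H) *\<^sub>v e0"
      by (rule assoc_mult_mat_vec[OF H(1) H(1) e0, symmetric])
    finally show ?thesis .
  qed
  also have "\<dots> = e \<cdot>\<^sub>v e0" using H(3) e0 by simp
  finally have Be0: "B *\<^sub>v e0 = e \<cdot>\<^sub>v e0" .
  have Bi0: "B $$ (i, 0) = (if i = 0 then e else 0)" if i: "i < n" for i
  proof -
    have "(B *\<^sub>v e0) $ i = (\<Sum>k<n. B $$ (i, k) * (if k = 0 then 1 else 0))"
      using B i by (simp add: e0_def scalar_prod_def atLeast0LessThan)
    also have "\<dots> = B $$ (i, 0)" using n by (simp add: if_distrib cong: if_cong)
    finally show ?thesis unfolding Be0 using i by (simp add: e0_def split: if_splits)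
  qed
  have B0i: "B $$ (0, i) = 0" if i: "i < n" "i > 0" for i
    using index_mat_adjoint_carrier[OF B, of 0 i] B_herm Bi0[OF i(1)] i n by simp
  define A3 where "A3 = mat m m (\<lambda>(i, j). B $$ (Suc i, Suc j))"
  have A3: "A3 \<in> carrier_mat m m" by (simp add: A3_def)
  let ?E = "mat 1 1 (\<lambda>_. e) :: complex mat"
  have Bblock: "B = four_block_mat ?E (0\<^sub>m 1 m) (0\<^sub>m m 1) A3"
    by (rule eq_matI) (use B n Bi0 B0i in \<open>auto simp: A3_def\<close>)
  have A3_herm: "mat_adjoint A3 = A3"
  proof (rule eq_matI)
    fix i j assume "i < dim_row A3" "j < dim_col A3"
    then have ij: "i < m" "j < m" by (auto simp: A3_def)
    have "cnj (B $$ (Suc j, Suc i)) = B $$ (Suc i, Suc j)"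
      using index_mat_adjoint_carrier[OF B, of "Suc i" "Suc j"] B_herm ij n by simp
    thus "mat_adjoint A3 $$ (i, j) = A3 $$ (i, j)"
      using ij by (simp add: index_mat_adjoint_carrier[OF A3]) (simp add: A3_def)
  qed (use A3 mat_adjoint_carrier[OF A3] in auto)
  have "similar_mat_wit A B H H"
  proof -
    have "H * B * H = (H * H) * A * (H * H)"
      unfolding B_def using H(1) A by (simp add: assoc_mult_mat[of _ n n _ n _ n])
    also have "\<dots> = A" unfolding H(3) using A by simp
    finally show ?thesis unfolding similar_mat_wit_def Let_def using A B H(1,3) by auto
  qed
  hence "char_poly A = char_poly B" by (intro char_poly_similar) (auto simp: similar_mat_def)
  also have "\<dots> = char_poly ?E * char_poly A3"
    unfolding Bblock by (rule char_poly_four_block_zeros_col) (use A3 in auto)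
  also have "char_poly ?E = [:- e, 1:]" by (simp add: char_poly_defs det_def sign_def)
  \<comment> \<open>Cancelling one linear factor leaves the tail of the list for the minor, so the
    diagonal will carry the eigenvalues in the prescribed order.\<close>
  finally have "char_poly A3 = (\<Prod>a\<leftarrow>es. [:- a, 1:])"
    unfolding cp by (simp only: list.map prod_list.Cons mult_cancel_left) simp
  from Cons.IH[OF A3 A3_herm this]
  obtain W where W: "W \<in> carrier_mat m m" "mat_adjoint W * W = 1\<^sub>m m" "W * mat_adjoint W = 1\<^sub>m m"
    "mat_adjoint W * A3 * W = diag_of es" by blast
  note W' = mat_adjoint_carrier[OF W(1)]
  define V where "V = four_block_mat (1\<^sub>m 1) (0\<^sub>m 1 m) (0\<^sub>m m 1) W"
  define V' where "V' = four_block_mat (1\<^sub>m 1) (0\<^sub>m 1 m) (0\<^sub>m m 1) (mat_adjoint W)"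
  have V: "V \<in> carrier_mat n n" "V' \<in> carrier_mat n n" using W W' n by (auto simp: V_def V'_def)
  have V_adj: "mat_adjoint V = V'" unfolding V_def V'_def by (rule mat_adjoint_four_block_one[OF W(1)])
  have one: "1\<^sub>m n = four_block_mat (1\<^sub>m 1) (0\<^sub>m 1 m) (0\<^sub>m m 1) (1\<^sub>m m)"
    unfolding n by (rule eq_matI) auto
  have VV: "V' * V = 1\<^sub>m n" "V * V' = 1\<^sub>m n"
    unfolding V_def V'_def one using W W' by (subst mult_four_block_mat[where ?n2.0 = m]; auto)+
  have VBV: "V' * B * V = diag_of (e # es)"
  proof -
    have "V' * B = four_block_mat ?E (0\<^sub>m 1 m) (0\<^sub>m m 1) (mat_adjoint W * A3)"
      unfolding V'_def Bblock using W' A3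
      by (subst mult_four_block_mat[where ?n2.0 = m]) (auto simp: right_mult_zero_mat[OF W'])
    moreover have "\<dots> * V = four_block_mat ?E (0\<^sub>m 1 m) (0\<^sub>m m 1) (mat_adjoint W * A3 * W)"
      unfolding V_def using W W' A3 by (subst mult_four_block_mat[where ?n2.0 = m]) auto
    moreover have "\<dots> = diag_of (e # es)"
      unfolding W(4) by (rule eq_matI) (auto simp: diag_of_def m_def nth_Cons split: nat.split)
    ultimately show ?thesis by simp
  qed
  define U where "U = H * V"
  have U: "U \<in> carrier_mat n n" using H V by (simp add: U_def)
  have U_adj: "mat_adjoint U = V' * H" unfolding U_def using mat_adjoint_mult[OF H(1) V(1)] H(2) V_adj by simp
  have 1: "mat_adjoint U * U = 1\<^sub>m n"
  proof -
    have "mat_adjoint U * U = V' * ((H * H) * V)"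
      unfolding U_adj unfolding U_def using H(1) V by (simp add: assoc_mult_mat[of _ n n _ n _ n])
    thus ?thesis using H(3) V VV by simp
  qed
  have 2: "U * mat_adjoint U = 1\<^sub>m n"
  proof -
    have "U * mat_adjoint U = H * ((V * V') * H)"
      unfolding U_adj unfolding U_def using H(1) V by (simp add: assoc_mult_mat[of _ n n _ n _ n])
    thus ?thesis using H VV by simp
  qed
  have 3: "mat_adjoint U * A * U = diag_of (e # es)"
  proof -
    have "mat_adjoint U * A * U = V' * (H * A * H) * V"
      unfolding U_adj unfolding U_def using H(1) V A by (simp add: assoc_mult_mat[of _ n n _ n _ n])
    thus ?thesis using VBV by (simp add: B_def)
  qed
  show ?case using U 1 2 3 by blast
qed

section \<open>The law of the largest eigenvalue\<close>

lemma scalar_prod_self_conjugate: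
  "v \<in> carrier_vec n \<Longrightarrow> (v :: complex vec) \<bullet>c v = complex_of_real (sqnorm {..<n} (\<lambda>i. v $ i))"
  by (simp add: scalar_prod_def atLeast0LessThan sqnorm_def complex_norm_square del: of_real_power)

text \<open>In an eigenbasis both quadratic forms are weighted sums of the same squares, which gives
  one direction; the other tests the form on eigenvectors. The condition on \<open>n\<close> keeps
  the set under \<open>Max\<close> nonempty.\<close>

lemma largest_eigenvalue_le_iff:
  assumes S: "S \<in> carrier_mat n n" "mat_adjoint S = S" and n: "n \<ge> 1"
  shows "largest_eigenvalue S \<le> x \<longleftrightarrow> (\<forall>v\<in>carrier_vec n. Re ((S *\<^sub>v v) \<bullet>c v) \<le> x * sqnorm {..<n} (\<lambda>i. v $ i))"
proof -
  obtain es where cp: "char_poly S = (\<Prod>a\<leftarrow>es. [:- a, 1:])" and len: "length es = n"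
    using char_poly_factorized[OF S(1)] by blast
  obtain U where U: "U \<in> carrier_mat n n" "mat_adjoint U * U = 1\<^sub>m n" "U * mat_adjoint U = 1\<^sub>m n"
    "mat_adjoint U * S * U = diag_of es"
    using hermitian_unitary_diagonalization[OF S cp] by blast
  note U' = mat_adjoint_carrier[OF U(1)]
  have D: "diag_of es \<in> carrier_mat n n" using len by (auto simp: diag_of_def)
  have "mat_adjoint (diag_of es) = diag_of es"
    unfolding U(4)[symmetric] using U(1) U' S
    by (simp add: mat_adjoint_mult[of _ n n _ n] mat_adjoint_adjoint[of _ n n] assoc_mult_mat[of _ n n _ n _ n])
  \<comment> \<open>The diagonal form is Hermitian, so its entries are real and the real eigenvalues
    in \<open>largest_eigenvalue\<close> make up the whole spectrum.\<close>
  hence real: "es ! k = complex_of_real (Re (es ! k))" if "k < n" for k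
    using index_mat_adjoint_carrier[OF D that that] that len by (auto simp: diag_of_def complex_eq_iff)
  have "eigenvalue S (complex_of_real y) \<longleftrightarrow> complex_of_real y \<in> set es" for y
    unfolding eigenvalue_root_char_poly[OF S(1)] cp by (induction es) auto
  hence eig: "{y. eigenvalue S (complex_of_real y)} = (\<lambda>k. Re (es ! k)) ` {..<n}"
    using real len by (auto simp: in_set_conv_nth image_iff complex_eq_iff)
  have le: "largest_eigenvalue S \<le> x \<longleftrightarrow> (\<forall>k<n. Re (es ! k) \<le> x)"
    unfolding largest_eigenvalue_def eig using n by (subst Max_le_iff) (auto simp: lessThan_empty_iff)
  have form: "Re ((S *\<^sub>v v) \<bullet>c v) = (\<Sum>k<n. Re (es ! k) * (cmod ((mat_adjoint U *\<^sub>v v) $ k))\<^sup>2)"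
    "sqnorm {..<n} (\<lambda>i. v $ i) = (\<Sum>k<n. (cmod ((mat_adjoint U *\<^sub>v v) $ k))\<^sup>2)" if v: "v \<in> carrier_vec n" for v
  proof -
    define z where "z = mat_adjoint U *\<^sub>v v"
    have z: "z \<in> carrier_vec n" using U' v by (simp add: z_def)
    have Uz: "U *\<^sub>v z = v"
      unfolding z_def using assoc_mult_mat_vec[OF U(1) U' v] U(3) v by simp
    have Sv: "S *\<^sub>v v \<in> carrier_vec n" using S v by simp
    have "(S *\<^sub>v v) \<bullet>c v = (S *\<^sub>v v) \<bullet>c (U *\<^sub>v z)" by (simp add: Uz)
    also have "\<dots> = (mat_adjoint U *\<^sub>v (S *\<^sub>v v)) \<bullet>c z"
      using scalar_prod_conjugate_adjoint[OF U' Sv z] mat_adjoint_adjoint[OF U(1)] by simp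
    also have "mat_adjoint U *\<^sub>v (S *\<^sub>v v) = diag_of es *\<^sub>v z"
    proof -
      have "mat_adjoint U *\<^sub>v (S *\<^sub>v (U *\<^sub>v z)) = (mat_adjoint U * S * U) *\<^sub>v z"
      proof -
        have "(mat_adjoint U * S * U) *\<^sub>v z = (mat_adjoint U * S) *\<^sub>v (U *\<^sub>v z)"
          by (rule assoc_mult_mat_vec[of _ n n _ n]) (use U' S U(1) z in auto)
        also have "\<dots> = mat_adjoint U *\<^sub>v (S *\<^sub>v (U *\<^sub>v z))"
          by (rule assoc_mult_mat_vec[of _ n n _ n]) (use U' S U(1) z in auto)
        finally show ?thesis ..
      qed
      thus ?thesis by (simp add: Uz U(4))
    qed
    also have "(diag_of es *\<^sub>v z) \<bullet>c z = (\<Sum>k<n. es ! k * (z $ k * cnj (z $ k)))"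
      using z len by (auto simp: diag_of_def scalar_prod_def atLeast0LessThan if_distrib[of "\<lambda>t. t * _"] cong: if_cong intro!: sum.cong)
    also have "\<dots> = complex_of_real (\<Sum>k<n. Re (es ! k) * (cmod (z $ k))\<^sup>2)"
      unfolding of_real_sum using real by (intro sum.cong) (auto simp: complex_norm_square simp del: of_real_power)
    finally show "Re ((S *\<^sub>v v) \<bullet>c v) = (\<Sum>k<n. Re (es ! k) * (cmod ((mat_adjoint U *\<^sub>v v) $ k))\<^sup>2)"
      by (simp add: z_def)
    have "v \<bullet>c v = z \<bullet>c z"
      using scalar_prod_conjugate_adjoint[OF U(1) z v] Uz by (simp add: z_def)
    hence "sqnorm {..<n} (\<lambda>i. v $ i) = sqnorm {..<n} (\<lambda>i. z $ i)"
      unfolding scalar_prod_self_conjugate[OF v] scalar_prod_self_conjugate[OF z] of_real_eq_iff .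
    thus "sqnorm {..<n} (\<lambda>i. v $ i) = (\<Sum>k<n. (cmod ((mat_adjoint U *\<^sub>v v) $ k))\<^sup>2)"
      by (simp add: sqnorm_def z_def)
  qed
  show ?thesis
  proof
    assume "largest_eigenvalue S \<le> x"
    thus "\<forall>v\<in>carrier_vec n. Re ((S *\<^sub>v v) \<bullet>c v) \<le> x * sqnorm {..<n} (\<lambda>i. v $ i)"
      unfolding le by (auto simp: form sum_distrib_left intro!: sum_mono mult_right_mono)
  next
    assume R: "\<forall>v\<in>carrier_vec n. Re ((S *\<^sub>v v) \<bullet>c v) \<le> x * sqnorm {..<n} (\<lambda>i. v $ i)"
    have "y \<le> x" if "eigenvalue S (complex_of_real y)" for y
    proof -
      obtain v where v: "v \<in> carrier_vec n" "v \<noteq> 0\<^sub>v n" "S *\<^sub>v v = complex_of_real y \<cdot>\<^sub>v v"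
        using \<open>eigenvalue S (complex_of_real y)\<close> S by (auto simp: eigenvalue_def eigenvector_def)
      have "sqnorm {..<n} (\<lambda>i. v $ i) \<noteq> 0"
        using v sqnorm_eq_0_iff[of "{..<n}" "\<lambda>i. v $ i"] by (auto intro!: eq_vecI)
      hence pos: "sqnorm {..<n} (\<lambda>i. v $ i) > 0" using sqnorm_nonneg[of "{..<n}" "\<lambda>i. v $ i"] by linarith
      have "(S *\<^sub>v v) \<bullet>c v = complex_of_real (y * sqnorm {..<n} (\<lambda>i. v $ i))"
        unfolding v(3) using v(1) by (simp add: scalar_prod_self_conjugate)
      hence "y * sqnorm {..<n} (\<lambda>i. v $ i) \<le> x * sqnorm {..<n} (\<lambda>i. v $ i)" using R v(1) by force
      thus ?thesis using pos by simp
    qed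
    thus "largest_eigenvalue S \<le> x" unfolding le using eig by auto
  qed
qed

text \<open>With X the centred sample, the form of X X^* / M at v is |X^* v|^2 / M, and the entries
  of X^* v are the conjugates of the pairings of the conjugated v with the columns. From here on
  matrices give way to \<open>bilin\<close> and \<open>sqnorm\<close>.\<close>

lemma sample_covariance_form:
  fixes y :: "nat \<Rightarrow> complex vec"
  assumes y: "\<And>j. j < M \<Longrightarrow> y j \<in> carrier_vec N" and v: "v \<in> carrier_vec N"
  shows "sample_covariance N M y \<in> carrier_mat N N"
    "mat_adjoint (sample_covariance N M y) = sample_covariance N M y"
    "Re ((sample_covariance N M y *\<^sub>v v) \<bullet>c v)
      = sqnorm {..<M} (\<lambda>j. bilin {..<N} (\<lambda>i. cnj (v $ i)) (\<lambda>i. y j $ i - (\<Sum>l<M. y l $ i) / of_nat M)) / real M"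
proof -
  define X where "X = centered_sample N M y"
  have X: "X \<in> carrier_mat N M"
    by (auto simp: X_def centered_sample_def)
  note X' = mat_adjoint_carrier[OF X]
  have Xij: "X $$ (i, j) = y j $ i - (\<Sum>l<M. y l $ i) / of_nat M" if "i < N" "j < M" for i j
    using that y[OF that(2)] by (simp add: X_def centered_sample_def sample_mean_def mat_of_cols_def)
  have S: "sample_covariance N M y = (1 / of_nat M) \<cdot>\<^sub>m (X * mat_adjoint X)"
    by (simp add: sample_covariance_def X_def Let_def)
  show SC: "sample_covariance N M y \<in> carrier_mat N N" unfolding S using X X' by simp
  have XX: "mat_adjoint (X * mat_adjoint X) = X * mat_adjoint X"
    using mat_adjoint_mult[OF X X'] mat_adjoint_adjoint[OF X] by simp
  show "mat_adjoint (sample_covariance N M y) = sample_covariance N M y"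
  proof (rule eq_matI)
    fix i j assume "i < dim_row (sample_covariance N M y)" "j < dim_col (sample_covariance N M y)"
    then have ij: "i < N" "j < N" using SC by auto
    have XXc: "X * mat_adjoint X \<in> carrier_mat N N" using X X' by simp
    have "cnj ((X * mat_adjoint X) $$ (j, i)) = (X * mat_adjoint X) $$ (i, j)"
      using index_mat_adjoint_carrier[OF XXc ij] XX by simp
    moreover have "sample_covariance N M y $$ (a, b) = (1 / of_nat M) * (X * mat_adjoint X) $$ (a, b)"
      if "a < N" "b < N" for a b
      unfolding S using XXc that by (subst index_smult_mat(1)) auto
    ultimately show "mat_adjoint (sample_covariance N M y) $$ (i, j) = sample_covariance N M y $$ (i, j)"
      using ij by (simp add: index_mat_adjoint_carrier[OF SC ij])
  qed (use SC in auto)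
  define z where "z = mat_adjoint X *\<^sub>v v"
  have z: "z \<in> carrier_vec M" using X' v by (simp add: z_def)
  have "(X * mat_adjoint X *\<^sub>v v) \<bullet>c v = (X *\<^sub>v z) \<bullet>c v"
    unfolding z_def using assoc_mult_mat_vec[OF X X' v] by simp
  also have "\<dots> = z \<bullet>c z" using scalar_prod_conjugate_adjoint[OF X z v] by (simp add: z_def)
  also have "\<dots> = complex_of_real (sqnorm {..<M} (\<lambda>j. z $ j))" by (rule scalar_prod_self_conjugate[OF z])
  also have "sqnorm {..<M} (\<lambda>j. z $ j) = sqnorm {..<M} (\<lambda>j. bilin {..<N} (\<lambda>i. cnj (v $ i)) (\<lambda>i. y j $ i - (\<Sum>l<M. y l $ i) / of_nat M))"
    unfolding sqnorm_def
  proof (rule sum.cong)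
    fix j assume "j \<in> {..<M}"
    then have j: "j < M" by simp
    have "z $ j = (\<Sum>i<N. cnj (X $$ (i, j)) * v $ i)"
      unfolding z_def using X v j by (simp add: scalar_prod_def atLeast0LessThan)
    also have "\<dots> = cnj (bilin {..<N} (\<lambda>i. cnj (v $ i)) (\<lambda>i. X $$ (i, j)))"
      by (simp add: bilin_def mult.commute)
    also have "bilin {..<N} (\<lambda>i. cnj (v $ i)) (\<lambda>i. X $$ (i, j)) = bilin {..<N} (\<lambda>i. cnj (v $ i)) (\<lambda>i. y j $ i - (\<Sum>l<M. y l $ i) / of_nat M)"
      using j Xij by (intro bilin_cong) auto
    finally show "(cmod (z $ j))\<^sup>2 = (cmod (bilin {..<N} (\<lambda>i. cnj (v $ i)) (\<lambda>i. y j $ i - (\<Sum>l<M. y l $ i) / of_nat M)))\<^sup>2"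
      by simp
  qed simp
  finally have "(X * mat_adjoint X *\<^sub>v v) \<bullet>c v
    = complex_of_real (sqnorm {..<M} (\<lambda>j. bilin {..<N} (\<lambda>i. cnj (v $ i)) (\<lambda>i. y j $ i - (\<Sum>l<M. y l $ i) / of_nat M)))" .
  moreover have "sample_covariance N M y *\<^sub>v v = (1 / of_nat M) \<cdot>\<^sub>v (X * mat_adjoint X *\<^sub>v v)"
    unfolding S using X v
    by (intro eq_vecI) (auto simp: scalar_prod_def sum_distrib_left mult_ac simp del: index_mult_mat(1))
  moreover have "X * mat_adjoint X *\<^sub>v v \<in> carrier_vec N"
    by (rule mult_mat_vec_carrier[of _ N N]) (use X X' v in auto)
  ultimately show "Re ((sample_covariance N M y *\<^sub>v v) \<bullet>c v)
      = sqnorm {..<M} (\<lambda>j. bilin {..<N} (\<lambda>i. cnj (v $ i)) (\<lambda>i. y j $ i - (\<Sum>l<M. y l $ i) / of_nat M)) / real M"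
    using v by (simp add: Re_divide_of_nat)
qed

lemma largest_eigenvalue_sample_covariance_le_iff:
  fixes y :: "nat \<Rightarrow> complex vec"
  assumes y: "\<And>j. j < M \<Longrightarrow> y j \<in> carrier_vec N" and MN: "M \<ge> 1" "N \<ge> 1"
  shows "largest_eigenvalue (sample_covariance N M y) \<le> x \<longleftrightarrow>
    (\<forall>z. sqnorm {..<M} (\<lambda>j. bilin {..<N} z (\<lambda>i. y j $ i - (\<Sum>l<M. y l $ i) / of_nat M)) \<le> x * real M * sqnorm {..<N} z)"
    (is "_ \<longleftrightarrow> (\<forall>z. ?P z)")
proof -
  have "largest_eigenvalue (sample_covariance N M y) \<le> x \<longleftrightarrow>
    (\<forall>v\<in>carrier_vec N. Re ((sample_covariance N M y *\<^sub>v v) \<bullet>c v) \<le> x * sqnorm {..<N} (\<lambda>i. v $ i))"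
    using sample_covariance_form(1,2)[OF y zero_carrier_vec] MN
    by (intro largest_eigenvalue_le_iff) auto
  also have "\<dots> \<longleftrightarrow> (\<forall>v\<in>carrier_vec N. ?P (\<lambda>i. cnj (v $ i)))"
    using MN by (intro ball_cong refl) (simp add: sample_covariance_form(3)[OF y] divide_le_eq mult_ac)
  also have "\<dots> \<longleftrightarrow> (\<forall>z. ?P z)"
  proof (intro iffI allI)
    fix z assume "\<forall>v\<in>carrier_vec N. ?P (\<lambda>i. cnj (v $ i))"
    hence "?P (\<lambda>i. cnj (Matrix.vec N (\<lambda>i. cnj (z i)) $ i))" by auto
    moreover have "bilin {..<N} (\<lambda>i. cnj (Matrix.vec N (\<lambda>i. cnj (z i)) $ i)) u = bilin {..<N} z u" for u
      by (intro bilin_cong) auto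
    moreover have "sqnorm {..<N} (\<lambda>i. cnj (Matrix.vec N (\<lambda>i. cnj (z i)) $ i)) = sqnorm {..<N} z"
      by (intro sqnorm_cong) auto
    ultimately show "?P z" by simp
  qed blast
  finally show ?thesis .
qed

section \<open>Whitening the sample and removing its mean\<close>

lemma borel_measurable_vec_index:
  assumes "i < N" shows "(\<lambda>v. v $ i) \<in> borel_measurable (lborel_cvec N)"
proof -
  have "(\<lambda>f. Matrix.vec N f $ i) \<in> borel_measurable (PiM {..<N} (\<lambda>_. lborel :: complex measure))"
  proof -
    have "(\<lambda>f. f i) \<in> borel_measurable (PiM {..<N} (\<lambda>_. lborel :: complex measure))"
      using measurable_component_singleton[of i "{..<N}" "\<lambda>_. lborel :: complex measure"] assms by simp
    thus ?thesis using assms by simp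
  qed
  thus ?thesis unfolding lborel_cvec_def by (rule measurable_embed_measure1)
qed

lemma sigma_finite_lborel_cvec: "sigma_finite_measure (lborel_cvec N)"
proof -
  interpret psf: product_sigma_finite "\<lambda>_::nat. lborel :: complex measure"
    by (simp add: product_sigma_finite_def sigma_finite_lborel)
  let ?L = "PiM {..<N} (\<lambda>_. lborel :: complex measure)"
  interpret L: sigma_finite_measure ?L by (rule psf.sigma_finite) simp
  obtain A where A: "countable A" "A \<subseteq> sets ?L" "\<Union>A = space ?L" "\<forall>a\<in>A. emeasure ?L a \<noteq> \<infinity>"
    using L.sigma_finite_countable by auto
  have "emeasure (lborel_cvec N) (Matrix.vec N ` a) \<noteq> \<infinity>" if a: "a \<in> A" for a
  proof -
    have "a \<in> sets ?L" using A a by auto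
    have "Matrix.vec N -` (Matrix.vec N ` a) \<inter> space ?L = a"
      using inj_on_vec_PiM[of N] sets.sets_into_space[OF \<open>a \<in> sets ?L\<close>] by (auto simp: inj_on_def subset_iff)
    hence "emeasure (lborel_cvec N) (Matrix.vec N ` a) = emeasure ?L a"
      unfolding lborel_cvec_def using in_sets_embed_measure[OF \<open>a \<in> sets ?L\<close>]
      by (subst emeasure_embed_measure'[OF inj_on_vec_PiM]) auto
    thus ?thesis using A a by auto
  qed
  moreover have "\<Union>((`) (Matrix.vec N) ` A) = space (lborel_cvec N)"
    unfolding lborel_cvec_def space_embed_measure A(3)[symmetric] by auto
  moreover have "(`) (Matrix.vec N) ` A \<subseteq> sets (lborel_cvec N)"
    using A(2) unfolding lborel_cvec_def by (auto intro: in_sets_embed_measure)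
  ultimately show ?thesis using A(1)
    by (intro sigma_finite_measure.intro exI[of _ "(`) (Matrix.vec N) ` A"]) auto
qed

text \<open>\<open>\<Phi>\<close> is the affine bijection v -> D^(-1/2) U^* (v - \<mu>), in which
  the exponent is minus a squared norm. Shifting v by U D^(1/2) a shifts \<open>\<Phi>\<close> by a,
  so \<open>distr_gaussian_density\<close> applies and neither a determinant nor the value of c has
  to be computed.\<close>

lemma distr_whitened_column:
  fixes u :: "nat \<Rightarrow> nat \<Rightarrow> complex" and \<mu> :: "complex vec" and d :: "nat \<Rightarrow> real" and N :: nat
  defines "\<Phi> \<equiv> \<lambda>v. \<lambda>k\<in>{..<N}. (\<Sum>i<N. cnj (u i k) * (v $ i - \<mu> $ i)) / complex_of_real (sqrt (d k))"
  assumes orth1: "\<And>i l. i < N \<Longrightarrow> l < N \<Longrightarrow> (\<Sum>k<N. u i k * cnj (u l k)) = (if i = l then 1 else 0)"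
    and orth2: "\<And>k l. k < N \<Longrightarrow> l < N \<Longrightarrow> (\<Sum>i<N. cnj (u i k) * u i l) = (if k = l then 1 else 0)"
    and d: "\<And>k. k < N \<Longrightarrow> d k > 0"
    and prob: "prob_space (density (lborel_cvec N) (\<lambda>v. ennreal (c * exp (- (\<Sum>k<N. (cmod (\<Phi> v k))\<^sup>2)))))"
  shows "distr (density (lborel_cvec N) (\<lambda>v. ennreal (c * exp (- (\<Sum>k<N. (cmod (\<Phi> v k))\<^sup>2)))))
      (PiM {..<N} (\<lambda>_. lborel)) \<Phi> = gauss {..<N}"
proof -
  interpret psf: product_sigma_finite "\<lambda>_::nat. lborel :: complex measure"
    by (simp add: product_sigma_finite_def sigma_finite_lborel)
  define L where "L = PiM {..<N} (\<lambda>_. lborel :: complex measure)"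
  define \<Psi> where "\<Psi> x = Matrix.vec N (\<lambda>i. \<mu> $ i + (\<Sum>k<N. u i k * complex_of_real (sqrt (d k)) * x k))" for x
  have vec_m[measurable]: "Matrix.vec N \<in> measurable L (lborel_cvec N)"
    unfolding lborel_cvec_def L_def by (rule measurable_embed_measure2'[OF inj_on_vec_PiM])
  have \<Phi>m: "\<Phi> \<in> measurable (lborel_cvec N) L"
    unfolding \<Phi>_def L_def using borel_measurable_vec_index by (intro measurable_restrict) auto
  have comp: "(\<lambda>x. x k) \<in> borel_measurable L" if "k < N" for k
    using measurable_component_singleton[of k "{..<N}" "\<lambda>_. lborel :: complex measure"] that by (simp add: L_def)
  have \<Psi>m: "\<Psi> \<in> measurable L (lborel_cvec N)"
  proof -
    have "(\<lambda>x. \<lambda>i\<in>{..<N}. \<mu> $ i + (\<Sum>k<N. u i k * complex_of_real (sqrt (d k)) * x k)) \<in> measurable L L"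
      unfolding L_def[of] using comp unfolding L_def by (intro measurable_restrict) auto
    from measurable_compose[OF this vec_m]
    show ?thesis
      by (rule measurable_cong[THEN iffD1, rotated]) (auto simp: \<Psi>_def intro!: eq_vecI)
  qed
  have \<Psi>\<Phi>: "\<Psi> (\<Phi> v) = v" if "v \<in> space (lborel_cvec N)" for v
  proof (rule eq_vecI)
    have v: "v \<in> carrier_vec N" using that by (simp add: space_lborel_cvec)
    show "dim_vec (\<Psi> (\<Phi> v)) = dim_vec v" using v by (simp add: \<Psi>_def)
    fix i assume "i < dim_vec v"
    then have i: "i < N" using v by simp
    have "(\<Sum>k<N. u i k * complex_of_real (sqrt (d k)) * \<Phi> v k) = (\<Sum>k<N. \<Sum>l<N. u i k * cnj (u l k) * (v $ l - \<mu> $ l))"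
    proof (rule sum.cong[OF refl])
      fix k assume "k \<in> {..<N}"
      then have k: "k < N" by simp
      have "complex_of_real (sqrt (d k)) \<noteq> 0" using d[OF k] by simp
      thus "u i k * complex_of_real (sqrt (d k)) * \<Phi> v k = (\<Sum>l<N. u i k * cnj (u l k) * (v $ l - \<mu> $ l))"
        using k by (simp add: \<Phi>_def) (simp add: sum_distrib_left mult_ac)
    qed
    also have "\<dots> = (\<Sum>l<N. (\<Sum>k<N. u i k * cnj (u l k)) * (v $ l - \<mu> $ l))"
      by (subst sum.swap) (simp add: sum_distrib_right)
    also have "\<dots> = v $ i - \<mu> $ i"
      using i by (simp add: orth1 if_distrib[of "\<lambda>t. t * _"] cong: if_cong)
    finally show "\<Psi> (\<Phi> v) $ i = v $ i" using i by (simp add: \<Psi>_def)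
  qed
  have inv: "distr (distr (lborel_cvec N) L \<Phi>) L (\<lambda>x. \<lambda>i\<in>{..<N}. x i + a i) = distr (lborel_cvec N) L \<Phi>" for a
  proof -
    define b where "b i = (\<Sum>k<N. u i k * complex_of_real (sqrt (d k)) * a k)" for i
    have tr: "(\<lambda>x. \<lambda>i\<in>{..<N}. x i + b i) \<in> measurable L L" for b
      unfolding L_def by measurable
    have emb: "lborel_cvec N = distr L (lborel_cvec N) (Matrix.vec N)"
      unfolding lborel_cvec_def L_def by (rule embed_measure_eq_distr'[OF inj_on_vec_PiM])
    define \<Phi>' where "\<Phi>' x = \<Phi> (Matrix.vec N x)" for x
    have \<Phi>'m: "\<Phi>' \<in> measurable L L" unfolding \<Phi>'_def by (rule measurable_compose[OF vec_m \<Phi>m])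
    have D: "distr (lborel_cvec N) L \<Phi> = distr L L \<Phi>'"
      by (subst emb, subst distr_distr[OF \<Phi>m vec_m]) (simp add: comp_def \<Phi>'_def[abs_def])
    have add: "\<Phi>' (\<lambda>i\<in>{..<N}. x i + b i) = (\<lambda>i\<in>{..<N}. \<Phi>' x i + a i)" for x
    proof (rule ext)
      fix k
      show "\<Phi>' (\<lambda>i\<in>{..<N}. x i + b i) k = (\<lambda>i\<in>{..<N}. \<Phi>' x i + a i) k"
      proof (cases "k < N")
        case k: True
        have "(\<Sum>i<N. cnj (u i k) * b i) = (\<Sum>l<N. (\<Sum>i<N. cnj (u i k) * u i l) * (complex_of_real (sqrt (d l)) * a l))"
          unfolding b_def sum_distrib_left sum_distrib_right by (subst sum.swap) (simp add: mult_ac)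
        also have "\<dots> = complex_of_real (sqrt (d k)) * a k"
          using k by (simp add: orth2 if_distrib[of "\<lambda>t. t * _"] cong: if_cong)
        finally have "(\<Sum>i<N. cnj (u i k) * b i) / complex_of_real (sqrt (d k)) = a k" using d[OF k] by simp
        moreover have "(\<Sum>i<N. cnj (u i k) * (x i + b i - \<mu> $ i))
            = (\<Sum>i<N. cnj (u i k) * (x i - \<mu> $ i)) + (\<Sum>i<N. cnj (u i k) * b i)"
          unfolding sum.distrib[symmetric] by (simp add: algebra_simps)
        ultimately show ?thesis using k
          by (simp add: \<Phi>'_def \<Phi>_def add_divide_distrib)
      qed (simp add: \<Phi>'_def \<Phi>_def)
    qed
    have "distr (distr L L \<Phi>') L (\<lambda>x. \<lambda>i\<in>{..<N}. x i + a i) = distr L L (\<lambda>x. \<Phi>' (\<lambda>i\<in>{..<N}. x i + b i))"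
      unfolding add by (subst distr_distr[OF tr \<Phi>'m]) (simp add: comp_def)
    also have "\<dots> = distr (distr L L (\<lambda>x. \<lambda>i\<in>{..<N}. x i + b i)) L \<Phi>'"
      by (subst distr_distr[OF \<Phi>'m tr]) (simp add: comp_def)
    also have "distr L L (\<lambda>x. \<lambda>i\<in>{..<N}. x i + b i) = L"
      unfolding L_def by (rule PiM_lborel_translate) simp
    finally show ?thesis unfolding D .
  qed
  \<comment> \<open>A negative \<open>c\<close> would give the density 0, since
    \<open>ennreal\<close> truncates, and that cannot have mass 1.\<close>
  have "c \<ge> 0"
  proof (rule ccontr)
    assume "\<not> c \<ge> 0"
    hence z: "ennreal (c * exp (- (\<Sum>k<N. (cmod (\<Phi> v k))\<^sup>2))) = 0" for v
      by (intro ennreal_neg) (simp add: mult_le_0_iff)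
    show False using prob_space.emeasure_space_1[OF prob] unfolding z
      by (simp add: emeasure_density)
  qed
  moreover note sigma_finite_lborel_cvec
  ultimately show ?thesis
    unfolding L_def[symmetric] using \<Psi>\<Phi> inv prob
    by (intro distr_gaussian_density[OF L_def finite_lessThan _ \<Phi>m \<Psi>m]) auto
qed


lemma measurable_PiM_uncurry:
  "(\<lambda>F. \<lambda>(i,j)\<in>I\<times>J. F j i) \<in> measurable (PiM J (\<lambda>_. gauss I)) (gauss_matrix I J)"
  unfolding case_prod_beta
proof (intro measurable_restrict)
  let ?C = "gauss I"
  fix p assume p: "p \<in> I \<times> J"
  have "(\<lambda>F. F (snd p)) \<in> measurable (PiM J (\<lambda>_. ?C)) ?C" using p by (intro measurable_component_singleton) auto
  moreover have "(\<lambda>f. f (fst p)) \<in> measurable ?C cgauss" using p by (intro measurable_component_singleton) auto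
  ultimately show "(\<lambda>F. F (snd p) (fst p)) \<in> measurable (PiM J (\<lambda>_. ?C)) cgauss"
    by (rule measurable_compose)
qed

lemma distr_PiM_uncurry:
  assumes "finite I" "finite J"
  shows "distr (PiM J (\<lambda>_. gauss I)) (gauss_matrix I J) (\<lambda>F. \<lambda>(i,j)\<in>I\<times>J. F j i) = gauss_matrix I J"
proof (rule cgauss.PiM_eqI)
  let ?C = "gauss I"
  interpret C: product_sigma_finite "\<lambda>_. ?C"
    by (simp add: product_sigma_finite_def prob_space_PiM_cgauss prob_space_imp_sigma_finite)
  note m = measurable_PiM_uncurry[of I J]
  fix A :: "'a \<times> 'b \<Rightarrow> complex set" assume A: "\<And>p. p \<in> I \<times> J \<Longrightarrow> A p \<in> sets cgauss"
  have "(\<lambda>F. \<lambda>(i,j)\<in>I\<times>J. F j i) -` Pi\<^sub>E (I \<times> J) A \<inter> space (PiM J (\<lambda>_. ?C)) = Pi\<^sub>E J (\<lambda>j. Pi\<^sub>E I (\<lambda>i. A (i, j)))"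
    by (auto simp: space_PiM PiE_iff)
  hence "emeasure (distr (PiM J (\<lambda>_. ?C)) (gauss_matrix I J) (\<lambda>F. \<lambda>(i,j)\<in>I\<times>J. F j i)) (Pi\<^sub>E (I \<times> J) A)
    = emeasure (PiM J (\<lambda>_. ?C)) (Pi\<^sub>E J (\<lambda>j. Pi\<^sub>E I (\<lambda>i. A (i, j))))"
    using A assms by (subst emeasure_distr[OF m]) (auto intro!: sets_PiM_I_finite)
  also have "\<dots> = (\<Prod>j\<in>J. \<Prod>i\<in>I. emeasure cgauss (A (i, j)))"
    using A assms by (subst C.emeasure_PiM) (auto intro!: sets_PiM_I_finite prod.cong cgauss.emeasure_PiM)
  also have "\<dots> = (\<Prod>p\<in>I\<times>J. emeasure cgauss (A p))"
    by (subst prod.swap) (simp add: prod.cartesian_product)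
  finally show "emeasure (distr (PiM J (\<lambda>_. ?C)) (gauss_matrix I J) (\<lambda>F. \<lambda>(i,j)\<in>I\<times>J. F j i)) (Pi\<^sub>E (I \<times> J) A)
    = (\<Prod>p\<in>I\<times>J. emeasure cgauss (A p))" .
qed (use assms in auto)

text \<open>Subtracting the mean is the orthogonal projection along the constant vector. A
  reflection taking the constant direction to the first basis vector turns it into deleting
  coordinate 0; the column count M - 1 comes from here.\<close>

lemma centering_reflection:
  assumes M: "M \<ge> 1"
  shows "\<exists>w. \<forall>h. sqnorm {..<M} (\<lambda>j. h j - (\<Sum>l<M. h l) / of_nat M) = sqnorm {1..<M} (householder {..<M} w h)"
proof -
  let ?u = "\<lambda>j. complex_of_real (sqrt (real M)) * (if j = 0 then 1 else 0)"
  have Mp: "real M > 0" using M by simp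
  have delta: "bilin {..<M} (\<lambda>j. if j = 0 then 1 else 0) h = h 0" for h
    using M by (simp add: bilin_def if_distrib[of "\<lambda>t. t * _"] cong: if_cong)
  have "sqnorm {..<M} ?u = sqnorm {..<M} (\<lambda>_. 1)"
    unfolding sqnorm_scale using sqnorm_single[of "{..<M}" 0 1] M by (simp add: if_distrib sqnorm_def[of _ "\<lambda>_. 1"] cong: if_cong)
  then obtain w' c where c: "cmod c = 1" and w': "\<And>j. j \<in> {..<M} \<Longrightarrow> householder {..<M} w' ?u j = c * 1"
    using householder_exists[of "{..<M}" ?u "\<lambda>_. 1"] by auto
  \<comment> \<open>Coordinate 0 of the reflected \<open>h\<close> is a pairing with the basis
    vector, and moving the reflection across the pairing transposes it; hence the conjugate.\<close>
  define w where "w j = cnj (w' j)" for j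
  have "sqnorm {..<M} (\<lambda>j. h j - (\<Sum>l<M. h l) / of_nat M) = sqnorm {1..<M} (householder {..<M} w h)" for h
  proof -
    define s where "s = (\<Sum>l<M. h l)"
    have "complex_of_real (sqrt (real M)) * householder {..<M} w h 0 = bilin {..<M} ?u (householder {..<M} w h)"
      using delta[of "householder {..<M} w h"] by (simp add: bilin_commute[of _ ?u] bilin_scale) (simp add: bilin_commute)
    also have "\<dots> = bilin {..<M} (householder {..<M} w' ?u) h" unfolding bilin_householder by (simp add: w_def)
    also have "\<dots> = bilin {..<M} (\<lambda>_. c) h" using w' by (intro bilin_cong) auto
    also have "\<dots> = c * s" by (simp add: bilin_def s_def sum_distrib_left)
    finally have "(cmod (complex_of_real (sqrt (real M)) * householder {..<M} w h 0))\<^sup>2 = (cmod (c * s))\<^sup>2" by simp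
    hence h0: "(cmod (householder {..<M} w h 0))\<^sup>2 = (cmod s)\<^sup>2 / real M"
      using Mp c by (simp add: norm_mult power_mult_distrib field_simps)
    have "sqnorm {..<M} (householder {..<M} w h) = (cmod (householder {..<M} w h 0))\<^sup>2 + sqnorm {1..<M} (householder {..<M} w h)"
    proof -
      have "{..<M} = insert 0 {1..<M}" using M by auto
      thus ?thesis by (simp add: sqnorm_def)
    qed
    hence "sqnorm {1..<M} (householder {..<M} w h) = sqnorm {..<M} h - (cmod s)\<^sup>2 / real M"
      by (simp add: sqnorm_householder h0)
    moreover have "sqnorm {..<M} (\<lambda>j. - (s / of_nat M) + h j) = sqnorm {..<M} h - (cmod s)\<^sup>2 / real M"
    proof -
      have 1: "sqnorm {..<M} (\<lambda>j. - (s / of_nat M)) = (cmod s)\<^sup>2 / real M"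
        using Mp by (simp add: sqnorm_def norm_divide power_divide power2_eq_square)
      have "bilin {..<M} (\<lambda>j. cnj (- (s / of_nat M))) h = - (cnj s * s / of_nat M)"
        by (simp add: bilin_def sum_distrib_left[symmetric] s_def[symmetric] sum_negf sum_divide_distrib[symmetric])
      also have "cnj s * s = complex_of_real ((cmod s)\<^sup>2)"
        by (simp add: complex_norm_square mult.commute del: of_real_power)
      finally have 2: "Re (bilin {..<M} (\<lambda>j. cnj (- (s / of_nat M))) h) = - ((cmod s)\<^sup>2 / real M)"
        by (simp add: Re_divide_of_nat)
      show ?thesis unfolding sqnorm_add 1 2 by simp
    qed
    ultimately show ?thesis by (simp add: s_def)
  qed
  thus ?thesis by blast
qed


context
  fixes y :: "nat \<Rightarrow> complex vec" and \<mu> :: "complex vec" and M N :: nat and d :: "nat \<Rightarrow> real"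
    and u :: "nat \<Rightarrow> nat \<Rightarrow> complex" and G :: "nat \<times> nat \<Rightarrow> complex"
  assumes M: "M \<ge> 1"
    and orth1: "\<And>i l. i < N \<Longrightarrow> l < N \<Longrightarrow> (\<Sum>k<N. u i k * cnj (u l k)) = (if i = l then 1 else 0)"
    and orth2: "\<And>k l. k < N \<Longrightarrow> l < N \<Longrightarrow> (\<Sum>i<N. cnj (u i k) * u i l) = (if k = l then 1 else 0)"
    and d: "\<And>k. k < N \<Longrightarrow> d k > 0"
    and G: "\<And>k j. k < N \<Longrightarrow> j < M \<Longrightarrow> G (k, j) = (\<Sum>i<N. cnj (u i k) * (y j $ i - \<mu> $ i)) / complex_of_real (sqrt (d k))"
begin

private lemma recolor: "y j $ i - \<mu> $ i = (\<Sum>k<N. u i k * complex_of_real (sqrt (d k)) * G (k, j))"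
  if ij: "i < N" "j < M"
proof -
  have "(\<Sum>k<N. u i k * complex_of_real (sqrt (d k)) * G (k, j)) = (\<Sum>k<N. \<Sum>l<N. u i k * cnj (u l k) * (y j $ l - \<mu> $ l))"
  proof (rule sum.cong[OF refl])
    fix k assume "k \<in> {..<N}"
    then have k: "k < N" by simp
    have "complex_of_real (sqrt (d k)) \<noteq> 0" using d[OF k] by simp
    thus "u i k * complex_of_real (sqrt (d k)) * G (k, j) = (\<Sum>l<N. u i k * cnj (u l k) * (y j $ l - \<mu> $ l))"
      using k ij by (simp add: G) (simp add: sum_distrib_left mult_ac)
  qed
  also have "\<dots> = (\<Sum>l<N. (\<Sum>k<N. u i k * cnj (u l k)) * (y j $ l - \<mu> $ l))"
    by (subst sum.swap) (simp add: sum_distrib_right)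
  also have "\<dots> = y j $ i - \<mu> $ i"
    using ij by (simp add: orth1 if_distrib[of "\<lambda>t. t * _"] cong: if_cong)
  finally show ?thesis ..
qed

text \<open>The substitution x = D^(1/2) U^T z undoes rotation and scaling at once, and \<mu>
  cancels in the differences from the sample mean. The second identity expresses that U is
  unitary.\<close>

private lemma transfer_form:
  fixes z :: "nat \<Rightarrow> complex"
  defines "x \<equiv> \<lambda>k. complex_of_real (sqrt (d k)) * (\<Sum>i<N. z i * u i k)"
  shows "sqnorm {..<M} (\<lambda>j. bilin {..<N} z (\<lambda>i. y j $ i - (\<Sum>l<M. y l $ i) / of_nat M))
      = sqnorm {..<M} (\<lambda>j. bilin {..<N} x (\<lambda>k. G (k, j)) - (\<Sum>l<M. bilin {..<N} x (\<lambda>k. G (k, l))) / of_nat M)"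
    "sqnorm {..<N} z = (\<Sum>k<N. (cmod (x k))\<^sup>2 / d k)"
proof -
  have Mp: "of_nat M \<noteq> (0::complex)" using M by simp
  have lfG: "bilin {..<N} z (\<lambda>i. y j $ i - \<mu> $ i) = bilin {..<N} x (\<lambda>k. G (k, j))" if j: "j < M" for j
  proof -
    have "bilin {..<N} z (\<lambda>i. y j $ i - \<mu> $ i) = (\<Sum>i<N. \<Sum>k<N. z i * (u i k * complex_of_real (sqrt (d k)) * G (k, j)))"
      unfolding bilin_def using j by (intro sum.cong) (auto simp: recolor sum_distrib_left)
    also have "\<dots> = (\<Sum>k<N. \<Sum>i<N. z i * (u i k * complex_of_real (sqrt (d k)) * G (k, j)))" by (rule sum.swap)
    also have "\<dots> = bilin {..<N} x (\<lambda>k. G (k, j))"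
      unfolding bilin_def x_def by (intro sum.cong refl) (simp add: sum_distrib_left sum_distrib_right mult_ac)
    finally show ?thesis .
  qed
  have "bilin {..<N} z (\<lambda>i. y j $ i - (\<Sum>l<M. y l $ i) / of_nat M)
    = bilin {..<N} x (\<lambda>k. G (k, j)) - (\<Sum>l<M. bilin {..<N} x (\<lambda>k. G (k, l))) / of_nat M" if j: "j < M" for j
  proof -
    have "y j $ i - (\<Sum>l<M. y l $ i) / of_nat M = (y j $ i - \<mu> $ i) - (\<Sum>l<M. y l $ i - \<mu> $ i) / of_nat M" for i
      using Mp by (simp add: sum_subtractf diff_divide_distrib)
    hence "bilin {..<N} z (\<lambda>i. y j $ i - (\<Sum>l<M. y l $ i) / of_nat M)
      = bilin {..<N} z (\<lambda>i. y j $ i - \<mu> $ i) - bilin {..<N} z (\<lambda>i. (\<Sum>l<M. y l $ i - \<mu> $ i) / of_nat M)"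
      by (simp only: bilin_diff[symmetric])
    also have "bilin {..<N} z (\<lambda>i. (\<Sum>l<M. y l $ i - \<mu> $ i) / of_nat M) = (\<Sum>l<M. bilin {..<N} z (\<lambda>i. y l $ i - \<mu> $ i)) / of_nat M"
      unfolding bilin_def by (subst sum.swap) (simp add: sum_divide_distrib sum_distrib_left)
    also have "(\<Sum>l<M. bilin {..<N} z (\<lambda>i. y l $ i - \<mu> $ i)) = (\<Sum>l<M. bilin {..<N} x (\<lambda>k. G (k, l)))"
      by (intro sum.cong) (auto simp: lfG)
    finally show ?thesis by (simp add: lfG j)
  qed
  thus "sqnorm {..<M} (\<lambda>j. bilin {..<N} z (\<lambda>i. y j $ i - (\<Sum>l<M. y l $ i) / of_nat M))
      = sqnorm {..<M} (\<lambda>j. bilin {..<N} x (\<lambda>k. G (k, j)) - (\<Sum>l<M. bilin {..<N} x (\<lambda>k. G (k, l))) / of_nat M)"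
    by (intro sqnorm_cong) auto
  have "complex_of_real (\<Sum>k<N. (cmod (x k))\<^sup>2 / d k) = (\<Sum>k<N. (\<Sum>i<N. z i * u i k) * cnj (\<Sum>i<N. z i * u i k))"
    unfolding of_real_sum
  proof (rule sum.cong[OF refl])
    fix k assume "k \<in> {..<N}"
    then have "d k > 0" using d by simp
    hence "(cmod (x k))\<^sup>2 / d k = (cmod (\<Sum>i<N. z i * u i k))\<^sup>2"
      by (simp add: x_def norm_mult power_mult_distrib)
    thus "complex_of_real ((cmod (x k))\<^sup>2 / d k) = (\<Sum>i<N. z i * u i k) * cnj (\<Sum>i<N. z i * u i k)"
      by (simp only: complex_norm_square)
  qed
  also have "\<dots> = (\<Sum>k<N. \<Sum>i<N. \<Sum>l<N. z i * cnj (z l) * (u i k * cnj (u l k)))"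
    by (simp add: sum_product mult_ac)
  also have "\<dots> = (\<Sum>i<N. \<Sum>l<N. z i * cnj (z l) * (\<Sum>k<N. u i k * cnj (u l k)))"
    unfolding sum_distrib_left by (subst sum.swap) (intro sum.cong refl sum.swap)
  also have "\<dots> = (\<Sum>i<N. z i * cnj (z i))"
    by (intro sum.cong refl) (simp add: orth1 if_distrib[of "\<lambda>t. _ * t"] cong: if_cong)
  also have "\<dots> = complex_of_real (sqnorm {..<N} z)"
    by (simp add: sqnorm_def complex_norm_square del: of_real_power)
  finally show "sqnorm {..<N} z = (\<Sum>k<N. (cmod (x k))\<^sup>2 / d k)" by (simp only: of_real_eq_iff)
qed

text \<open>The substitution of \<open>transfer_form\<close> is onto as far as coordinates below
  \<open>N\<close> are concerned, so the two universal statements match. The reflection acts on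
  columns and therefore commutes with combining rows.\<close>

lemma sample_forms_iff:
  assumes w: "\<And>h. sqnorm {..<M} (\<lambda>j. h j - (\<Sum>l<M. h l) / of_nat M) = sqnorm {1..<M} (householder {..<M} w h)"
  shows "(\<forall>z. sqnorm {..<M} (\<lambda>j. bilin {..<N} z (\<lambda>i. y j $ i - (\<Sum>l<M. y l $ i) / of_nat M)) \<le> t * sqnorm {..<N} z)
    \<longleftrightarrow> (\<forall>x. sqnorm {1..<M} (\<lambda>j. bilin {..<N} x (\<lambda>i. householder {..<M} w (\<lambda>l. G (i, l)) j)) \<le> t * (\<Sum>k<N. (cmod (x k))\<^sup>2 / d k))"
    (is "(\<forall>z. ?P z) \<longleftrightarrow> (\<forall>x. ?Q x)")
proof -
  define X where "X z k = complex_of_real (sqrt (d k)) * (\<Sum>i<N. z i * u i k)" for z :: "nat \<Rightarrow> complex" and k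
  have PQ: "?P z \<longleftrightarrow> ?Q (X z)" for z
    unfolding transfer_form[of z, folded X_def] w bilin_householder_swap[abs_def] ..
  have surj: "\<exists>z. \<forall>k<N. X z k = x k" for x
  proof (intro exI allI impI)
    fix k assume k: "k < N"
    let ?z = "\<lambda>i. \<Sum>l<N. x l / complex_of_real (sqrt (d l)) * cnj (u i l)"
    have "(\<Sum>i<N. ?z i * u i k) = (\<Sum>l<N. x l / complex_of_real (sqrt (d l)) * (\<Sum>i<N. cnj (u i l) * u i k))"
      unfolding sum_distrib_left sum_distrib_right by (subst sum.swap) (simp add: mult_ac)
    also have "\<dots> = x k / complex_of_real (sqrt (d k))"
      using k by (simp add: orth2 if_distrib[of "\<lambda>t. _ * t"] cong: if_cong)
    finally show "X ?z k = x k" using d[OF k] by (simp add: X_def)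
  qed
  have Q_cong: "?Q x \<longleftrightarrow> ?Q x'" if "\<And>k. k < N \<Longrightarrow> x k = x' k" for x x'
  proof -
    have "bilin {..<N} x h = bilin {..<N} x' h" for h using that by (intro bilin_cong) auto
    moreover have "(\<Sum>k<N. (cmod (x k))\<^sup>2 / d k) = (\<Sum>k<N. (cmod (x' k))\<^sup>2 / d k)" using that by (intro sum.cong) auto
    ultimately show ?thesis by simp
  qed
  show ?thesis
  proof (intro iffI allI)
    fix x assume P: "\<forall>z. ?P z"
    obtain z where "\<forall>k<N. X z k = x k" using surj by blast
    hence "?Q (X z) \<longleftrightarrow> ?Q x" by (intro Q_cong) auto
    thus "?Q x" using P PQ by blast
  qed (use PQ in blast)
qed

end


text \<open>\<open>mat_inverse\<close> returns an option, so invertibility comes first: U D^(-1) U^*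
  is a two-sided inverse and, inverses being unique, the matrix that is returned.\<close>

lemma mat_inverse_unitary_form:
  fixes A U :: "complex mat" and d :: "nat \<Rightarrow> real"
  assumes A: "A \<in> carrier_mat n n" and U: "U \<in> carrier_mat n n" "mat_adjoint U * U = 1\<^sub>m n" "U * mat_adjoint U = 1\<^sub>m n"
    and D: "mat_adjoint U * A * U = mat n n (\<lambda>(i, j). if i = j then complex_of_real (d i) else 0)"
    and d: "\<And>k. k < n \<Longrightarrow> d k > 0" and w: "w \<in> carrier_vec n"
  shows "Re ((the (mat_inverse A) *\<^sub>v w) \<bullet>c w) = (\<Sum>k<n. (cmod (\<Sum>i<n. cnj (U $$ (i, k)) * w $ i))\<^sup>2 / d k)"
proof -
  note U' = mat_adjoint_carrier[OF U(1)]
  let ?D = "mat n n (\<lambda>(i, j). if i = j then complex_of_real (d i) else 0)"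
  let ?E = "mat n n (\<lambda>(i, j). if i = j then complex_of_real (1 / d i) else 0)"
  note assoc = assoc_mult_mat[of _ n n _ n _ n]
  have DE: "?D * ?E = 1\<^sub>m n" "?E * ?D = 1\<^sub>m n"
    using d by (auto intro!: eq_matI simp: scalar_prod_def if_distrib[of "\<lambda>t. t * _"] less_imp_neq[symmetric] cong: if_cong)
  have A_eq: "A = U * ?D * mat_adjoint U"
  proof -
    have AU: "A * U \<in> carrier_mat n n" using A U(1) by simp
    have "U * (mat_adjoint U * A * U) = U * (mat_adjoint U * (A * U))"
      using assoc_mult_mat[OF U' A U(1)] by simp
    also have "\<dots> = (U * mat_adjoint U) * (A * U)"
      by (rule assoc_mult_mat[OF U(1) U' AU, symmetric])
    also have "\<dots> = A * U" unfolding U(3) by (rule left_mult_one_mat[OF AU])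
    finally have "U * (mat_adjoint U * A * U) * mat_adjoint U = A * (U * mat_adjoint U)"
      using assoc_mult_mat[OF A U(1) U'] by simp
    thus ?thesis using A U(3) by (simp add: D)
  qed
  have Dc: "?D \<in> carrier_mat n n" and Ec: "?E \<in> carrier_mat n n" by auto
  have prod: "(U * X * mat_adjoint U) * (U * Z * mat_adjoint U) = 1\<^sub>m n"
    if X: "X \<in> carrier_mat n n" and Z: "Z \<in> carrier_mat n n" and XZ: "X * Z = 1\<^sub>m n" for X Z
  proof -
    have ZU: "Z * mat_adjoint U \<in> carrier_mat n n" by (rule mult_carrier_mat[OF Z U'])
    have UX: "U * X \<in> carrier_mat n n" by (rule mult_carrier_mat[OF U(1) X])
    have UZU: "U * (Z * mat_adjoint U) \<in> carrier_mat n n" by (rule mult_carrier_mat[OF U(1) ZU])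
    have "(U * X * mat_adjoint U) * (U * Z * mat_adjoint U) = (U * X) * (mat_adjoint U * (U * (Z * mat_adjoint U)))"
      unfolding assoc_mult_mat[OF U(1) Z U'] by (rule assoc_mult_mat[OF UX U' UZU])
    also have "mat_adjoint U * (U * (Z * mat_adjoint U)) = Z * mat_adjoint U"
      unfolding assoc_mult_mat[OF U' U(1) ZU, symmetric] U(2) by (rule left_mult_one_mat[OF ZU])
    also have "(U * X) * (Z * mat_adjoint U) = U * (X * (Z * mat_adjoint U))"
      by (rule assoc_mult_mat[OF U(1) X ZU])
    also have "X * (Z * mat_adjoint U) = mat_adjoint U"
      unfolding assoc_mult_mat[OF X Z U', symmetric] XZ by (rule left_mult_one_mat[OF U'])
    finally show ?thesis by (simp add: U(3))
  qed
  define C where "C = U * ?E * mat_adjoint U"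
  have C: "C \<in> carrier_mat n n" unfolding C_def by (rule mult_carrier_mat[OF mult_carrier_mat[OF U(1) Ec] U'])
  have AC: "A * C = 1\<^sub>m n" by (subst A_eq, unfold C_def, rule prod[OF Dc Ec DE(1)])
  have CA: "C * A = 1\<^sub>m n" by (subst A_eq, unfold C_def, rule prod[OF Ec Dc DE(2)])
  have "A \<in> Units (ring_mat TYPE(complex) n ())"
    using A C AC CA by (auto simp: Units_def ring_mat_simps)
  then obtain B where B: "mat_inverse A = Some B" using mat_inverse(1)[OF A, where b = "()"] by (cases "mat_inverse A") auto
  from mat_inverse(2)[OF A B] have "A * B = 1\<^sub>m n" "B \<in> carrier_mat n n" by auto
  hence "B = C"
    using CA A C assoc_mult_mat[OF C A, of B n] by simp
  define z where "z = mat_adjoint U *\<^sub>v w"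
  have z: "z \<in> carrier_vec n" using U' w by (simp add: z_def)
  have zk: "z $ k = (\<Sum>i<n. cnj (U $$ (i, k)) * w $ i)" if "k < n" for k
    unfolding z_def using U(1) w that by (simp add: scalar_prod_def atLeast0LessThan)
  have "C *\<^sub>v w = U *\<^sub>v (?E *\<^sub>v z)"
  proof -
    have "C *\<^sub>v w = (U * ?E) *\<^sub>v z"
      unfolding C_def z_def by (rule assoc_mult_mat_vec[of _ n n _ n]) (use U(1) U' w in auto)
    also have "\<dots> = U *\<^sub>v (?E *\<^sub>v z)"
      by (rule assoc_mult_mat_vec[of _ n n _ n]) (use U(1) z in auto)
    finally show ?thesis .
  qed
  moreover have "?E *\<^sub>v z \<in> carrier_vec n" by (rule mult_mat_vec_carrier[OF Ec z])
  ultimately have "(C *\<^sub>v w) \<bullet>c w = (?E *\<^sub>v z) \<bullet>c z"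
    using scalar_prod_conjugate_adjoint[OF U(1) _ w, of "?E *\<^sub>v z"] by (simp only: z_def)
  also have "\<dots> = (\<Sum>k<n. complex_of_real (1 / d k) * (z $ k * cnj (z $ k)))"
    using z by (auto simp: scalar_prod_def atLeast0LessThan if_distrib[of "\<lambda>t. t * _"] cong: if_cong intro!: sum.cong)
  also have "\<dots> = complex_of_real (\<Sum>k<n. (cmod (z $ k))\<^sup>2 / d k)"
    unfolding of_real_sum by (intro sum.cong) (auto simp: complex_norm_square simp del: of_real_power)
  finally have "Re ((C *\<^sub>v w) \<bullet>c w) = (\<Sum>k<n. (cmod (z $ k))\<^sup>2 / d k)" by simp
  thus ?thesis unfolding B option.sel \<open>B = C\<close> by (simp add: zk)
qed

text \<open>Four maps with known laws carry the sample to a Gaussian matrix: whitening each vector,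
  collecting the independent columns, reflecting them to isolate the mean, and deleting column 0.
  The event is the preimage of \<open>cov_le\<close> under their composite, which also makes it
  measurable. The factor \<open>real M\<close> undoes the division by M in the sample
  covariance.\<close>

theorem measure_largest_eigenvalue_le:
  fixes y :: "nat \<Rightarrow> 'a \<Rightarrow> complex vec" and ell :: "nat \<Rightarrow> real" and x :: real
  assumes P: "prob_space P" and MN: "M \<ge> 1" "N \<ge> 1"
    and \<mu>: "\<mu> \<in> carrier_vec N" and \<Sigma>: "hermitian_pos_def N \<Sigma>"
    and gaussian: "\<And>j. j < M \<Longrightarrow> complex_gaussian P N \<mu> \<Sigma> (y j)"
    and indep: "prob_space.indep_vars P (\<lambda>j. lborel_cvec N) y {..<M}"
    and ell: "\<And>j. j \<in> {1..N} \<Longrightarrow> ell j > 0"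
    and cp: "char_poly \<Sigma> = (\<Prod>j=1..N. [:- complex_of_real (ell j), 1:])"
  defines "E \<equiv> {\<omega> \<in> space P. largest_eigenvalue (sample_covariance N M (\<lambda>j. y j \<omega>)) \<le> x}"
  shows "E \<in> sets P"
    "measure P E = measure (gauss_matrix {..<N} {1..<M}) (cov_le {..<N} {1..<M} (\<lambda>k. ell (Suc k)) (x * real M))"
proof -
  interpret P: prob_space P by fact
  have \<Sigma>c: "\<Sigma> \<in> carrier_mat N N" and \<Sigma>h: "mat_adjoint \<Sigma> = \<Sigma>" using \<Sigma> by (auto simp: hermitian_pos_def_def)
  define es where "es = map (\<lambda>j. complex_of_real (ell j)) [1..<Suc N]"
  \<comment> \<open>Eigenvalues are numbered from 1, rows from 0.\<close>
  define d where "d k = ell (Suc k)" for k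
  have d: "d k > 0" if "k < N" for k using ell[of "Suc k"] that by (simp add: d_def)
  have len: "length es = N" by (simp add: es_def)
  have es_nth: "es ! k = complex_of_real (d k)" if "k < N" for k
    using that by (simp add: es_def d_def del: upt_Suc)
  have "char_poly \<Sigma> = (\<Prod>a\<leftarrow>es. [:- a, 1:])"
    unfolding cp es_def map_map comp_def
    using prod.distinct_set_conv_list[of "[1..<Suc N]" "\<lambda>j. [:- complex_of_real (ell j), 1:]"]
    by (simp add: atLeastLessThanSuc_atLeastAtMost del: upt_Suc)
  from hermitian_unitary_diagonalization[OF \<Sigma>c \<Sigma>h this]
  obtain U where U: "U \<in> carrier_mat N N" "mat_adjoint U * U = 1\<^sub>m N" "U * mat_adjoint U = 1\<^sub>m N"
    and UD: "mat_adjoint U * \<Sigma> * U = diag_of es" by blast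
  note U' = mat_adjoint_carrier[OF U(1)]
  have UD': "mat_adjoint U * \<Sigma> * U = mat N N (\<lambda>(i, j). if i = j then complex_of_real (d i) else 0)"
    unfolding UD diag_of_def len by (rule eq_matI) (auto simp: es_nth)
  define u where "u i k = U $$ (i, k)" for i k
  have orth1: "(\<Sum>k<N. u i k * cnj (u l k)) = (if i = l then 1 else 0)" if "i < N" "l < N" for i l
  proof -
    have "(U * mat_adjoint U) $$ (i, l) = (\<Sum>k<N. u i k * cnj (u l k))"
      using that U(1) by (simp add: scalar_prod_def atLeast0LessThan u_def)
    thus ?thesis unfolding U(3) using that by simp
  qed
  have orth2: "(\<Sum>i<N. cnj (u i k) * u i l) = (if k = l then 1 else 0)" if "k < N" "l < N" for k l
  proof -
    have "(mat_adjoint U * U) $$ (k, l) = (\<Sum>i<N. cnj (u i k) * u i l)"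
      using that U(1) by (simp add: scalar_prod_def atLeast0LessThan u_def)
    thus ?thesis unfolding U(2) using that by simp
  qed
  define \<Phi> where "\<Phi> v = (\<lambda>k\<in>{..<N}. (\<Sum>i<N. cnj (u i k) * (v $ i - \<mu> $ i)) / complex_of_real (sqrt (d k)))" for v
  let ?C = "gauss {..<N}"
  let ?L = "PiM {..<N} (\<lambda>_. lborel :: complex measure)"
  have \<Phi>L: "\<Phi> \<in> measurable (lborel_cvec N) ?L"
    unfolding \<Phi>_def using borel_measurable_vec_index by (intro measurable_restrict) auto
  hence \<Phi>m: "\<Phi> \<in> measurable (lborel_cvec N) ?C"
    by (simp add: measurable_cong_sets[OF refl sets_PiM_cgauss])
  have form: "Re ((the (mat_inverse \<Sigma>) *\<^sub>v (v - \<mu>)) \<bullet>c (v - \<mu>)) = (\<Sum>k<N. (cmod (\<Phi> v k))\<^sup>2)"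
    if v: "v \<in> carrier_vec N" for v
  proof -
    have "v - \<mu> \<in> carrier_vec N" using v \<mu> by simp
    from mat_inverse_unitary_form[OF \<Sigma>c U UD' d this]
    have "Re ((the (mat_inverse \<Sigma>) *\<^sub>v (v - \<mu>)) \<bullet>c (v - \<mu>)) = (\<Sum>k<N. (cmod (\<Sum>i<N. cnj (u i k) * (v $ i - \<mu> $ i)))\<^sup>2 / d k)"
      using v \<mu> by (simp add: u_def)
    also have "\<dots> = (\<Sum>k<N. (cmod (\<Phi> v k))\<^sup>2)"
      using d by (intro sum.cong) (auto simp: \<Phi>_def norm_divide power_divide less_imp_le)
    finally show ?thesis .
  qed
  have ym: "y j \<in> measurable P (lborel_cvec N)" if "j < M" for j
    using gaussian[OF that] by (auto simp: complex_gaussian_def dest: distributed_measurable)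
  have yc: "y j \<omega> \<in> carrier_vec N" if "j < M" "\<omega> \<in> space P" for j \<omega>
    using measurable_space[OF ym that(2)] that by (simp add: space_lborel_cvec)
  have col: "distr P ?C (\<lambda>\<omega>. \<Phi> (y j \<omega>)) = ?C" if j: "j < M" for j
  proof -
    obtain c :: real where c: "distributed P (lborel_cvec N) (y j)
        (\<lambda>v. ennreal (c * exp (- Re ((the (mat_inverse \<Sigma>) *\<^sub>v (v - \<mu>)) \<bullet>c (v - \<mu>)))))"
      using gaussian[OF j] by (auto simp: complex_gaussian_def)
    let ?h = "\<lambda>v. ennreal (c * exp (- (\<Sum>k<N. (cmod (\<Phi> v k))\<^sup>2)))"
    have "(\<lambda>v. \<Phi> v k) \<in> borel_measurable (lborel_cvec N)" if "k < N" for k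
      using measurable_compose[OF \<Phi>m measurable_PiM_cgauss_component[of k "{..<N}"]] that by simp
    hence hm: "?h \<in> borel_measurable (lborel_cvec N)" by measurable
    have law: "distr P (lborel_cvec N) (y j) = density (lborel_cvec N) ?h"
      unfolding distributed_distr_eq_density[OF c]
      by (rule density_cong[OF distributed_borel_measurable[OF c] hm]) (auto simp: form space_lborel_cvec)
    have prob: "prob_space (density (lborel_cvec N) ?h)"
      unfolding law[symmetric] by (rule P.prob_space_distr[OF ym[OF j]])
    have "distr P ?C (\<lambda>\<omega>. \<Phi> (y j \<omega>)) = distr (distr P (lborel_cvec N) (y j)) ?C \<Phi>"
      by (subst distr_distr[OF \<Phi>m ym[OF j]]) (simp add: comp_def)
    also have "\<dots> = distr (density (lborel_cvec N) ?h) ?L \<Phi>"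
      unfolding law by (rule distr_cong) (auto simp: sets_PiM_cgauss)
    also have "\<dots> = ?C"
      using distr_whitened_column[of N u d c \<mu>, OF orth1 orth2 d] prob unfolding \<Phi>_def by blast
    finally show ?thesis .
  qed
  have joint: "distr P (PiM {..<M} (\<lambda>_. ?C)) (\<lambda>\<omega>. \<lambda>j\<in>{..<M}. \<Phi> (y j \<omega>)) = PiM {..<M} (\<lambda>_. ?C)"
  proof -
    have rv: "(\<lambda>\<omega>. \<Phi> (y j \<omega>)) \<in> measurable P ?C" if "j \<in> {..<M}" for j
      using measurable_compose[OF ym \<Phi>m] that by simp
    have "P.indep_vars (\<lambda>_. ?C) (\<lambda>j \<omega>. \<Phi> (y j \<omega>)) {..<M}"
      using P.indep_vars_compose2[OF indep, where Y = "\<lambda>_. \<Phi>" and N = "\<lambda>_. ?C"] \<Phi>m by simp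
    moreover have "{..<M} \<noteq> {}" using MN by (auto simp: lessThan_empty_iff)
    ultimately have "distr P (PiM {..<M} (\<lambda>_. ?C)) (\<lambda>\<omega>. \<lambda>j\<in>{..<M}. \<Phi> (y j \<omega>))
      = PiM {..<M} (\<lambda>j. distr P ?C (\<lambda>\<omega>. \<Phi> (y j \<omega>)))"
      using P.indep_vars_iff_distr_eq_PiM'[where I = "{..<M}" and M' = "\<lambda>_. ?C" and X = "\<lambda>j \<omega>. \<Phi> (y j \<omega>)"] rv by simp
    also have "\<dots> = PiM {..<M} (\<lambda>_. ?C)" by (intro PiM_cong) (auto simp: col)
    finally show ?thesis .
  qed
  obtain w where w: "\<And>h. sqnorm {..<M} (\<lambda>j. h j - (\<Sum>l<M. h l) / of_nat M) = sqnorm {1..<M} (householder {..<M} w h)"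
    using centering_reflection[OF MN(1)] by blast
  define Y where "Y \<omega> = (\<lambda>j\<in>{..<M}. \<Phi> (y j \<omega>))" for \<omega>
  define Uc where "Uc F = (\<lambda>(i,j)\<in>{..<N}\<times>{..<M}. F j i)" for F :: "nat \<Rightarrow> nat \<Rightarrow> complex"
  define Rt where "Rt G = (\<lambda>(i,j)\<in>{..<N}\<times>{..<M}. householder {..<M} w (\<lambda>k. G (i, k)) j)" for G :: "nat \<times> nat \<Rightarrow> complex"
  define Rs where "Rs G = restrict G ({..<N} \<times> {1..<M})" for G :: "nat \<times> nat \<Rightarrow> complex"
  have sub: "{..<N} \<times> {1..<M} \<subseteq> {..<N} \<times> {..<M}" by auto
  have Ym: "Y \<in> measurable P (PiM {..<M} (\<lambda>_. ?C))"
    unfolding Y_def using measurable_compose[OF ym \<Phi>m] by (intro measurable_restrict) auto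
  have Um: "Uc \<in> measurable (PiM {..<M} (\<lambda>_. ?C)) (gauss_matrix {..<N} {..<M})"
    unfolding Uc_def by (rule measurable_PiM_uncurry)
  have Rtm: "Rt \<in> measurable (gauss_matrix {..<N} {..<M}) (gauss_matrix {..<N} {..<M})"
    unfolding Rt_def by (rule measurable_householder_right)
  have Rsm: "Rs \<in> measurable (gauss_matrix {..<N} {..<M}) (gauss_matrix {..<N} {1..<M})"
    unfolding Rs_def by (rule measurable_restrict_subset[OF sub])
  have law: "distr P (gauss_matrix {..<N} {1..<M}) (\<lambda>\<omega>. Rs (Rt (Uc (Y \<omega>)))) = gauss_matrix {..<N} {1..<M}"
  proof -
    have "distr (distr (distr (distr P (PiM {..<M} (\<lambda>_. ?C)) Y) (gauss_matrix {..<N} {..<M}) Uc) (gauss_matrix {..<N} {..<M}) Rt) (gauss_matrix {..<N} {1..<M}) Rs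
      = gauss_matrix {..<N} {1..<M}"
    proof -
      have 1: "distr P (PiM {..<M} (\<lambda>_. ?C)) Y = PiM {..<M} (\<lambda>_. ?C)"
        unfolding Y_def[abs_def] by (rule joint)
      have 2: "distr (PiM {..<M} (\<lambda>_. ?C)) (gauss_matrix {..<N} {..<M}) Uc = gauss_matrix {..<N} {..<M}"
        unfolding Uc_def[abs_def] by (rule distr_PiM_uncurry) auto
      have 3: "distr (gauss_matrix {..<N} {..<M}) (gauss_matrix {..<N} {..<M}) Rt = gauss_matrix {..<N} {..<M}"
        unfolding Rt_def[abs_def] by (rule distr_householder_right) auto
      have 4: "distr (gauss_matrix {..<N} {..<M}) (gauss_matrix {..<N} {1..<M}) Rs = gauss_matrix {..<N} {1..<M}"
        unfolding Rs_def[abs_def] by (rule distr_PiM_cgauss_restrict[OF _ sub]) auto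
      show ?thesis unfolding 1 2 3 4 ..
    qed
    thus ?thesis
      unfolding distr_distr[OF Um Ym, unfolded comp_def]
        distr_distr[OF Rtm measurable_compose[OF Ym Um], unfolded comp_def]
        distr_distr[OF Rsm measurable_compose[OF measurable_compose[OF Ym Um] Rtm], unfolded comp_def] .
  qed
  let ?T = "\<lambda>\<omega>. Rs (Rt (Uc (Y \<omega>)))"
  have Tm: "?T \<in> measurable P (gauss_matrix {..<N} {1..<M})"
    using Ym Um Rtm Rsm by (auto intro: measurable_compose)
  have iff: "largest_eigenvalue (sample_covariance N M (\<lambda>j. y j \<omega>)) \<le> x
      \<longleftrightarrow> ?T \<omega> \<in> cov_le {..<N} {1..<M} (\<lambda>k. ell (Suc k)) (x * real M)" if \<omega>: "\<omega> \<in> space P" for \<omega>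
  proof -
    have G: "Uc (Y \<omega>) (k, j) = (\<Sum>i<N. cnj (u i k) * (y j \<omega> $ i - \<mu> $ i)) / complex_of_real (sqrt (d k))"
      if "k < N" "j < M" for k j
      using that by (simp add: Uc_def Y_def \<Phi>_def)
    have "bilin {..<N} z (\<lambda>i. ?T \<omega> (i, j)) = bilin {..<N} z (\<lambda>i. householder {..<M} w (\<lambda>l. Uc (Y \<omega>) (i, l)) j)" if "j \<in> {1..<M}" for z j
      using that by (intro bilin_cong) (auto simp: Rs_def Rt_def)
    hence T: "sqnorm {1..<M} (comb {..<N} z (?T \<omega>))
      = sqnorm {1..<M} (\<lambda>j. bilin {..<N} z (\<lambda>i. householder {..<M} w (\<lambda>l. Uc (Y \<omega>) (i, l)) j))" for z
      by (intro sqnorm_cong) auto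
    have "largest_eigenvalue (sample_covariance N M (\<lambda>j. y j \<omega>)) \<le> x
      \<longleftrightarrow> (\<forall>z. sqnorm {..<M} (\<lambda>j. bilin {..<N} z (\<lambda>i. y j \<omega> $ i - (\<Sum>l<M. y l \<omega> $ i) / of_nat M)) \<le> x * real M * sqnorm {..<N} z)"
      by (rule largest_eigenvalue_sample_covariance_le_iff[OF _ MN]) (rule yc[OF _ \<omega>])
    also have "\<dots> \<longleftrightarrow> (\<forall>z. sqnorm {1..<M} (\<lambda>j. bilin {..<N} z (\<lambda>i. householder {..<M} w (\<lambda>l. Uc (Y \<omega>) (i, l)) j))
        \<le> x * real M * (\<Sum>k<N. (cmod (z k))\<^sup>2 / d k))"
      by (rule sample_forms_iff[OF MN(1) orth1 orth2 d G w])
    also have "\<dots> \<longleftrightarrow> ?T \<omega> \<in> cov_le {..<N} {1..<M} (\<lambda>k. ell (Suc k)) (x * real M)"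
      using measurable_space[OF Tm \<omega>] unfolding cov_le_def mem_Collect_eq T d_def by blast
    finally show ?thesis .
  qed
  have E: "E = ?T -` cov_le {..<N} {1..<M} (\<lambda>k. ell (Suc k)) (x * real M) \<inter> space P"
    unfolding E_def using iff by auto
  show "E \<in> sets P" unfolding E by (rule measurable_sets[OF Tm sets_cov_le]) simp
  have "measure P E = measure (distr P (gauss_matrix {..<N} {1..<M}) ?T) (cov_le {..<N} {1..<M} (\<lambda>k. ell (Suc k)) (x * real M))"
    unfolding E by (rule measure_distr[symmetric, OF Tm sets_cov_le]) simp
  thus "measure P E = measure (gauss_matrix {..<N} {1..<M}) (cov_le {..<N} {1..<M} (\<lambda>k. ell (Suc k)) (x * real M))"
    unfolding law .
qed

section \<open>Convergence in probability\<close>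

text \<open>The parameters are merely confined to a compact set, so they have limits along
  subsequences only; this lemma returns to the full sequence.\<close>

lemma LIMSEQ_by_subsequences:
  fixes X :: "nat \<Rightarrow> real"
  assumes "\<And>s :: nat \<Rightarrow> nat. strict_mono s \<Longrightarrow> \<exists>s'. strict_mono s' \<and> (\<lambda>n. X (s (s' n))) \<longlonglongrightarrow> x"
  shows "X \<longlonglongrightarrow> x"
proof (rule ccontr)
  assume "\<not> X \<longlonglongrightarrow> x"
  then obtain e where e: "e > 0" "\<exists>\<^sub>F n in sequentially. e \<le> dist (X n) x"
    unfolding tendsto_iff by (auto simp: not_eventually not_less)
  hence "infinite {n. e \<le> dist (X n) x}" by (simp add: frequently_cofinite[symmetric] cofinite_eq_sequentially)
  then obtain s :: "nat \<Rightarrow> nat" where s: "strict_mono s" "\<And>n. e \<le> dist (X (s n)) x"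
    using infinite_enumerate[of "{n. e \<le> dist (X n) x}"] by auto
  obtain s' where "strict_mono s'" "(\<lambda>n. X (s (s' n))) \<longlonglongrightarrow> x" using assms[OF s(1)] by blast
  hence "\<forall>\<^sub>F n in sequentially. dist (X (s (s' n))) x < e" using e(1) by (auto simp: tendsto_iff)
  thus False using s(2) by (auto simp: eventually_sequentially not_less[symmetric])
qed

text \<open>For c = 1 / \<gamma>^2 this is the limit in (b); at l = 1 + sqrt c it equals (1 + sqrt
  c)^2, so one formula covers (a) too.\<close>

definition spike_limit :: "real \<Rightarrow> real \<Rightarrow> real" where
  "spike_limit c l = l * (1 + c / (l - 1))"

lemma spike_limit_critical: "g > 0 \<Longrightarrow> spike_limit (g\<^sup>2) (1 + g) = (1 + g)\<^sup>2"
  by (simp add: spike_limit_def power2_eq_square)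

text \<open>The upper bound uses \<open>L n\<close> as a common bound for all spikes. The lower
  bound has two sources: at the threshold the unspiked rows alone produce the limit, above it one
  extremal spike is kept. The distance \<delta> from the threshold is uniform and so persists in
  subsequential limits.\<close>

lemma tends_to_zero_in_prob_spike_limit:
  fixes P :: "nat \<Rightarrow> 'a measure" and M N :: "nat \<Rightarrow> nat" and \<gamma> L :: "nat \<Rightarrow> real"
    and ell :: "nat \<Rightarrow> nat \<Rightarrow> real" and y :: "nat \<Rightarrow> nat \<Rightarrow> 'a \<Rightarrow> complex vec"
  assumes M_lim: "filterlim M at_top sequentially"
    and N_lim: "filterlim N at_top sequentially"
    and gamma: "\<And>n. \<gamma> n \<ge> 1" "\<And>n. real (M n) / real (N n) = (\<gamma> n)\<^sup>2"
    and K: "compact K" "K \<subseteq> {1..}" "\<And>n. (\<gamma> n)\<^sup>2 \<in> K"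
    and prob: "\<And>n. prob_space (P n)"
    and mean: "\<And>n. \<mu> n \<in> carrier_vec (N n)"
    and pos_def: "\<And>n. hermitian_pos_def (N n) (\<Sigma> n)"
    and gaussian: "\<And>n j. j < M n \<Longrightarrow> complex_gaussian (P n) (N n) (\<mu> n) (\<Sigma> n) (y n j)"
    and indep: "\<And>n. prob_space.indep_vars (P n) (\<lambda>j. lborel_cvec (N n)) (y n) {..<M n}"
    and r_le: "\<And>n. r \<le> N n"
    and ell_pos: "\<And>n j. j \<in> {1..N n} \<Longrightarrow> ell n j > 0"
    and ell_eigenvalues: "\<And>n. char_poly (\<Sigma> n) = (\<Prod>j=1..N n. [:- complex_of_real (ell n j), 1:])"
    and ell_one: "\<And>n j. j \<in> {r+1..N n} \<Longrightarrow> ell n j = 1"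
    and L: "\<And>n. 1 + 1 / \<gamma> n \<le> L n" "\<And>n. L n \<le> B" "\<And>n j. j \<in> {1..r} \<Longrightarrow> ell n j \<le> L n"
    and L_cases: "(\<forall>n. L n = 1 + 1 / \<gamma> n) \<or> (1 \<le> r \<and> (\<exists>\<delta>>0. \<forall>n. 1 + 1 / \<gamma> n + \<delta> \<le> L n \<and> ell n 1 = L n))"
  shows "tends_to_zero_in_prob P (\<lambda>n \<omega>.
    largest_eigenvalue (sample_covariance (N n) (M n) (\<lambda>j. y n j \<omega>)) - spike_limit (1 / (\<gamma> n)\<^sup>2) (L n))"
proof -
  define \<Lambda> where "\<Lambda> n \<omega> = largest_eigenvalue (sample_covariance (N n) (M n) (\<lambda>j. y n j \<omega>))" for n \<omega>
  define \<rho> where "\<rho> n = spike_limit (1 / (\<gamma> n)\<^sup>2) (L n)" for n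
  define e where "e n i = ell n (Suc i)" for n i
  define J where "J n = {1..<M n}" for n
  define g where "g n = gauss_matrix {..<N n} (J n)" for n
  have g2: "(\<gamma> n)\<^sup>2 \<ge> 1" for n using gamma(1)[of n] by (simp add: one_le_power)
  have Np: "N n > 0" for n using gamma(2)[of n] g2[of n] by (cases "N n = 0") auto
  have MN: "real (M n) = (\<gamma> n)\<^sup>2 * real (N n)" for n using gamma(2)[of n] Np[of n] by (simp add: field_simps)
  have NM: "N n \<le> M n" for n
  proof -
    have "1 * real (N n) \<le> real (M n)" unfolding MN using g2[of n] by (intro mult_right_mono) auto
    thus ?thesis by simp
  qed
  have Mp: "M n > 0" for n using NM[of n] Np[of n] by linarith
  have ratio: "real (N n) / real (M n) = 1 / (\<gamma> n)\<^sup>2" for n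
    unfolding MN using Np[of n] by simp
  have event: "{\<omega> \<in> space (P n). \<Lambda> n \<omega> \<le> x} \<in> sets (P n)"
    "measure (P n) {\<omega> \<in> space (P n). \<Lambda> n \<omega> \<le> x} = measure (g n) (cov_le {..<N n} (J n) (e n) (real (M n) * x))" for n x
    using measure_largest_eigenvalue_le[OF prob _ _ mean pos_def gaussian indep ell_pos ell_eigenvalues, of n x] Mp[of n] Np[of n]
    by (simp_all add: \<Lambda>_def g_def J_def e_def[abs_def] mult.commute)
  have L1: "L n > 1" for n using L(1)[of n] gamma(1)[of n] by (smt (verit) divide_pos_pos)
  have \<rho>1: "\<rho> n \<ge> 1" for n
  proof -
    have "0 \<le> 1 / (\<gamma> n)\<^sup>2 / (L n - 1)" using L1[of n] by simp
    hence "1 * 1 \<le> \<rho> n" unfolding \<rho>_def spike_limit_def using L1[of n] by (intro mult_mono) auto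
    thus ?thesis by simp
  qed
  have sub: "\<exists>s'. strict_mono s' \<and>
      (\<lambda>n. measure (g (s (s' n))) (space (g (s (s' n))) - cov_le {..<N (s (s' n))} (J (s (s' n))) (e (s (s' n))) (real (M (s (s' n))) * (\<rho> (s (s' n)) + \<epsilon>)))) \<longlonglongrightarrow> 0 \<and>
      (\<lambda>n. measure (g (s (s' n))) (cov_le {..<N (s (s' n))} (J (s (s' n))) (e (s (s' n))) (real (M (s (s' n))) * (\<rho> (s (s' n)) - \<epsilon>)))) \<longlonglongrightarrow> 0"
    if s: "strict_mono s" and \<epsilon>: "0 < \<epsilon>" "\<epsilon> \<le> 1" for s :: "nat \<Rightarrow> nat" and \<epsilon>
  proof -
    have "compact (K \<times> {1..B})" using K(1) by (intro compact_Times) auto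
    hence "seq_compact (K \<times> {1..B})" by (rule compact_imp_seq_compact)
    moreover have "((\<gamma> (s n))\<^sup>2, L (s n)) \<in> K \<times> {1..B}" for n
      using K(3)[of "s n"] L1[of "s n"] L(2)[of "s n"] by simp
    ultimately obtain p s' where p: "p \<in> K \<times> {1..B}" and s': "strict_mono s'"
      and lim: "((\<lambda>n. ((\<gamma> (s n))\<^sup>2, L (s n))) \<circ> s') \<longlonglongrightarrow> p"
      by (auto elim: seq_compactE[where f = "\<lambda>n. ((\<gamma> (s n))\<^sup>2, L (s n))"])
    define v where "v n = s (s' n)" for n
    have v: "strict_mono v" using s s' by (auto simp: v_def strict_mono_def)
    define q where "q = fst p"
    define L0 where "L0 = snd p"
    define c where "c = 1 / q"
    have q: "q \<ge> 1" using p K(2) by (auto simp: q_def)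
    have limq: "(\<lambda>n. (\<gamma> (v n))\<^sup>2) \<longlonglongrightarrow> q" and limL: "(\<lambda>n. L (v n)) \<longlonglongrightarrow> L0"
      using tendsto_fst[OF lim] tendsto_snd[OF lim] by (simp_all add: v_def q_def L0_def comp_def)
    have c: "0 < c" "c \<le> 1" using q by (auto simp: c_def)
    have limc: "(\<lambda>n. 1 / (\<gamma> (v n))\<^sup>2) \<longlonglongrightarrow> c" unfolding c_def using q by (intro tendsto_intros limq) auto
    have limg: "(\<lambda>n. 1 / \<gamma> (v n)) \<longlonglongrightarrow> sqrt c"
    proof -
      have "(\<lambda>n. sqrt (1 / (\<gamma> (v n))\<^sup>2)) \<longlonglongrightarrow> sqrt c" by (intro tendsto_intros limc)
      moreover have "sqrt (1 / (\<gamma> (v n))\<^sup>2) = 1 / \<gamma> (v n)" for n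
        using gamma(1)[of "v n"] by (simp add: real_sqrt_divide)
      ultimately show ?thesis by simp
    qed
    have L0: "1 + sqrt c \<le> L0"
      by (rule LIMSEQ_le[OF tendsto_add[OF tendsto_const limg] limL]) (use L(1) in auto)
    have sc: "sqrt c > 0" using c by simp
    have L01: "L0 > 1" using L0 sc by linarith
    have lim\<rho>: "(\<lambda>n. \<rho> (v n)) \<longlonglongrightarrow> spike_limit c L0"
      unfolding \<rho>_def spike_limit_def using L01 by (intro tendsto_intros limL limc) auto
    have Mv: "filterlim (\<lambda>n. M (v n)) at_top sequentially"
      by (rule filterlim_compose[OF M_lim filterlim_subseq[OF v]])
    have Nv: "filterlim (\<lambda>n. N (v n)) at_top sequentially"
      by (rule filterlim_compose[OF N_lim filterlim_subseq[OF v]])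
    have limNM: "(\<lambda>n. real (N (v n)) / real (M (v n))) \<longlonglongrightarrow> c" unfolding ratio by (rule limc)
    have upper: "(\<lambda>n. measure (g (v n)) (space (g (v n)) - cov_le {..<N (v n)} (J (v n)) (e (v n)) (real (M (v n)) * (\<rho> (v n) + \<epsilon>)))) \<longlonglongrightarrow> 0"
      unfolding g_def
    proof (rule cov_le_upper_tendsto[OF Mv NM r_le limNM _ limL L01])
      show "(\<lambda>n. \<rho> (v n) + \<epsilon>) \<longlonglongrightarrow> spike_limit c L0 + \<epsilon>" by (intro tendsto_intros lim\<rho>)
      show "L0 * (1 + c / (L0 - 1)) < spike_limit c L0 + \<epsilon>" using \<epsilon> by (simp add: spike_limit_def)
      show "0 < e (v n) i \<and> e (v n) i \<le> L (v n)" if "i < r" for n i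
        using that L(3)[of "Suc i" "v n"] ell_pos[of "Suc i" "v n"] r_le[of "v n"] by (simp add: e_def)
      show "e (v n) i = 1" if "r \<le> i" "i < N (v n)" for n i
        using that ell_one[of "Suc i" "v n"] by (simp add: e_def)
    qed (use c in \<open>auto simp: J_def\<close>)
    have lim\<tau>: "(\<lambda>n. \<rho> (v n) - \<epsilon>) \<longlonglongrightarrow> spike_limit c L0 - \<epsilon>" by (intro tendsto_intros lim\<rho>)
    have Nr: "\<forall>\<^sub>F n in sequentially. r < N (v n)" using Nv unfolding filterlim_at_top by (auto simp: Suc_le_eq[symmetric])
    have Jv: "finite (J (v n))" "M (v n) \<le> card (J (v n)) + 1" for n by (auto simp: J_def)
    have lower: "(\<lambda>n. measure (g (v n)) (cov_le {..<N (v n)} (J (v n)) (e (v n)) (real (M (v n)) * (\<rho> (v n) - \<epsilon>)))) \<longlonglongrightarrow> 0"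
      using L_cases
    proof
      assume crit: "\<forall>n. L n = 1 + 1 / \<gamma> n"
      have "(\<lambda>n. L (v n)) \<longlonglongrightarrow> 1 + sqrt c" using crit by (auto intro!: tendsto_intros limg)
      hence "L0 = 1 + sqrt c" using limL LIMSEQ_unique by blast
      hence sl: "spike_limit c L0 = (1 + sqrt c)\<^sup>2" using spike_limit_critical[OF sc] c by simp
      define t0 where "t0 = spike_limit c L0 - \<epsilon> / 2"
      have "t0 < (1 + sqrt c)\<^sup>2" using \<epsilon> by (simp add: t0_def sl)
      from decrease_null[OF c(1) this] obtain a b \<eta> where ab: "0 \<le> a" "a < 1" "0 \<le> b" "b < c" "\<eta> > 0"
        and decr: "\<And>w. a < w \<Longrightarrow> t0 + \<eta> \<le> w + b * w / (w - a)" by blast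
      have "\<forall>\<^sub>F n in sequentially. \<rho> (v n) - \<epsilon> < t0"
        using \<epsilon> by (intro order_tendstoD(2)[OF lim\<tau>]) (auto simp: t0_def)
      hence ev\<tau>: "\<forall>\<^sub>F n in sequentially. 0 \<le> \<rho> (v n) - \<epsilon> \<and> \<rho> (v n) - \<epsilon> \<le> t0 \<and> (1::real) \<le> 1 \<and> (\<rho> (v n) - \<epsilon>) / 1 \<le> t0"
      proof eventually_elim
        case (elim n)
        thus ?case using \<rho>1[of "v n"] \<epsilon> by simp
      qed
      \<comment> \<open>All spiked rows are dropped. Row \<open>r\<close> stands in as the
        distinguished row with l = 1, so the orbit starts at \<tau> itself.\<close>
      have evI: "\<forall>\<^sub>F n in sequentially. {r..<N (v n)} \<subseteq> {..<N (v n)} \<and> r \<in> {r..<N (v n)} \<and> N (v n) - r \<le> card {r..<N (v n)}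
         \<and> e (v n) r = 1 \<and> (\<forall>i\<in>{r..<N (v n)} - {r}. e (v n) i = 1)"
        using Nr by eventually_elim (auto simp: e_def intro!: ell_one)
      show ?thesis unfolding g_def
        by (rule cov_le_lower_tendsto[where l = "\<lambda>_. 1" and ?w0.0 = t0 and r = r, OF Mv limNM c(2) ab(1-4) decr ab(5) ev\<tau> evI Jv])
    next
      assume "1 \<le> r \<and> (\<exists>\<delta>>0. \<forall>n. 1 + 1 / \<gamma> n + \<delta> \<le> L n \<and> ell n 1 = L n)"
      then obtain \<delta> where r: "1 \<le> r" and \<delta>: "\<delta> > 0" "\<And>n. 1 + 1 / \<gamma> n + \<delta> \<le> L n" "\<And>n. ell n 1 = L n" by blast
      have "1 + sqrt c + \<delta> \<le> L0"
        by (rule LIMSEQ_le[OF tendsto_add[OF tendsto_add[OF tendsto_const limg] tendsto_const] limL]) (use \<delta>(2) in auto)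
      hence "sqrt c < L0 - 1" using \<delta>(1) by linarith
      hence "(sqrt c)\<^sup>2 < (L0 - 1)\<^sup>2" using sc by (intro power_strict_mono) auto
      hence cL: "c < (L0 - 1)\<^sup>2" using c by simp
      \<comment> \<open>The limit of the starting value \<tau> / l of the orbit.\<close>
      define q where "q = (spike_limit c L0 - \<epsilon>) / L0"
      have q: "q < 1 + c / (L0 - 1)" using L01 \<epsilon> by (simp add: q_def spike_limit_def pos_divide_less_eq mult.commute)
      from decrease_spiked[OF c(1) L01 cL q] obtain a b w0 \<eta> where ab: "0 \<le> a" "a < 1" "0 \<le> b" "b < c" "\<eta> > 0" "q < w0"
        and decr: "\<And>w. a < w \<Longrightarrow> w \<le> w0 \<Longrightarrow> L0 * w0 + \<eta> \<le> w + b * w / (w - a)" by blast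
      have "\<forall>\<^sub>F n in sequentially. \<rho> (v n) - \<epsilon> < L0 * w0"
        using ab(6) L01 by (intro order_tendstoD(2)[OF lim\<tau>]) (simp add: q_def pos_divide_less_eq mult.commute)
      moreover have "\<forall>\<^sub>F n in sequentially. (\<rho> (v n) - \<epsilon>) / L (v n) < w0"
        using ab(6) L01 unfolding q_def by (intro order_tendstoD(2)[OF tendsto_divide[OF lim\<tau> limL]]) auto
      ultimately have ev\<tau>: "\<forall>\<^sub>F n in sequentially. 0 \<le> \<rho> (v n) - \<epsilon> \<and> \<rho> (v n) - \<epsilon> \<le> L0 * w0 \<and> 1 \<le> L (v n) \<and> (\<rho> (v n) - \<epsilon>) / L (v n) \<le> w0"
      proof eventually_elim
        case (elim n)
        thus ?case using \<rho>1[of "v n"] \<epsilon> L1[of "v n"] by simp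
      qed
      \<comment> \<open>Row 0 carries the spike \<open>ell n 1\<close>; the rows from 1 to r - 1 are
        dropped.\<close>
      have evI: "\<forall>\<^sub>F n in sequentially. insert 0 {r..<N (v n)} \<subseteq> {..<N (v n)} \<and> 0 \<in> insert 0 {r..<N (v n)} \<and> N (v n) - r \<le> card (insert 0 {r..<N (v n)})
         \<and> e (v n) 0 = L (v n) \<and> (\<forall>i\<in>insert 0 {r..<N (v n)} - {0}. e (v n) i = 1)"
        using Nr by eventually_elim (use r \<delta>(3) in \<open>auto simp: e_def card_insert_if intro!: ell_one\<close>)
      show ?thesis unfolding g_def
        by (rule cov_le_lower_tendsto[where l = "\<lambda>n. L (v n)" and r = r, OF Mv limNM c(2) ab(1-4) decr ab(5) ev\<tau> evI Jv])
    qed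
    show ?thesis using s' upper lower unfolding v_def by blast
  qed
  have meas: "\<Lambda> n \<in> borel_measurable (P n)" for n
    unfolding borel_measurable_iff_le using event(1) by blast
  have small: "(\<lambda>n. measure (P n) {\<omega> \<in> space (P n). \<epsilon> < \<bar>\<Lambda> n \<omega> - \<rho> n\<bar>}) \<longlonglongrightarrow> 0" if \<epsilon>: "0 < \<epsilon>" "\<epsilon> \<le> 1" for \<epsilon>
  proof -
    define U where "U n = measure (g n) (space (g n) - cov_le {..<N n} (J n) (e n) (real (M n) * (\<rho> n + \<epsilon>)))" for n
    define V where "V n = measure (g n) (cov_le {..<N n} (J n) (e n) (real (M n) * (\<rho> n - \<epsilon>)))" for n
    have lim: "(\<lambda>n. U n + V n) \<longlonglongrightarrow> 0"
    proof (rule LIMSEQ_by_subsequences)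
      fix s :: "nat \<Rightarrow> nat" assume "strict_mono s"
      from sub[OF this \<epsilon>] obtain s' where "strict_mono s'" "(\<lambda>n. U (s (s' n))) \<longlonglongrightarrow> 0" "(\<lambda>n. V (s (s' n))) \<longlonglongrightarrow> 0"
        unfolding U_def V_def by blast
      thus "\<exists>s'. strict_mono s' \<and> (\<lambda>n. U (s (s' n)) + V (s (s' n))) \<longlonglongrightarrow> 0"
        using tendsto_add[of "\<lambda>n. U (s (s' n))" 0 sequentially "\<lambda>n. V (s (s' n))" 0] by auto
    qed
    have le: "measure (P n) {\<omega> \<in> space (P n). \<epsilon> < \<bar>\<Lambda> n \<omega> - \<rho> n\<bar>} \<le> U n + V n" for n
    proof -
      interpret prob_space "P n" by (rule prob)
      interpret g: prob_space "g n" unfolding g_def by (rule prob_space_PiM_cgauss)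
      let ?A = "\<lambda>x. {\<omega> \<in> space (P n). \<Lambda> n \<omega> \<le> x}"
      have [measurable]: "?A x \<in> sets (P n)" for x by (rule event(1))
      have "measure (P n) {\<omega> \<in> space (P n). \<epsilon> < \<bar>\<Lambda> n \<omega> - \<rho> n\<bar>} \<le> measure (P n) ((space (P n) - ?A (\<rho> n + \<epsilon>)) \<union> ?A (\<rho> n - \<epsilon>))"
        by (rule finite_measure_mono) auto
      also have "\<dots> \<le> measure (P n) (space (P n) - ?A (\<rho> n + \<epsilon>)) + measure (P n) (?A (\<rho> n - \<epsilon>))"
        by (rule measure_Un_le) auto
      also have "measure (P n) (space (P n) - ?A (\<rho> n + \<epsilon>)) = 1 - measure (P n) (?A (\<rho> n + \<epsilon>))"
        by (rule prob_compl) auto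
      also have "\<dots> = U n"
        unfolding event(2) U_def g_def by (rule prob_space.prob_compl[OF prob_space_PiM_cgauss sets_cov_le, symmetric]) simp
      also have "measure (P n) (?A (\<rho> n - \<epsilon>)) = V n" unfolding event(2) V_def ..
      finally show ?thesis .
    qed
    show ?thesis by (rule tendsto_sandwich[OF _ _ tendsto_const lim]) (simp_all add: le)
  qed
  \<comment> \<open>Capping the deviation at 1 keeps the level \<rho> - \<epsilon> nonnegative, as
    \<rho> \<ge> 1; larger deviations are rarer.\<close>
  have "(\<lambda>n. measure (P n) {\<omega> \<in> space (P n). \<epsilon> < \<bar>\<Lambda> n \<omega> - \<rho> n\<bar>}) \<longlonglongrightarrow> 0" if \<epsilon>: "0 < \<epsilon>" for \<epsilon>
  proof (rule tendsto_sandwich[OF _ _ tendsto_const])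
    show "(\<lambda>n. measure (P n) {\<omega> \<in> space (P n). min \<epsilon> 1 < \<bar>\<Lambda> n \<omega> - \<rho> n\<bar>}) \<longlonglongrightarrow> 0"
      using \<epsilon> by (intro small) auto
    have "measure (P n) {\<omega> \<in> space (P n). \<epsilon> < \<bar>\<Lambda> n \<omega> - \<rho> n\<bar>} \<le> measure (P n) {\<omega> \<in> space (P n). min \<epsilon> 1 < \<bar>\<Lambda> n \<omega> - \<rho> n\<bar>}" for n
    proof -
      interpret prob_space "P n" by (rule prob)
      have [measurable]: "\<Lambda> n \<in> borel_measurable (P n)" by (rule meas)
      show ?thesis by (rule finite_measure_mono) (auto, measurable)
    qed
    thus "\<forall>\<^sub>F n in sequentially. measure (P n) {\<omega> \<in> space (P n). \<epsilon> < \<bar>\<Lambda> n \<omega> - \<rho> n\<bar>}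
      \<le> measure (P n) {\<omega> \<in> space (P n). min \<epsilon> 1 < \<bar>\<Lambda> n \<omega> - \<rho> n\<bar>}" by simp
  qed auto
  moreover have "(\<lambda>\<omega>. \<Lambda> n \<omega> - \<rho> n) \<in> borel_measurable (P n)" for n using meas[of n] by simp
  ultimately show ?thesis unfolding tends_to_zero_in_prob_def \<Lambda>_def \<rho>_def by blast
qed

theorem corollary1p1:
  fixes P :: "nat \<Rightarrow> 'a measure"
    and M N :: "nat \<Rightarrow> nat"
    and \<gamma> :: "nat \<Rightarrow> real"
    and ell :: "nat \<Rightarrow> nat \<Rightarrow> real"
    and \<mu> :: "nat \<Rightarrow> complex vec"
    and \<Sigma> :: "nat \<Rightarrow> complex mat"
    and y :: "nat \<Rightarrow> nat \<Rightarrow> 'a \<Rightarrow> complex vec"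
    and r :: nat
    and K :: "real set"
  assumes M_lim: "filterlim M at_top sequentially"
    and N_lim: "filterlim N at_top sequentially"
    and gamma: "\<And>n. \<gamma> n \<ge> 1" "\<And>n. real (M n) / real (N n) = (\<gamma> n)\<^sup>2"
    and K: "compact K" "K \<subseteq> {1..}" "\<And>n. (\<gamma> n)\<^sup>2 \<in> K"
    and prob: "\<And>n. prob_space (P n)"
    and mean: "\<And>n. \<mu> n \<in> carrier_vec (N n)"
    and pos_def: "\<And>n. hermitian_pos_def (N n) (\<Sigma> n)"
    and gaussian: "\<And>n j. j < M n \<Longrightarrow> complex_gaussian (P n) (N n) (\<mu> n) (\<Sigma> n) (y n j)"
    and indep: "\<And>n. prob_space.indep_vars (P n) (\<lambda>j. lborel_cvec (N n)) (y n) {..<M n}"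
    and r_le: "\<And>n. r \<le> N n"
    and ell_pos: "\<And>n j. j \<in> {1..N n} \<Longrightarrow> ell n j > 0"
    and ell_eigenvalues:
      "\<And>n. char_poly (\<Sigma> n) = (\<Prod>j=1..N n. [:- complex_of_real (ell n j), 1:])"
    and ell_one: "\<And>n j. j \<in> {r+1..N n} \<Longrightarrow> ell n j = 1"
  shows
    "(\<forall>k\<le>r.
        (\<forall>n. \<forall>j\<in>{1..k}. ell n j = 1 + 1 / \<gamma> n) \<and>
        (\<exists>\<delta>>0. \<forall>n. \<forall>j\<in>{k+1..r}. \<delta> \<le> ell n j \<and> ell n j \<le> 1 + 1 / \<gamma> n - \<delta>)
        \<longrightarrow> tends_to_zero_in_prob P (\<lambda>n \<omega>.
              largest_eigenvalue (sample_covariance (N n) (M n) (\<lambda>j. y n j \<omega>)) - (1 + 1 / \<gamma> n)\<^sup>2))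
     \<and>
     (\<forall>k\<in>{1..r}.
        (\<forall>n. \<forall>j\<in>{1..k}. ell n j = ell n 1) \<and>
        (\<exists>\<delta>>0. \<exists>B. \<forall>n. 1 + 1 / \<gamma> n + \<delta> \<le> ell n 1 \<and> ell n 1 \<le> B) \<and>
        (\<exists>\<delta>>0. \<forall>n. \<forall>j\<in>{k+1..r}. \<delta> \<le> ell n j \<and> ell n j \<le> ell n 1 - \<delta>)
        \<longrightarrow> tends_to_zero_in_prob P (\<lambda>n \<omega>.
              largest_eigenvalue (sample_covariance (N n) (M n) (\<lambda>j. y n j \<omega>))
                - ell n 1 * (1 + (1 / (\<gamma> n)\<^sup>2) / (ell n 1 - 1))))"
proof (intro conjI allI ballI impI)
  note main = tends_to_zero_in_prob_spike_limit[OF M_lim N_lim gamma K prob mean pos_def gaussian indep r_le ell_pos ell_eigenvalues ell_one]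
  have g0: "1 / \<gamma> n > 0" "1 / \<gamma> n \<le> 1" for n using gamma(1)[of n] by (auto simp: divide_le_eq)
  {
    fix k assume k: "k \<le> r"
      and H: "(\<forall>n. \<forall>j\<in>{1..k}. ell n j = 1 + 1 / \<gamma> n) \<and>
        (\<exists>\<delta>>0. \<forall>n. \<forall>j\<in>{k+1..r}. \<delta> \<le> ell n j \<and> ell n j \<le> 1 + 1 / \<gamma> n - \<delta>)"
    then obtain \<delta> where \<delta>: "\<delta> > 0" "\<And>n j. j \<in> {k+1..r} \<Longrightarrow> ell n j \<le> 1 + 1 / \<gamma> n - \<delta>" by blast
    have "ell n j \<le> 1 + 1 / \<gamma> n" if "j \<in> {1..r}" for n j
    proof (cases "j \<le> k")
      case True
      thus ?thesis using H that by auto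
    next
      case False
      thus ?thesis using \<delta>(1) \<delta>(2)[of j n] that by auto
    qed
    \<comment> \<open>The common bound is the threshold itself, also when k = 0 and every spike is
      smaller; \<gamma> \<ge> 1 makes 2 a bound for it.\<close>
    hence "tends_to_zero_in_prob P (\<lambda>n \<omega>.
        largest_eigenvalue (sample_covariance (N n) (M n) (\<lambda>j. y n j \<omega>)) - spike_limit (1 / (\<gamma> n)\<^sup>2) (1 + 1 / \<gamma> n))"
      using g0 by (intro main[where B = 2]) auto
    moreover have "spike_limit (1 / (\<gamma> n)\<^sup>2) (1 + 1 / \<gamma> n) = (1 + 1 / \<gamma> n)\<^sup>2" for n
      using spike_limit_critical[OF g0(1), of n] by (simp add: power_divide)
    ultimately show "tends_to_zero_in_prob P (\<lambda>n \<omega>.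
        largest_eigenvalue (sample_covariance (N n) (M n) (\<lambda>j. y n j \<omega>)) - (1 + 1 / \<gamma> n)\<^sup>2)" by simp
  next
    fix k assume k: "k \<in> {1..r}"
      and H: "(\<forall>n. \<forall>j\<in>{1..k}. ell n j = ell n 1) \<and>
        (\<exists>\<delta>>0. \<exists>B. \<forall>n. 1 + 1 / \<gamma> n + \<delta> \<le> ell n 1 \<and> ell n 1 \<le> B) \<and>
        (\<exists>\<delta>>0. \<forall>n. \<forall>j\<in>{k+1..r}. \<delta> \<le> ell n j \<and> ell n j \<le> ell n 1 - \<delta>)"
    note H1 = H[THEN conjunct1] and H2 = H[THEN conjunct2, THEN conjunct1] and H3 = H[THEN conjunct2, THEN conjunct2]
    obtain \<delta> B where \<delta>: "\<delta> > 0" "\<And>n. 1 + 1 / \<gamma> n + \<delta> \<le> ell n 1 \<and> ell n 1 \<le> B" using H2 by blast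
    obtain \<delta>' where "\<delta>' > 0 \<and> (\<forall>n. \<forall>j\<in>{k+1..r}. \<delta>' \<le> ell n j \<and> ell n j \<le> ell n 1 - \<delta>')" using H3 by (elim exE)
    hence \<delta>': "\<delta>' > 0" "\<And>n j. j \<in> {k+1..r} \<Longrightarrow> ell n j \<le> ell n 1 - \<delta>'" by simp_all
    have le: "ell n j \<le> ell n 1" if "j \<in> {1..r}" for n j
    proof (cases "j \<le> k")
      case True
      thus ?thesis using H1[rule_format, of j n] that by simp
    next
      case False
      thus ?thesis using \<delta>'(1) \<delta>'(2)[of j n] that by auto
    qed
    have "1 + 1 / \<gamma> n \<le> ell n 1" "ell n 1 \<le> B" for n using \<delta>(1) \<delta>(2)[of n] by auto
    hence "tends_to_zero_in_prob P (\<lambda>n \<omega>.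
        largest_eigenvalue (sample_covariance (N n) (M n) (\<lambda>j. y n j \<omega>)) - spike_limit (1 / (\<gamma> n)\<^sup>2) (ell n 1))"
      using le k \<delta> by (intro main[where B = B]) auto
    thus "tends_to_zero_in_prob P (\<lambda>n \<omega>.
        largest_eigenvalue (sample_covariance (N n) (M n) (\<lambda>j. y n j \<omega>))
          - ell n 1 * (1 + (1 / (\<gamma> n)\<^sup>2) / (ell n 1 - 1)))"
      unfolding spike_limit_def .
  }
qed

end
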